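(* Let $\mathcal{X}$ and $\mathcal{Y}$ be finite sets, let $P_X,P_Y$ be probability distributions whose supports are $\mathcal{X}$ and $\mathcal{Y}$ respectively, and let $c:\mathcal{X}\times\mathcal{Y}\to[0,+\infty)$ be a (finite) cost function. Assume $\alpha_0:=\mathcal{E}(P_X,P_Y)$ satisfies $\min_{x,y}c(x,y)<\alpha_0<\max_{x,y}c(x,y)$. Then for every $\Delta\in\mathbb{R}$, $$\Lambda_\Delta(P_X,P_Y)\le\liminf_{n\to\infty}\mathcal{G}^{(n)}_{\alpha_0+\Delta/\sqrt n}(P_X,P_Y)\le\limsup_{n\to\infty}\mathcal{G}^{(n)}_{\alpha_0+\Delta/\sqrt n}(P_X,P_Y)\le\lim_{\Delta'\uparrow\Delta}\Lambda_{\Delta'}(P_X,P_Y),$$ where $$\Lambda_\Delta(P_X,P_Y):=\min_{\Psi\in\Pi(\Phi_{P_X},\Phi_{P_Y})}\Psi\{(\beta_X,\beta_Y):\theta(\beta_X,\beta_Y)>\Delta\}.$$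
   Context: $\Pi(P,Q)$ denotes the set of couplings of $P,Q$ (probability measures on the product space with marginals $P$ and $Q$). Optimal transport cost: $\mathcal{E}(Q_X,Q_Y):=\min_{Q_{XY}\in\Pi(Q_X,Q_Y)}\mathbb{E}_{(X,Y)\sim Q_{XY}}[c(X,Y)]$. $c_n(x^n,y^n):=\frac1n\sum_{i=1}^n c(x_i,y_i)$, and $\mathcal{G}_{\alpha}^{(n)}(P_X,P_Y):=\min_{P_{X^nY^n}\in\Pi(P_X^{\otimes n},P_Y^{\otimes n})}\mathbb{P}_{(X^n,Y^n)\sim P_{X^nY^n}}\{c_n(X^n,Y^n)>\alpha\}$. $\mathbb{S}_X:=\{\beta_X\in\mathbb{R}^{|\mathcal{X}|}:\sum_x\beta_X(x)=0\}$, and $\mathbb{S}_Y$ is defined analogously for $\mathcal{Y}$. Fix an optimal coupling $P_{XY}^*$ attaining $\mathcal{E}(P_X,P_Y)$ and let $\mathcal{S}\subseteq\mathcal{X}\times\mathcal{Y}$ be its support. For $\beta_X\in\mathbb{S}_X,\beta_Y\in\mathbb{S}_Y$, $$\theta(\beta_X,\beta_Y):=\min_{\beta_{XY}\in\overline{\Pi}(\beta_X,\beta_Y):\ \{(x,y):\beta_{XY}(x,y)<0\}\subseteq\mathcal{S}}\ \sum_{x,y}\beta_{XY}(x,y)c(x,y),$$ where $\overline{\Pi}(\beta_X,\beta_Y)$ is the set of signed measures on $\mathcal{X}\times\mathcal{Y}$ whose $X$- and $Y$-marginals are $\beta_X$ and $\beta_Y$. (The function $\theta$ does not depend on the choice of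 $P^*_{XY}$.) $\Phi_{P_X}$ is the (degenerate) centered Gaussian measure on $\mathbb{R}^{|\mathcal{X}|}$ with covariance matrix $[P_X(x)\mathbf{1}\{x=x'\}-P_X(x)P_X(x')]_{(x,x')\in\mathcal{X}^2}$; it is concentrated on $\mathbb{S}_X$ and is regarded as a measure on $\mathbb{S}_X$. $\Phi_{P_Y}$ is defined analogously on $\mathbb{S}_Y$. *)

theory Defs
  imports "HOL-Probability.Probability"
begin

section \<open>Couplings and optimal transport\<close>

definition couplings :: "'a measure \<Rightarrow> 'b measure \<Rightarrow> ('a \<times> 'b) measure set" where
  "couplings M N = {Q. prob_space Q \<and> sets Q = sets (M \<Otimes>\<^sub>M N) \<and>
     distr Q M fst = M \<and> distr Q N snd = N}"

definition transport_cost :: "('a \<Rightarrow> 'b \<Rightarrow> real) \<Rightarrow> ('a \<times> 'b) measure \<Rightarrow> real" where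
  "transport_cost c Q = (\<integral>z. c (fst z) (snd z) \<partial>Q)"

text \<open>
  Minima over couplings and over signed couplings are written as infima of sets of reals. In the
  situation of interest (finite alphabets, full supports, an optimal coupling) these sets are
  nonempty and bounded below, and the infima are attained.
\<close>

definition OT :: "('a \<Rightarrow> 'b \<Rightarrow> real) \<Rightarrow> 'a pmf \<Rightarrow> 'b pmf \<Rightarrow> real" where
  "OT c P Q = (INF R\<in>couplings (measure_pmf P) (measure_pmf Q). transport_cost c R)"

definition optimal_coupling ::
    "('a \<Rightarrow> 'b \<Rightarrow> real) \<Rightarrow> 'a pmf \<Rightarrow> 'b pmf \<Rightarrow> ('a \<times> 'b) measure \<Rightarrow> bool" where
  "optimal_coupling c P Q R \<longleftrightarrow>
     R \<in> couplings (measure_pmf P) (measure_pmf Q) \<and>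
     (\<forall>R'\<in>couplings (measure_pmf P) (measure_pmf Q). transport_cost c R \<le> transport_cost c R')"

text \<open>The support of a measure on a finite discrete space.\<close>

definition atoms :: "'a measure \<Rightarrow> 'a set" where
  "atoms M = {x. measure M {x} > 0}"

definition avg_cost ::
    "('a \<Rightarrow> 'b \<Rightarrow> real) \<Rightarrow> nat \<Rightarrow> (nat \<Rightarrow> 'a) \<Rightarrow> (nat \<Rightarrow> 'b) \<Rightarrow> real" where
  "avg_cost c n x y = (\<Sum>i<n. c (x i) (y i)) / real n"

definition iid :: "nat \<Rightarrow> 'a pmf \<Rightarrow> (nat \<Rightarrow> 'a) measure" where
  "iid n P = (\<Pi>\<^sub>M i\<in>{..<n}. measure_pmf P)"

definition excess_prob ::
    "('a \<Rightarrow> 'b \<Rightarrow> real) \<Rightarrow> 'a pmf \<Rightarrow> 'b pmf \<Rightarrow> nat \<Rightarrow> real \<Rightarrow> real" where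
  "excess_prob c P Q n \<alpha> = (INF R\<in>couplings (iid n P) (iid n Q).
     measure R {z \<in> space R. avg_cost c n (fst z) (snd z) > \<alpha>})"


section \<open>Signed couplings and the function \<open>\<theta>\<close>\<close>

definition zero_sum :: "(real ^ 'a::finite) set" where
  "zero_sum = {\<beta>. (\<Sum>x\<in>UNIV. \<beta> $ x) = 0}"

definition signed_couplings ::
    "real ^ 'a::finite \<Rightarrow> real ^ 'b::finite \<Rightarrow> (real ^ ('a \<times> 'b)) set" where
  "signed_couplings \<beta>X \<beta>Y = {B. (\<forall>x. (\<Sum>y\<in>UNIV. B $ (x, y)) = \<beta>X $ x) \<and>
     (\<forall>y. (\<Sum>x\<in>UNIV. B $ (x, y)) = \<beta>Y $ y)}"

definition theta :: "('a::finite \<Rightarrow> 'b::finite \<Rightarrow> real) \<Rightarrow> ('a \<times> 'b) set \<Rightarrow>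
    real ^ 'a \<Rightarrow> real ^ 'b \<Rightarrow> real" where
  "theta c S \<beta>X \<beta>Y =
     (INF B\<in>{B \<in> signed_couplings \<beta>X \<beta>Y. {z. B $ z < 0} \<subseteq> S}.
        \<Sum>(x, y)\<in>UNIV. B $ (x, y) * c x y)"


section \<open>Degenerate Gaussian measures\<close>

text \<open>
  The centered Gaussian measure with covariance \<open>\<Sigma>\<close> is the law of \<open>A *v Z\<close>, where \<open>Z\<close> has
  independent standard normal coordinates and \<open>A ** transpose A = \<Sigma>\<close>. By the lemma
  \<open>char_centered_gaussian\<close> below, its characteristic function does not depend on the choice
  of \<open>A\<close>; hence neither does the law.
\<close>

definition centered_gaussian :: "real ^ 'a ^ 'a \<Rightarrow> (real ^ 'a::finite) measure" where
  "centered_gaussian \<Sigma> =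
     distr (\<Pi>\<^sub>M i\<in>UNIV. std_normal_distribution) borel
       (\<lambda>z. (SOME A :: real ^ 'a ^ 'a. A ** transpose A = \<Sigma>) *v (\<chi> i. z i))"

definition cov_matrix :: "'a::finite pmf \<Rightarrow> real ^ 'a ^ 'a" where
  "cov_matrix P = (\<chi> x x'. pmf P x * of_bool (x = x') - pmf P x * pmf P x')"

definition Phi :: "'a::finite pmf \<Rightarrow> (real ^ 'a) measure" where
  "Phi P = restrict_space (centered_gaussian (cov_matrix P)) zero_sum"

lemma cov_matrix_factorization:
  "\<exists>A :: real ^ 'a ^ 'a. A ** transpose A = cov_matrix (P :: 'a::finite pmf)"
proof
  define r where "r x = sqrt (pmf P x)" for x
  have p: "pmf P x = r x * r x" for x
    by (simp add: r_def)
  have s1: "(\<Sum>z\<in>UNIV. r z * r z) = 1"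
    using sum_pmf_eq_1[of UNIV P] by (simp add: p)
  let ?A = "(\<chi> x z. of_bool (x = z) * r x - r x * r x * r z) :: real ^ 'a ^ 'a"
  have "(\<Sum>z\<in>UNIV. (of_bool (x = z) * r x - r x * r x * r z) *
        (of_bool (y = z) * r y - r y * r y * r z)) =
      r x * r x * of_bool (x = y) - r x * r x * (r y * r y)" (is "?l = ?r") for x y
  proof -
    have "?l = (\<Sum>z\<in>UNIV. (if x = z then of_bool (y = x) * r x * r y - r x * r x * r y * r y else 0)
        - (if y = z then r x * r x * r y * r y else 0) + r x * r x * r y * r y * (r z * r z))"
      by (intro sum.cong refl) (auto simp: of_bool_def right_diff_distrib left_diff_distrib mult_ac)
    also have "\<dots> = of_bool (y = x) * r x * r y - r x * r x * r y * r y - r x * r x * r y * r y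
        + r x * r x * r y * r y * (\<Sum>z\<in>UNIV. r z * r z)"
      by (simp only: sum.distrib sum_subtractf sum_distrib_left) simp
    also have "\<dots> = ?r"
      by (simp only: s1) (auto simp: of_bool_def mult_ac)
    finally show ?thesis .
  qed
  then show "?A ** transpose ?A = cov_matrix P"
    by (simp add: matrix_matrix_mult_def transpose_def cov_matrix_def vec_eq_iff p)
qed

lemma measurable_matrix_chi:
  "(\<lambda>z. (A :: real ^ 'a ^ 'a) *v (\<chi> i. z i)) \<in>
     (\<Pi>\<^sub>M i\<in>(UNIV :: 'a::finite set). std_normal_distribution) \<rightarrow>\<^sub>M borel"
proof -
  have "(\<lambda>z. (A *v (\<chi> i. z i)) \<bullet> b) \<in>
     (\<Pi>\<^sub>M i\<in>(UNIV :: 'a set). std_normal_distribution) \<rightarrow>\<^sub>M borel" for b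
  proof -
    have "(\<lambda>z. \<Sum>i\<in>UNIV. (\<Sum>j\<in>UNIV. A $ i $ j * z j) * b $ i) \<in>
        (\<Pi>\<^sub>M i\<in>(UNIV :: 'a set). std_normal_distribution) \<rightarrow>\<^sub>M borel"
    proof -
      have [measurable]: "(\<lambda>z. z j) \<in> 
         (\<Pi>\<^sub>M i\<in>(UNIV :: 'a set). std_normal_distribution) \<rightarrow>\<^sub>M borel" for j
        using measurable_component_singleton[of j UNIV "\<lambda>_. std_normal_distribution"] by simp
      show ?thesis by measurable
    qed
    then show ?thesis
      by (simp add: inner_vec_def matrix_vector_mult_def)
  qed
  then show ?thesis
    by (subst borel_measurable_euclidean_space) auto
qed

lemma char_centered_gaussian:
  fixes \<Sigma> :: "real ^ 'a::finite ^ 'a"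
  assumes "\<exists>A :: real ^ 'a ^ 'a. A ** transpose A = \<Sigma>"
  shows "(\<integral>\<beta>. iexp (t \<bullet> \<beta>) \<partial>centered_gaussian \<Sigma>) = exp (- complex_of_real (t \<bullet> (\<Sigma> *v t)) / 2)"
proof -
  let ?N = "\<Pi>\<^sub>M i\<in>(UNIV :: 'a set). std_normal_distribution"
  define A where "A = (SOME A :: real ^ 'a ^ 'a. A ** transpose A = \<Sigma>)"
  have A: "A ** transpose A = \<Sigma>"
    using someI_ex[OF assms] by (simp add: A_def)
  define s where "s = t v* A"
  interpret product_sigma_finite "\<lambda>_ :: 'a. std_normal_distribution"
    unfolding product_sigma_finite_def
    by (intro allI prob_space_imp_sigma_finite prob_space_normal_density) simp
  have "(\<integral>\<beta>. iexp (t \<bullet> \<beta>) \<partial>centered_gaussian \<Sigma>) = (\<integral>z. iexp (t \<bullet> (A *v (\<chi> i. z i))) \<partial>?N)"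
    unfolding centered_gaussian_def A_def[symmetric]
    by (intro integral_distr measurable_matrix_chi) measurable
  also have "\<dots> = (\<integral>z. (\<Prod>i\<in>UNIV. iexp (s $ i * z i)) \<partial>?N)"
  proof -
    have "t \<bullet> (A *v v) = (\<Sum>i\<in>UNIV. s $ i * v $ i)" for v
      by (simp only: dot_lmul_matrix[symmetric] s_def[symmetric]) (simp add: inner_vec_def)
    then show ?thesis
      by (simp add: exp_sum sum_distrib_left)
  qed
  also have "\<dots> = (\<Prod>i\<in>UNIV. \<integral>x. iexp (s $ i * x) \<partial>std_normal_distribution)"
  proof (rule product_integral_prod)
    fix i :: 'a
    interpret real_distribution std_normal_distribution
      by (rule real_dist_normal_dist)
    show "integrable std_normal_distribution (\<lambda>x. iexp (s $ i * x))"
      by (rule integrable_iexp) auto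
  qed simp
  also have "\<dots> = (\<Prod>i\<in>UNIV. complex_of_real (exp (- ((s $ i)\<^sup>2) / 2)))"
    using char_std_normal_distribution by (simp add: char_def fun_eq_iff)
  also have "\<dots> = exp (- complex_of_real (s \<bullet> s) / 2)"
    by (simp add: inner_vec_def exp_sum[symmetric] exp_of_real[symmetric] power2_eq_square
        sum_negf sum_divide_distrib)
  also have "s \<bullet> s = t \<bullet> (\<Sigma> *v t)"
    unfolding s_def dot_lmul_matrix A[symmetric]
    by (simp add: matrix_vector_mul_assoc[symmetric])
  finally show ?thesis .
qed

lemma centered_gaussian_zero_sum:
  "AE \<beta> in centered_gaussian (cov_matrix P). \<beta> \<in> zero_sum"
proof -
  define A where "A = (SOME A :: real ^ 'a ^ 'a. A ** transpose A = cov_matrix P)"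
  have A: "A ** transpose A = cov_matrix P"
    using someI_ex[OF cov_matrix_factorization[of P]] by (simp add: A_def)
  have s1: "(\<Sum>z\<in>UNIV. pmf P z) = 1"
    by (rule sum_pmf_eq_1) auto
  have "cov_matrix P *v 1 = 0"
    by (simp add: cov_matrix_def matrix_vector_mult_def vec_eq_iff sum_subtractf
        flip: sum_distrib_left) (simp add: s1)
  then have "(1 v* A) \<bullet> (1 v* A) = 0"
    unfolding dot_lmul_matrix A[symmetric] by (simp add: matrix_vector_mul_assoc[symmetric])
  then have "1 v* A = 0"
    by simp
  then have "1 \<bullet> (A *v z) = 0" for z
    by (simp add: dot_lmul_matrix[symmetric])
  then have *: "A *v z \<in> zero_sum" for z
    by (simp add: zero_sum_def inner_vec_def)
  have "closed (zero_sum :: (real ^ 'a) set)"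
    unfolding zero_sum_def by (intro closed_Collect_eq continuous_intros)
  then have "{\<beta> \<in> space borel. \<beta> \<in> zero_sum} \<in> sets (borel :: (real ^ 'a) measure)"
    by simp
  then show ?thesis
    unfolding centered_gaussian_def A_def[symmetric]
    by (subst AE_distr_iff[OF measurable_matrix_chi]) (use * in auto)
qed


section \<open>The limiting transport problem\<close>

definition Lambda :: "('a::finite \<Rightarrow> 'b::finite \<Rightarrow> real) \<Rightarrow> ('a \<times> 'b) set \<Rightarrow>
    'a pmf \<Rightarrow> 'b pmf \<Rightarrow> real \<Rightarrow> real" where
  "Lambda c S P Q \<Delta> = (INF \<Psi>\<in>couplings (Phi P) (Phi Q).
     measure \<Psi> {\<beta> \<in> space \<Psi>. theta c S (fst \<beta>) (snd \<beta>) > \<Delta>})"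

end

theory Submission
  imports Defs "HOL-Real_Asymp.Real_Asymp"
begin

text \<open>
  Write \<open>\<beta>\<^sub>X, \<beta>\<^sub>Y\<close> for the rescaled deviations of the empirical distributions of the two words.

  Lower bound: the joint empirical distribution of a pair of words differs from the optimal coupling
  by a signed coupling that is feasible for \<open>\<theta>\<close>, so \<open>\<theta>(\<beta>\<^sub>X, \<beta>\<^sub>Y) \<le> sqrt n (c\<^sub>n - \<alpha>\<^sub>0)\<close> always holds. The laws
  of \<open>(\<beta>\<^sub>X, \<beta>\<^sub>Y)\<close> under near-optimal couplings are tight; a subsequence converges to a coupling of the two
  Gaussians, and \<open>\<theta>\<close> is continuous. Compactness in finite dimension is reduced to Helly's and Skorohod's
  theorems on the real line by a Schoenberg space-filling curve with a Borel section.

  Upper bound: a coupling of the Gaussians is discretized on a grid whose hyperplanes are null sets.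
  By the central limit theorem the cell masses converge, so the discretized coupling can be perturbed
  slightly to have the marginals of the empirical deviations, and then be glued to the laws of the
  words. Finally the second word is rearranged so as to match the first one optimally up to rounding.
\<close>

section \<open>A continuous surjection with a Borel section\<close>

text \<open>One tool serves the central limit theorem for cells as well as the lower bound: tight
  laws on a Euclidean space have a subsequence realised by variables that converge pointwise on a
  single probability space. It comes from the line because the curve \<open>f\<close> is continuous
  and inverts its section \<open>s\<close>, while \<open>s\<close> itself need only be Borel and
  bounded on bounded sets. Two obstacles shape the upper bound. A coupling of words must have
  exactly the product marginals, so cell masses are compared in the multiplicative form
  \<open>(1 - e) * old \<le> new\<close>: the residual is then a multiple of a probability and can
  be added as an independent part. And the plan behind the rearrangement, \<open>p\<close> plus a
  matrix divided by \<open>sqrt n\<close>, must be nonnegative, so near-minimizers of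
  \<open>theta\<close> have to be bounded uniformly over bounded deviations. The left limit on the
  right-hand side arises because the gap between \<open>\<Delta>'\<close> and
  \<open>\<Delta>\<close> pays for the oscillation of \<open>theta\<close> inside a grid cell, for
  near-minimality and for rounding. The lower bound loses nothing: an excess is a strict inequality,
  hence an open condition.\<close>

definition binary_digit :: "real \<Rightarrow> nat \<Rightarrow> int" where
  "binary_digit y k = \<lfloor>2 ^ Suc k * y\<rfloor> mod 2"

lemma binary_digit_cases: "binary_digit y k = 0 \<or> binary_digit y k = 1"
  unfolding binary_digit_def by presburger

text \<open>The partial sums are \<open>y\<close> rounded down to multiples of
  \<open>1 / 2 ^ n\<close>. The bound \<open>y < 1\<close> is strict because every digit of 1
  defined by the floor is 0.\<close>

lemma binary_digit_sums:
  assumes "0 \<le> y" "y < 1"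
  shows "(\<lambda>k. real_of_int (binary_digit y k) / 2 ^ Suc k) sums y"
proof -
  have partial: "(\<Sum>k<n. real_of_int (binary_digit y k) / 2 ^ Suc k) = \<lfloor>2 ^ n * y\<rfloor> / 2 ^ n" for n
  proof (induction n)
    case 0
    then show ?case using assms by (simp add: floor_eq_iff)
  next
    case (Suc n)
    have "\<lfloor>2 ^ n * y\<rfloor> = \<lfloor>2 ^ Suc n * y\<rfloor> div 2"
      using floor_divide_real_eq_div[of 2 "2 ^ Suc n * y"] by simp
    then have "\<lfloor>2 ^ Suc n * y\<rfloor> = 2 * \<lfloor>2 ^ n * y\<rfloor> + binary_digit y n"
      unfolding binary_digit_def by presburger
    then have "real_of_int \<lfloor>2 ^ Suc n * y\<rfloor> = 2 * real_of_int \<lfloor>2 ^ n * y\<rfloor> + binary_digit y n"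
      by linarith
    then show ?case using Suc by (simp add: field_simps)
  qed
  have "(\<lambda>n. \<lfloor>2 ^ n * y\<rfloor> / 2 ^ n) \<longlonglongrightarrow> y"
  proof (rule tendsto_sandwich)
    show "\<forall>\<^sub>F n in sequentially. y - 1 / 2 ^ n \<le> \<lfloor>2 ^ n * y\<rfloor> / 2 ^ n"
    proof (intro always_eventually allI)
      fix n :: nat
      have "2 ^ n * y - 1 \<le> \<lfloor>2 ^ n * y\<rfloor>" by linarith
      then have "(2 ^ n * y - 1) / 2 ^ n \<le> \<lfloor>2 ^ n * y\<rfloor> / 2 ^ n" by (rule divide_right_mono) simp
      then show "y - 1 / 2 ^ n \<le> \<lfloor>2 ^ n * y\<rfloor> / 2 ^ n" by (simp add: diff_divide_distrib)
    qed
    show "\<forall>\<^sub>F n in sequentially. \<lfloor>2 ^ n * y\<rfloor> / 2 ^ n \<le> y"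
      by (intro always_eventually allI) (simp add: field_simps)
    show "(\<lambda>n. y - 1 / 2 ^ n) \<longlonglongrightarrow> y"
      using tendsto_diff[OF tendsto_const LIMSEQ_realpow_zero[of "1/2::real"], of y]
      by (simp add: power_divide)
  qed simp
  then show ?thesis
    unfolding sums_def partial .
qed

text \<open>The distance from \<open>t\<close> to the nearest even integer; the form with arccos
  makes continuity and period 2 immediate.\<close>

definition dist_even :: "real \<Rightarrow> real" where
  "dist_even t = arccos (cos (pi * t)) / pi"

lemma dist_even_continuous: "continuous_on A dist_even"
  unfolding dist_even_def by (intro continuous_intros) auto

lemma dist_even_eq: "0 \<le> t \<Longrightarrow> t \<le> 1 \<Longrightarrow> dist_even t = t"
  unfolding dist_even_def by (subst arccos_cos) auto

lemma dist_even_shift: "dist_even (t + 2 * of_int k) = dist_even t"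
proof -
  have "cos (pi * (t + 2 * of_int k)) = cos (pi * t + 2 * pi * of_int k)"
    by (simp add: algebra_simps)
  also have "\<dots> = cos (pi * t)"
    using cos.plus_of_int[of "pi * t" k] by (simp add: mult_ac)
  finally show ?thesis unfolding dist_even_def by simp
qed

text \<open>Schoenberg's even function of period 2: 0 on [0, 1/3], 1 on [2/3, 1], linear in
  between.\<close>

definition plateau :: "real \<Rightarrow> real" where
  "plateau t = max 0 (min 1 (3 * dist_even t - 1))"

lemma plateau_continuous: "continuous_on A plateau"
  unfolding plateau_def by (intro continuous_intros dist_even_continuous)

lemma plateau_bounds: "0 \<le> plateau t" "plateau t \<le> 1"
  by (auto simp: plateau_def)

lemma ternary_summable:
  fixes a :: "nat \<Rightarrow> int"
  assumes "\<And>j. a j = 0 \<or> a j = 1"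
  shows "summable (\<lambda>j. 2 * real_of_int (a j) / 3 ^ Suc j)"
proof (rule summable_comparison_test)
  show "summable (\<lambda>j. (1/3 :: real) ^ j)" by (rule summable_geometric) simp
  show "\<exists>N. \<forall>n\<ge>N. norm (2 * real_of_int (a n) / 3 ^ Suc n) \<le> (1/3) ^ n"
  proof (intro exI allI impI)
    fix n show "norm (2 * real_of_int (a n) / 3 ^ Suc n) \<le> (1/3) ^ n"
      using assms[of n] by (auto simp: power_divide field_simps)
  qed
qed

lemma ternary_bounds:
  fixes a :: "nat \<Rightarrow> int"
  assumes "\<And>j. a j = 0 \<or> a j = 1"
  shows "0 \<le> (\<Sum>j. 2 * real_of_int (a j) / 3 ^ Suc j)" "(\<Sum>j. 2 * real_of_int (a j) / 3 ^ Suc j) \<le> 1"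
proof -
  have nn: "0 \<le> real_of_int (a j)" "real_of_int (a j) \<le> 1" for j using assms[of j] by auto
  show "0 \<le> (\<Sum>j. 2 * real_of_int (a j) / 3 ^ Suc j)"
    by (intro suminf_nonneg ternary_summable assms divide_nonneg_nonneg) (use nn in auto)
  have g: "(\<lambda>j. 2 / 3 * (1/3 :: real) ^ j) sums (2 / 3 * (1 / (1 - 1/3)))"
    by (intro sums_mult geometric_sums) simp
  have "(\<Sum>j. 2 * real_of_int (a j) / 3 ^ Suc j) \<le> (\<Sum>j. 2 / 3 * (1/3 :: real) ^ j)"
    by (intro suminf_le ternary_summable assms sums_summable[OF g])
      (use nn in \<open>auto simp: power_divide field_simps\<close>)
  then show "(\<Sum>j. 2 * real_of_int (a j) / 3 ^ Suc j) \<le> 1"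
    using sums_unique[OF g] by simp
qed

text \<open>Modulo even integers, \<open>3 ^ j * t\<close> starts with the ternary digit \<open>2 * a j\<close>, hence lies
  on the plateau of height \<open>a j\<close>.\<close>
lemma plateau_ternary:
  fixes a :: "nat \<Rightarrow> int"
  assumes a: "\<And>j. a j = 0 \<or> a j = 1"
  shows "plateau (3 ^ j * (\<Sum>j. 2 * real_of_int (a j) / 3 ^ Suc j)) = a j"
proof -
  let ?f = "\<lambda>j. 2 * real_of_int (a j) / 3 ^ Suc j"
  \<comment> \<open>The tail after digit \<open>j\<close>, scaled by \<open>3 ^ j\<close>. It lies
    in [0, 1/3], the length of a plateau, so it cannot leave the plateau selected by
    \<open>a j\<close>.\<close>
  define r where "r = (\<Sum>i. 2 * real_of_int (a (i + Suc j)) / 3 ^ Suc i) / 3"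
  have r: "0 \<le> r" "r \<le> 1/3"
    using ternary_bounds[of "\<lambda>i. a (i + Suc j)"] a unfolding r_def by auto
  have split: "suminf ?f = (\<Sum>i. ?f (i + Suc j)) + sum ?f {..<j} + ?f j"
    using suminf_split_initial_segment[OF ternary_summable[of a, OF a], where k="Suc j"] by simp
  have tail: "3 ^ j * (\<Sum>i. ?f (i + Suc j)) = r"
  proof -
    have "3 ^ j * (\<Sum>i. ?f (i + Suc j)) = (\<Sum>i. 3 ^ j * ?f (i + Suc j))"
      using ternary_summable[of a, OF a, THEN summable_ignore_initial_segment]
      by (intro suminf_mult[symmetric])
    also have "(\<lambda>i. 3 ^ j * ?f (i + Suc j)) = (\<lambda>i. (2 * real_of_int (a (i + Suc j)) / 3 ^ Suc i) / 3)"
      by (auto simp: power_add field_simps)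
    also have "(\<Sum>i. (2 * real_of_int (a (i + Suc j)) / 3 ^ Suc i) / 3) = r"
      unfolding r_def by (intro suminf_divide ternary_summable a)
    finally show ?thesis .
  qed
  \<comment> \<open>The digits before \<open>j\<close> are 0 or 2, so they contribute an even
    integer, which the period 2 erases.\<close>
  have "\<exists>k::int. 3 ^ j * sum ?f {..<j} = 2 * of_int k"
  proof -
    have "3 ^ j * ?f i = 2 * of_int (a i * 3 ^ (j - Suc i))" if "i < j" for i
    proof -
      have "(3::real) ^ j = 3 ^ (j - Suc i) * 3 ^ Suc i"
        using that by (subst power_add[symmetric]) simp
      then show ?thesis by simp
    qed
    then have "3 ^ j * sum ?f {..<j} = (\<Sum>i<j. 2 * of_int (a i * 3 ^ (j - Suc i)))"
      by (simp add: sum_distrib_left)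
    also have "\<dots> = 2 * of_int (\<Sum>i<j. a i * 3 ^ (j - Suc i))"
      by (simp only: sum_distrib_left[symmetric] of_int_sum)
    finally show ?thesis by blast
  qed
  then obtain k :: int where k: "3 ^ j * sum ?f {..<j} = 2 * of_int k" by blast
  have "3 ^ j * suminf ?f = (2 * real_of_int (a j) / 3 + r) + 2 * of_int k"
    unfolding split using tail k by (simp add: distrib_left)
  moreover have "dist_even (2 * real_of_int (a j) / 3 + r) = 2 * real_of_int (a j) / 3 + r"
    using a[of j] r by (intro dist_even_eq) auto
  ultimately have "dist_even (3 ^ j * suminf ?f) = 2 * real_of_int (a j) / 3 + r"
    by (simp add: dist_even_shift)
  then show ?thesis unfolding plateau_def using a[of j] r by auto
qed

text \<open>Coordinate \<open>i\<close> of Schoenberg's curve in dimension \<open>m\<close>: for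
  \<open>t\<close> in the Cantor set it reads every \<open>m\<close>-th ternary digit, starting at
  digit \<open>i\<close>, and reassembles them as a binary expansion.\<close>

definition schoenberg :: "nat \<Rightarrow> nat \<Rightarrow> real \<Rightarrow> real" where
  "schoenberg m i t = (\<Sum>k. plateau (3 ^ (m * k + i) * t) / 2 ^ Suc k)"

text \<open>The binary digits of the coordinates, interleaved and doubled into ternary digits, give
  a point of the Cantor set. Only digits and a series are involved, which makes the map
  Borel.\<close>

definition schoenberg_inv :: "nat \<Rightarrow> (nat \<Rightarrow> real) \<Rightarrow> real" where
  "schoenberg_inv m y = (\<Sum>j. 2 * real_of_int (binary_digit (y (j mod m)) (j div m)) / 3 ^ Suc j)"

lemma schoenberg_continuous: "continuous_on UNIV (schoenberg m i)"
proof -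
  have "uniform_limit UNIV (\<lambda>n t. \<Sum>k<n. plateau (3 ^ (m * k + i) * t) / 2 ^ Suc k)
      (\<lambda>t. \<Sum>k. plateau (3 ^ (m * k + i) * t) / 2 ^ Suc k) sequentially"
  proof (rule Weierstrass_m_test)
    show "norm (plateau (3 ^ (m * k + i) * t) / 2 ^ Suc k) \<le> (1/2) ^ k" for k t
      using plateau_bounds[of "3 ^ (m * k + i) * t"] by (auto simp: power_divide field_simps)
  qed (rule summable_geometric, simp)
  then have "continuous_on UNIV (\<lambda>t. \<Sum>k. plateau (3 ^ (m * k + i) * t) / 2 ^ Suc k)"
    by (rule uniform_limit_theorem[rotated])
      (auto intro!: always_eventually continuous_intros
        continuous_on_compose2[OF plateau_continuous[of UNIV]])
  then show ?thesis by (simp add: schoenberg_def[abs_def])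
qed

text \<open>Frees the even integer part of the parameter, which the section below uses to record the
  size of the vector.\<close>

lemma schoenberg_shift: "schoenberg m i (t + 2 * of_int l) = schoenberg m i t"
proof -
  have "plateau (3 ^ j * (t + 2 * of_int l)) = plateau (3 ^ j * t)" for j
    using dist_even_shift[of "3 ^ j * t" "3 ^ j * l"]
    by (simp add: plateau_def algebra_simps)
  then show ?thesis by (simp add: schoenberg_def)
qed

lemma schoenberg_inverse:
  assumes "i < m" "0 \<le> y i" "y i < 1"
  shows "schoenberg m i (schoenberg_inv m y) = y i"
proof -
  have "plateau (3 ^ (m * k + i) * schoenberg_inv m y) = binary_digit (y i) k" for k
    unfolding schoenberg_inv_def
    by (subst plateau_ternary) (use assms binary_digit_cases in auto)
  then have "schoenberg m i (schoenberg_inv m y) = (\<Sum>k. real_of_int (binary_digit (y i) k) / 2 ^ Suc k)"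
    by (simp add: schoenberg_def)
  also have "\<dots> = y i" using binary_digit_sums[OF assms(2,3)] by (rule sums_unique[symmetric])
  finally show ?thesis .
qed

lemma schoenberg_inv_bounds: "0 \<le> schoenberg_inv m y" "schoenberg_inv m y \<le> 1"
  unfolding schoenberg_inv_def by (intro ternary_bounds binary_digit_cases)+

text \<open>On the parameter interval [2k, 2k+1] the curve is rescaled to a cube of half side
  \<open>k\<close>, so growing cubes exhaust the space; in between the scale changes continuously.
  Boundedness of \<open>s\<close> on balls is what carries tightness over to the line.\<close>

lemma continuous_surjection_with_borel_section:
  obtains f :: "real \<Rightarrow> 'e :: euclidean_space" and s :: "'e \<Rightarrow> real"
  where "continuous_on UNIV f" "s \<in> borel_measurable borel" "\<And>x. f (s x) = x"
    "\<And>K. \<exists>T. \<forall>x. norm x \<le> K \<longrightarrow> \<bar>s x\<bar> \<le> T"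
proof -
  define m where "m = DIM('e)"
  obtain idx :: "'e \<Rightarrow> nat" where idx: "bij_betw idx Basis {..<m}"
    using ex_bij_betw_finite_nat[OF finite_Basis] unfolding m_def by (auto simp: lessThan_atLeast0)
  define bas where "bas = inv_into Basis idx"
  have bas: "bas (idx b) = b" if "b \<in> Basis" for b
    using idx that unfolding bas_def by (simp add: bij_betw_inv_into_left)
  have idx_less: "idx b < m" if "b \<in> Basis" for b
    using idx that by (auto simp: bij_betw_def)
  \<comment> \<open>\<open>(t - dist_even t) / 2\<close> equals \<open>k\<close> on \<open>[2k, 2k+1]\<close>.\<close>
  define f where "f t = (\<Sum>b\<in>Basis. ((t - dist_even t) / 2 * (2 * schoenberg m (idx b) t - 1)) *\<^sub>R b)" for t :: real
  \<comment> \<open>Strictly larger than the norm, so that the rescaled coordinates stay below 1,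
    where binary digits would fail.\<close>
  define N where "N x = \<lfloor>norm x\<rfloor> + 1" for x :: 'e
  define y where "y x i = ((x \<bullet> bas i) / N x + 1) / 2" for x i
  define s where "s x = schoenberg_inv m (y x) + 2 * of_int (N x)" for x
  show ?thesis
  proof
    show "continuous_on UNIV f"
      unfolding f_def by (intro continuous_intros dist_even_continuous schoenberg_continuous) auto
    have [measurable]: "N \<in> borel \<rightarrow>\<^sub>M count_space UNIV" unfolding N_def by measurable
    show "s \<in> borel_measurable borel"
      unfolding s_def schoenberg_inv_def y_def binary_digit_def by measurable
    show "f (s x) = x" for x
    proof -
      have "N x > 0" unfolding N_def by (simp add: add_nonneg_pos)
      have Nx: "real_of_int (N x) > norm x" unfolding N_def by linarith
      have pos: "real_of_int (N x) > 0" using \<open>N x > 0\<close> by simp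
      have "schoenberg m (idx b) (s x) = y x (idx b)" if b: "b \<in> Basis" for b
      proof -
        have "\<bar>x \<bullet> b\<bar> < N x" using Basis_le_norm[OF b, of x] Nx by linarith
        then have "0 \<le> y x (idx b)" "y x (idx b) < 1"
          unfolding y_def bas[OF b] using pos by (auto simp: field_simps)
        then show ?thesis
          unfolding s_def schoenberg_shift by (intro schoenberg_inverse idx_less[OF b])
      qed
      moreover have "(s x - dist_even (s x)) / 2 = N x"
        unfolding s_def dist_even_shift using schoenberg_inv_bounds[of m "y x"]
        by (simp add: dist_even_eq)
      ultimately have "f (s x) = (\<Sum>b\<in>Basis. (N x * (2 * y x (idx b) - 1)) *\<^sub>R b)"
        unfolding f_def by (intro sum.cong) auto
      also have "\<dots> = (\<Sum>b\<in>Basis. (x \<bullet> b) *\<^sub>R b)"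
        using pos by (intro sum.cong) (auto simp: y_def bas field_simps)
      also have "\<dots> = x" by (rule euclidean_representation)
      finally show ?thesis .
    qed
    show "\<exists>T. \<forall>x. norm x \<le> K \<longrightarrow> \<bar>s x\<bar> \<le> T" for K
    proof (intro exI allI impI)
      fix x :: 'e assume "norm x \<le> K"
      then have "real_of_int (N x) \<le> K + 1" unfolding N_def by linarith
      moreover have "0 \<le> real_of_int (N x)" unfolding N_def by (simp add: add_nonneg_nonneg)
      ultimately show "\<bar>s x\<bar> \<le> 2 * (K + 1) + 1"
        unfolding s_def using schoenberg_inv_bounds[of m "y x"]
        by (simp add: abs_le_iff)
    qed
  qed
qed

section \<open>Skorohod representation in finite dimension\<close>

text \<open>The laws are pushed to the line by \<open>s\<close>, where Helly's theorem gives a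
  weakly convergent subsequence and Skorohod's theorem pointwise convergent variables. Applying
  \<open>f\<close> brings them back: its continuity preserves the convergence, and
  \<open>f (s x) = x\<close> restores the laws. The law of \<open>Z\<close> is left open here;
  characteristic functions later identify what is needed of it.\<close>

lemma skorokhod_euclidean:
  fixes \<mu> :: "nat \<Rightarrow> 'e::euclidean_space measure"
  assumes prob: "\<And>n. prob_space (\<mu> n)" and sets: "\<And>n. sets (\<mu> n) = sets borel"
    and tight: "\<And>e. 0 < e \<Longrightarrow> \<exists>K. \<forall>n. 1 - e < measure (\<mu> n) {x. norm x \<le> K}"
  obtains r :: "nat \<Rightarrow> nat" and \<Omega> :: "real measure" and Y Z
  where "strict_mono r" "prob_space \<Omega>" "\<And>n. Y n \<in> borel_measurable \<Omega>"
    "\<And>n. distr \<Omega> borel (Y n) = \<mu> (r n)" "Z \<in> borel_measurable \<Omega>"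
    "\<And>\<omega>. \<omega> \<in> space \<Omega> \<Longrightarrow> (\<lambda>n. Y n \<omega>) \<longlonglongrightarrow> Z \<omega>"
proof -
  obtain f :: "real \<Rightarrow> 'e" and s where f: "continuous_on UNIV f"
    and s [measurable]: "s \<in> borel_measurable borel"
    and fs: "\<And>x. f (s x) = x" and bdd: "\<And>K. \<exists>T. \<forall>x. norm x \<le> K \<longrightarrow> \<bar>s x\<bar> \<le> T"
    using continuous_surjection_with_borel_section by blast
  have f_meas [measurable]: "f \<in> borel_measurable borel"
    using f by (rule borel_measurable_continuous_onI)
  have sM [measurable]: "s \<in> borel_measurable (\<mu> n)" for n
    using s measurable_cong_sets[OF sets refl] by blast
  have space: "space (\<mu> n) = UNIV" for n
    using sets_eq_imp_space_eq[OF sets] by simp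
  define \<nu> where "\<nu> n = distr (\<mu> n) borel s" for n
  have \<nu>: "real_distribution (\<nu> n)" for n
    unfolding \<nu>_def using prob by (intro prob_space.real_distribution_distr) auto
  have "tight \<nu>"
    unfolding tight_def
  proof (intro conjI allI impI \<nu>)
    fix e :: real assume "0 < e"
    then obtain K where K: "\<And>n. 1 - e < measure (\<mu> n) {x. norm x \<le> K}" using tight by blast
    obtain T where T: "\<And>x. norm x \<le> K \<Longrightarrow> \<bar>s x\<bar> \<le> T" using bdd by blast
    show "\<exists>a b. a < b \<and> (\<forall>n. 1 - e < measure (\<nu> n) {a<..b})"
    proof (intro exI conjI allI)
      \<comment> \<open>The interval is open on the left, hence the additional 1; the absolute value
        covers a negative \<open>T\<close>, possible when \<open>K\<close> is negative.\<close>
      show "- \<bar>T\<bar> - 1 < \<bar>T\<bar>" by simp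
      fix n
      interpret prob_space "\<mu> n" by (rule prob)
      have "{x. norm x \<le> K} \<subseteq> s -` {- \<bar>T\<bar> - 1<..\<bar>T\<bar>} \<inter> space (\<mu> n)"
      proof
        fix x :: 'e assume "x \<in> {x. norm x \<le> K}"
        then have "\<bar>s x\<bar> \<le> T" using T by simp
        then show "x \<in> s -` {- \<bar>T\<bar> - 1<..\<bar>T\<bar>} \<inter> space (\<mu> n)" using space by auto
      qed
      then have "measure (\<mu> n) {x. norm x \<le> K} \<le> measure (\<nu> n) {- \<bar>T\<bar> - 1<..\<bar>T\<bar>}"
        unfolding \<nu>_def by (subst measure_distr) (auto intro!: finite_measure_mono)
      with K[of n] show "1 - e < measure (\<nu> n) {- \<bar>T\<bar> - 1<..\<bar>T\<bar>}" by linarith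
    qed
  qed
  from tight_imp_convergent_subsubsequence[OF this strict_mono_id] obtain r M
    where r: "strict_mono (r :: nat \<Rightarrow> nat)" and M: "real_distribution M"
      and conv: "weak_conv_m (\<nu> \<circ> r) M"
    by auto
  have "real_distribution ((\<nu> \<circ> r) n)" for n using \<nu> by simp
  from Skorohod[OF this M conv] obtain \<Omega> :: "real measure" and Y' Z'
    where \<Omega>: "prob_space \<Omega>" and Y' [measurable]: "\<And>n. Y' n \<in> measurable \<Omega> borel"
      and dY': "\<And>n. distr \<Omega> borel (Y' n) = (\<nu> \<circ> r) n"
      and Z': "Z' \<in> measurable \<Omega> lborel"
      and lim: "\<And>x. x \<in> space \<Omega> \<Longrightarrow> (\<lambda>n. Y' n x) \<longlonglongrightarrow> Z' x"
    by metis
  have Z'_meas [measurable]: "Z' \<in> borel_measurable \<Omega>" using Z' by simp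
  show ?thesis
  proof (rule that[OF r \<Omega>])
    show "(\<lambda>\<omega>. f (Y' n \<omega>)) \<in> borel_measurable \<Omega>" for n by measurable
    show "(\<lambda>\<omega>. f (Z' \<omega>)) \<in> borel_measurable \<Omega>" by measurable
    show "distr \<Omega> borel (\<lambda>\<omega>. f (Y' n \<omega>)) = \<mu> (r n)" for n
    proof -
      have "distr \<Omega> borel (\<lambda>\<omega>. f (Y' n \<omega>)) = distr (distr \<Omega> borel (Y' n)) borel f"
        by (subst distr_distr) (auto simp: comp_def)
      also have "\<dots> = distr (\<mu> (r n)) borel (\<lambda>x. f (s x))"
        unfolding dY' by (simp add: \<nu>_def distr_distr comp_def)
      also have "\<dots> = distr (\<mu> (r n)) (\<mu> (r n)) (\<lambda>x. x)"
        by (intro distr_cong) (auto simp: fs sets)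
      finally show ?thesis by simp
    qed
    show "(\<lambda>n. f (Y' n \<omega>)) \<longlonglongrightarrow> f (Z' \<omega>)" if "\<omega> \<in> space \<Omega>" for \<omega>
      using f lim[OF that] by (auto simp: continuous_on_eq_continuous_at intro: isCont_tendsto_compose)
  qed
qed

section \<open>Uniqueness of characteristic functions\<close>

text \<open>Levy's uniqueness theorem for the law of \<open>X\<close> under the density
  \<open>g / c\<close>, where \<open>c\<close> is the integral of \<open>g\<close>. The case
  \<open>s = 0\<close> shows that \<open>c\<close> is the same under \<open>M\<close> and
  \<open>N\<close>; if \<open>c = 0\<close>, both sides vanish.\<close>

lemma weighted_iexp_unique:
  fixes X :: "'x \<Rightarrow> real" and g :: "'x \<Rightarrow> real"
  assumes M: "prob_space M" and N: "prob_space N"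
    and [measurable]: "X \<in> borel_measurable M" "X \<in> borel_measurable N"
      "g \<in> borel_measurable M" "g \<in> borel_measurable N"
    and nonneg: "\<And>x. 0 \<le> g x" and bdd: "\<And>x. g x \<le> C"
    and eq: "\<And>s. (\<integral>x. g x *\<^sub>R iexp (s * X x) \<partial>M) = (\<integral>x. g x *\<^sub>R iexp (s * X x) \<partial>N)"
    and B: "B \<in> sets borel"
  shows "(\<integral>x. g x * indicator B (X x) \<partial>M) = (\<integral>x. g x * indicator B (X x) \<partial>N)"
proof -
  have int: "integrable L g" if "prob_space L" "g \<in> borel_measurable L" for L
  proof -
    interpret prob_space L by fact
    show ?thesis using nonneg bdd by (intro integrable_const_bound[where B=C] that) auto
  qed
  note [simp] = int[OF M assms(5)] int[OF N assms(6)]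
  define c where "c = (\<integral>x. g x \<partial>M)"
  have "complex_of_real (\<integral>x. g x \<partial>M) = complex_of_real (\<integral>x. g x \<partial>N)"
    using eq[of 0] by (simp add: scaleR_conv_of_real)
  then have c': "c = (\<integral>x. g x \<partial>N)" by (simp add: c_def)
  have "c \<ge> 0" unfolding c_def using nonneg by simp
  show ?thesis
  proof (cases "c = 0")
    case True
    then have "AE x in M. g x = 0" "AE x in N. g x = 0"
      using integral_nonneg_eq_0_iff_AE[of M g] integral_nonneg_eq_0_iff_AE[of N g] nonneg c' c_def
      by auto
    then have "(\<integral>x. g x * indicator B (X x) \<partial>M) = 0" "(\<integral>x. g x * indicator B (X x) \<partial>N) = 0"
      by (auto intro!: integral_eq_zero_AE)
    then show ?thesis by simp
  next
    case False
    then have c: "c > 0" using \<open>c \<ge> 0\<close> by simp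
    define D where "D L = distr (density L (\<lambda>x. ennreal (g x / c))) borel X" for L
    have main: "real_distribution (D L) \<and> char (D L) = (\<lambda>s. (\<integral>x. g x *\<^sub>R iexp (s * X x) \<partial>L) / c)
        \<and> measure (D L) B = (\<integral>x. g x * indicator B (X x) \<partial>L) / c"
      if L: "prob_space L" and [measurable]: "X \<in> borel_measurable L" "g \<in> borel_measurable L"
        and Lc: "(\<integral>x. g x \<partial>L) = c" for L
    proof -
      interpret L: prob_space L by fact
      have [simp]: "integrable L g" by (rule int) fact+
      have "(\<integral>\<^sup>+x. ennreal (g x / c) \<partial>L) = ennreal (\<integral>x. g x / c \<partial>L)"
        by (intro nn_integral_eq_integral) (use nonneg c in auto)
      then have "prob_space (density L (\<lambda>x. ennreal (g x / c)))"
        using Lc c by (intro prob_spaceI) (simp add: emeasure_density)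
      then interpret d: prob_space "density L (\<lambda>x. ennreal (g x / c))" .
      have rd: "real_distribution (D L)" unfolding D_def by (rule d.real_distribution_distr) simp
      have "char (D L) s = (\<integral>x. g x *\<^sub>R iexp (s * X x) \<partial>L) / c" for s
      proof -
        have "char (D L) s = (\<integral>x. iexp (s * X x) \<partial>density L (\<lambda>x. ennreal (g x / c)))"
          unfolding D_def char_def by (subst integral_distr) auto
        also have "\<dots> = (\<integral>x. (g x / c) *\<^sub>R iexp (s * X x) \<partial>L)"
          by (subst integral_density) (use nonneg c in auto)
        also have "\<dots> = (\<integral>x. g x *\<^sub>R iexp (s * X x) / c \<partial>L)"
          by (simp add: scaleR_conv_of_real field_simps)
        finally show ?thesis by simp
      qed
      moreover have "measure (D L) B = (\<integral>x. g x * indicator B (X x) \<partial>L) / c"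
      proof -
        interpret D: real_distribution "D L" by (rule rd)
        have "measure (D L) B = (\<integral>x. indicator B x \<partial>D L)"
          using B by simp
        also have "\<dots> = (\<integral>x. indicator B (X x) \<partial>density L (\<lambda>x. ennreal (g x / c)))"
          unfolding D_def using B by (subst integral_distr) auto
        also have "\<dots> = (\<integral>x. (g x / c) *\<^sub>R indicator B (X x) \<partial>L)"
          by (subst integral_density) (use nonneg c B in auto)
        finally show ?thesis by simp
      qed
      ultimately show ?thesis using rd by blast
    qed
    note mM = main[OF M assms(3,5) c_def[symmetric]] and mN = main[OF N assms(4,6) c'[symmetric]]
    have "D M = D N" using mM mN eq by (intro Levy_uniqueness) auto
    then show ?thesis using mM mN c by simp
  qed
qed

text \<open>Coordinates are replaced one at a time by indicators, using the one-dimensional uniqueness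
  theorem with the nonnegative weights \<open>1 + cos\<close> and \<open>1 + sin\<close>.\<close>
lemma char_vec_unique:
  fixes M N :: "(real ^ 'a::finite) measure"
  assumes M: "prob_space M" and N: "prob_space N"
    and sM: "sets M = sets borel" and sN: "sets N = sets borel"
    and eq: "\<And>t. (\<integral>x. iexp (t \<bullet> x) \<partial>M) = (\<integral>x. iexp (t \<bullet> x) \<partial>N)"
  shows "M = N"
proof -
  interpret M: prob_space M by fact
  interpret N: prob_space N by fact
  have meas: "f \<in> borel_measurable M \<and> f \<in> borel_measurable N"
    if "f \<in> borel_measurable borel" for f :: "real ^ 'a \<Rightarrow> 'c::topological_space"
    using that measurable_cong_sets[OF sM refl] measurable_cong_sets[OF sN refl] by blast
  define w where "w J A x = (\<Prod>j\<in>J. indicator (A j) (x $ j) :: real)"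
    for J and A :: "'a \<Rightarrow> real set" and x :: "real ^ 'a"
  have w01: "0 \<le> w J A x" "w J A x \<le> 1" for J A x
    unfolding w_def by (auto intro!: prod_nonneg prod_le_1 simp: indicator_def)
  have w_meas [measurable]: "w J A \<in> borel_measurable borel" if "\<And>j. A j \<in> sets borel" for J A
    unfolding w_def[abs_def] using that by measurable
  \<comment> \<open>A hybrid statement: indicators test the coordinates in \<open>J\<close>, while
    the exponential still tests the whole vector. \<open>J = {}\<close> is the hypothesis, and
    \<open>J = UNIV\<close> with \<open>t = 0\<close> gives the measures of boxes.\<close>
  have step: "\<forall>A t. (\<forall>j. A j \<in> sets borel) \<longrightarrow>
      (\<integral>x. w J A x *\<^sub>R iexp (t \<bullet> x) \<partial>M) = (\<integral>x. w J A x *\<^sub>R iexp (t \<bullet> x) \<partial>N)" for J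
  proof (induction J rule: finite_induct[OF finite])
    case 1
    then show ?case by (simp add: w_def eq)
  next
    case (2 k J)
    show ?case
    proof (intro allI impI)
      fix A :: "'a \<Rightarrow> real set" and t :: "real ^ 'a"
      assume A: "\<forall>j. A j \<in> sets borel"
      have A': "A j \<in> sets borel" for j using A by simp
      have [measurable]: "w J A \<in> borel_measurable borel" by (rule w_meas[OF A'])
      define h where "h u x = w J A x *\<^sub>R iexp (u \<bullet> x)" for u x
      have IH: "(\<integral>x. w J A x *\<^sub>R iexp (u \<bullet> x) \<partial>M) = (\<integral>x. w J A x *\<^sub>R iexp (u \<bullet> x) \<partial>N)" for u
        using 2 A by blast
      have int: "integrable M (\<lambda>x. w J A x *\<^sub>R iexp (u \<bullet> x))" "integrable N (\<lambda>x. w J A x *\<^sub>R iexp (u \<bullet> x))" for u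
        using w01[of J A]
        by (auto intro!: M.integrable_const_bound[where B=1] N.integrable_const_bound[where B=1]
            meas[THEN conjunct1] meas[THEN conjunct2] simp: norm_mult)
      have wi: "w (insert k J) A x = w J A x * indicator (A k) (x $ k)" for x
        using 2 by (simp add: w_def)
      \<comment> \<open>The product of \<open>cos (t \<bullet> x)\<close> or
        \<open>sin (t \<bullet> x)\<close> with an exponential in coordinate \<open>k\<close> is a
        combination of exponentials at these two frequencies, to which the induction hypothesis
        applies.\<close>
      define p where "p s = t + s *\<^sub>R axis k 1" for s :: real
      define q where "q s = - t + s *\<^sub>R axis k 1" for s :: real
      have pq: "p s \<bullet> x = t \<bullet> x + s * x $ k" "q s \<bullet> x = - (t \<bullet> x) + s * x $ k" for s x
        by (auto simp: p_def q_def inner_add_left inner_diff_left inner_axis')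
      have s_eq: "s * x $ k = (s *\<^sub>R axis k 1) \<bullet> x" for s and x :: "real ^ 'a"
        by (simp add: inner_axis')
      have iexp_add: "iexp (u + v) = iexp u * iexp v" for u v
        by (simp add: exp_add distrib_left)
      have e0: "(\<integral>x. w J A x *\<^sub>R iexp (s * x $ k) \<partial>M) = (\<integral>x. w J A x *\<^sub>R iexp (s * x $ k) \<partial>N)" for s
        unfolding s_eq by (rule IH)
      have uniq: "(\<integral>x. g x * indicator (A k) (x $ k) \<partial>M) = (\<integral>x. g x * indicator (A k) (x $ k) \<partial>N)"
        if "g \<in> borel_measurable borel" "\<And>x. 0 \<le> g x" "\<And>x. g x \<le> 2"
          "\<And>s. (\<integral>x. g x *\<^sub>R iexp (s * x $ k) \<partial>M) = (\<integral>x. g x *\<^sub>R iexp (s * x $ k) \<partial>N)" for g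
        using that A by (intro weighted_iexp_unique[OF M N, where C=2])
          (auto intro!: meas[THEN conjunct1] meas[THEN conjunct2])
      have bnd: "0 \<le> w J A x * (1 + v)" "w J A x * (1 + v) \<le> 2" if "\<bar>v\<bar> \<le> 1" for x v
      proof -
        show "0 \<le> w J A x * (1 + v)" using that w01 by (intro mult_nonneg_nonneg) auto
        have "w J A x * (1 + v) \<le> 1 * 2" using that w01 by (intro mult_mono) auto
        then show "w J A x * (1 + v) \<le> 2" by simp
      qed
      have u0: "(\<integral>x. w J A x * indicator (A k) (x $ k) \<partial>M) = (\<integral>x. w J A x * indicator (A k) (x $ k) \<partial>N)"
        using w01(2)[of J A] by (intro uniq w01(1) e0) (auto intro: order_trans[of _ 1])
      have trig: "(\<integral>x. w J A x * (1 + g x) * indicator (A k) (x $ k) \<partial>M)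
          = (\<integral>x. w J A x * (1 + g x) * indicator (A k) (x $ k) \<partial>N)"
        if g: "g \<in> borel_measurable borel" "\<And>x. \<bar>g x\<bar> \<le> 1"
          and gI: "\<And>s x. g x *\<^sub>R iexp (s * x $ k) = a * iexp (p s \<bullet> x) + b * iexp (q s \<bullet> x)"
        for g :: "real ^ 'a \<Rightarrow> real" and a b
      proof -
        have "(\<integral>x. (w J A x * (1 + g x)) *\<^sub>R iexp (s * x $ k) \<partial>L)
            = (\<integral>x. h (s *\<^sub>R axis k 1) x \<partial>L)
              + (a * (\<integral>x. h (p s) x \<partial>L) + b * (\<integral>x. h (q s) x \<partial>L))"
          if "L \<in> {M, N}" for s L
        proof -
          have i: "integrable L (h u)" for u using that int by (auto simp: h_def[abs_def])
          have "(\<lambda>x. (w J A x * (1 + g x)) *\<^sub>R iexp (s * x $ k)) =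
            (\<lambda>x. h (s *\<^sub>R axis k 1) x +
              (a * h (p s) x + b * h (q s) x))"
          proof
            fix x
            have "(w J A x * (1 + g x)) *\<^sub>R iexp (s * x $ k) =
              w J A x *\<^sub>R iexp (s * x $ k) + w J A x *\<^sub>R (g x *\<^sub>R iexp (s * x $ k))"
              by (simp add: distrib_left scaleR_left_distrib)
            also have "\<dots> = h (s *\<^sub>R axis k 1) x +
              (a * h (p s) x + b * h (q s) x)"
              unfolding gI h_def s_eq[symmetric] by (simp add: scaleR_conv_of_real distrib_left mult_ac)
            finally show "(w J A x * (1 + g x)) *\<^sub>R iexp (s * x $ k) =
              h (s *\<^sub>R axis k 1) x +
              (a * h (p s) x + b * h (q s) x)" .
          qed
          then show ?thesis using i by simp
        qed
        then have "(\<integral>x. (w J A x * (1 + g x)) *\<^sub>R iexp (s * x $ k) \<partial>M)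
            = (\<integral>x. (w J A x * (1 + g x)) *\<^sub>R iexp (s * x $ k) \<partial>N)" for s
          using IH[folded h_def] by (simp only: insert_iff simp_thms)
        then show ?thesis using g by (intro uniq bnd) auto
      qed
      have uc: "(\<integral>x. w J A x * (1 + cos (t \<bullet> x)) * indicator (A k) (x $ k) \<partial>M)
          = (\<integral>x. w J A x * (1 + cos (t \<bullet> x)) * indicator (A k) (x $ k) \<partial>N)"
      proof (rule trig[of _ "1 / 2" "1 / 2"])
        show "cos (t \<bullet> x) *\<^sub>R iexp (s * x $ k) = 1 / 2 * iexp (p s \<bullet> x) + 1 / 2 * iexp (q s \<bullet> x)" for s x
          unfolding pq iexp_add
          by (simp add: scaleR_conv_of_real cos_exp_eq field_simps flip: cos_of_real)
      qed auto
      have us: "(\<integral>x. w J A x * (1 + sin (t \<bullet> x)) * indicator (A k) (x $ k) \<partial>M)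
          = (\<integral>x. w J A x * (1 + sin (t \<bullet> x)) * indicator (A k) (x $ k) \<partial>N)"
      proof (rule trig[of _ "1 / (2 * \<i>)" "- 1 / (2 * \<i>)"])
        show "sin (t \<bullet> x) *\<^sub>R iexp (s * x $ k)
            = 1 / (2 * \<i>) * iexp (p s \<bullet> x) + - 1 / (2 * \<i>) * iexp (q s \<bullet> x)" for s x
          unfolding pq iexp_add
          by (simp add: scaleR_conv_of_real sin_exp_eq field_simps flip: sin_of_real)
      qed auto
      \<comment> \<open>The exponential is recovered from cosine and sine; the constant 1, added
        only to make the weights nonnegative, is subtracted again.\<close>
      have "(\<integral>x. w (insert k J) A x *\<^sub>R iexp (t \<bullet> x) \<partial>L) =
          complex_of_real ((\<integral>x. w J A x * (1 + cos (t \<bullet> x)) * indicator (A k) (x $ k) \<partial>L)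
            - (\<integral>x. w J A x * indicator (A k) (x $ k) \<partial>L))
          + \<i> * complex_of_real ((\<integral>x. w J A x * (1 + sin (t \<bullet> x)) * indicator (A k) (x $ k) \<partial>L)
            - (\<integral>x. w J A x * indicator (A k) (x $ k) \<partial>L))" if L: "L \<in> {M, N}" for L
      proof -
        have iL: "integrable L (\<lambda>x. g x * indicator (A k) (x $ k))"
          if "g \<in> borel_measurable borel" "\<And>x. 0 \<le> g x" "\<And>x. g x \<le> 2" for g :: "_ \<Rightarrow> real"
        proof -
          have m: "(\<lambda>x. g x * indicator (A k) (x $ k)) \<in> borel_measurable borel"
            using that A' by measurable
          have b: "norm (g x * indicator (A k) (x $ k)) \<le> 2" for x
            using that(2)[of x] that(3)[of x] by (auto simp: indicator_def)
          show ?thesis using L meas[OF m] b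
            by (auto intro!: M.integrable_const_bound[where B=2] N.integrable_const_bound[where B=2])
        qed
        have i0: "integrable L (\<lambda>x. w J A x * indicator (A k) (x $ k))"
          using w01[of J A] by (intro iL) (auto intro: order_trans[of _ 1])
        have ic: "integrable L (\<lambda>x. w J A x * (1 + cos (t \<bullet> x)) * indicator (A k) (x $ k))"
          and isn: "integrable L (\<lambda>x. w J A x * (1 + sin (t \<bullet> x)) * indicator (A k) (x $ k))"
          by (intro iL bnd; simp)+
        have split_integral: "(\<integral>x. complex_of_real (u x - v x) + \<i> * complex_of_real (u' x - v x) \<partial>L)
            = complex_of_real ((\<integral>x. u x \<partial>L) - (\<integral>x. v x \<partial>L))
              + \<i> * complex_of_real ((\<integral>x. u' x \<partial>L) - (\<integral>x. v x \<partial>L))"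
          if "integrable L u" "integrable L v" "integrable L u'" for u v u' :: "_ \<Rightarrow> real"
          using that by simp
        have feq: "(\<lambda>x. w (insert k J) A x *\<^sub>R iexp (t \<bullet> x)) = (\<lambda>x.
            complex_of_real (w J A x * (1 + cos (t \<bullet> x)) * indicator (A k) (x $ k)
            - w J A x * indicator (A k) (x $ k))
          + \<i> * complex_of_real (w J A x * (1 + sin (t \<bullet> x)) * indicator (A k) (x $ k)
            - w J A x * indicator (A k) (x $ k)))"
          unfolding wi by (auto simp: fun_eq_iff complex_eq_iff Re_exp Im_exp algebra_simps)
        show ?thesis unfolding feq by (rule split_integral[OF ic i0 isn])
      qed
      then show "(\<integral>x. w (insert k J) A x *\<^sub>R iexp (t \<bullet> x) \<partial>M) = (\<integral>x. w (insert k J) A x *\<^sub>R iexp (t \<bullet> x) \<partial>N)"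
        using u0 uc us by simp
    qed
  qed
  have box: "measure M (box a b) = measure N (box a b)" for a b :: "real ^ 'a"
  proof -
    define A where "A j = {a $ j<..<b $ j}" for j
    have ind: "w UNIV A x = indicator (box a b) x" for x
      unfolding w_def A_def by (auto simp: indicator_def mem_box_cart prod.If_cases)
    have "complex_of_real (\<integral>x. w UNIV A x \<partial>M) = complex_of_real (\<integral>x. w UNIV A x \<partial>N)"
      using step[rule_format, of A UNIV 0] by (simp add: A_def scaleR_conv_of_real)
    then show ?thesis unfolding ind by (simp add: sM sN)
  qed
  show ?thesis
  proof (rule measure_eqI_generator_eq)
    let ?E = "range (\<lambda>(a, b). box a b :: (real ^ 'a) set)"
    show "Int_stable ?E"
      by (auto simp: Int_stable_def box_Int_box)
    show "?E \<subseteq> Pow UNIV" by simp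
    show "sets M = sigma_sets UNIV ?E" "sets N = sigma_sets UNIV ?E"
      unfolding sM sN by (subst borel_eq_box, simp)+
    show "emeasure M X = emeasure N X" if "X \<in> ?E" for X
      using that box by (auto simp: M.emeasure_eq_measure N.emeasure_eq_measure)
    show "range (\<lambda>n::nat. box (- real n *\<^sub>R One) (real n *\<^sub>R One) :: (real ^ 'a) set) \<subseteq> ?E" by auto
    show "(\<Union>n::nat. box (- real n *\<^sub>R One) (real n *\<^sub>R One) :: (real ^ 'a) set) = UNIV"
      using UN_box_eq_UNIV by simp
    show "emeasure M (box (- real i *\<^sub>R One) (real i *\<^sub>R One)) \<noteq> \<infinity>" for i :: nat
      by simp
  qed
qed

section \<open>The central limit theorem for empirical distributions\<close>

text \<open>The product law as a pmf on total functions, with \<open>undefined\<close> outside the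
  first \<open>n\<close> positions, so that binding, mapping and conditioning of pmfs are
  available.\<close>

definition iid_pmf :: "nat \<Rightarrow> 'a pmf \<Rightarrow> (nat \<Rightarrow> 'a) pmf" where
  "iid_pmf n P = Pi_pmf {..<n} undefined (\<lambda>_. P)"

definition fluct :: "'a::finite pmf \<Rightarrow> nat \<Rightarrow> (nat \<Rightarrow> 'a) \<Rightarrow> real ^ 'a" where
  "fluct P n x = (\<chi> a. (\<Sum>i<n. of_bool (x i = a) - pmf P a) / sqrt (real n))"

definition fluct_law :: "'a::finite pmf \<Rightarrow> nat \<Rightarrow> (real ^ 'a) measure" where
  "fluct_law P n = distr (measure_pmf (iid_pmf n P)) borel (fluct P n)"

lemma prob_space_fluct_law: "prob_space (fluct_law P n)"
  unfolding fluct_law_def by (intro prob_space.prob_space_distr prob_space_measure_pmf) simp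

lemma sets_fluct_law [simp]: "sets (fluct_law P n) = sets borel"
  by (simp add: fluct_law_def)

lemma iid_pmf_component: "i < n \<Longrightarrow> map_pmf (\<lambda>x. x i) (iid_pmf n P) = P"
  unfolding iid_pmf_def by (subst Pi_pmf_component) auto

lemma indep_vars_iid_pmf:
  "prob_space.indep_vars (measure_pmf (iid_pmf n P)) (\<lambda>_. borel) (\<lambda>i x. f (x i)) {..<n}"
  unfolding iid_pmf_def
  by (rule prob_space.indep_vars_compose2[OF prob_space_measure_pmf indep_vars_Pi_pmf]) auto

lemma sum_fluct: "(\<Sum>a\<in>UNIV. fluct P n x $ a) = 0"
proof -
  have "(\<Sum>a\<in>UNIV. fluct P n x $ a) = (\<Sum>i<n. \<Sum>a\<in>UNIV. of_bool (x i = a) - pmf P a) / sqrt n"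
    unfolding fluct_def by (simp add: sum_divide_distrib[symmetric] sum.swap[of _ UNIV])
  also have "\<dots> = 0"
    using sum_pmf_eq_1[of UNIV P] by (simp add: sum_subtractf of_bool_def)
  finally show ?thesis .
qed

lemma fluct_in_zero_sum: "fluct P n x \<in> zero_sum"
  using sum_fluct by (simp add: zero_sum_def)

text \<open>Hoeffding's inequality for indicators, which take values in [0, 1]. Its bound is free of
  \<open>n\<close>, so tightness holds for all \<open>n\<close> at once. For \<open>n = 0\<close>
  the division by \<open>sqrt 0\<close> makes the deviation 0, which is below
  \<open>s\<close>.\<close>

lemma fluct_component_tail:
  fixes P :: "'a::finite pmf"
  assumes s: "0 < s"
  shows "measure_pmf.prob (iid_pmf n P) {x. s \<le> \<bar>fluct P n x $ a\<bar>} \<le> 2 * exp (- 2 * s\<^sup>2)"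
proof (cases "n = 0")
  case True
  then show ?thesis using s by (simp add: fluct_def)
next
  case False
  let ?M = "measure_pmf (iid_pmf n P)"
  let ?X = "\<lambda>i (x :: nat \<Rightarrow> 'a). of_bool (x i = a) :: real"
  interpret indep_interval_bounded_random_variables ?M "{..<n}" ?X "\<lambda>_. 0" "\<lambda>_. 1"
  proof unfold_locales
    show "prob_space.indep_vars ?M (\<lambda>_. borel) ?X {..<n}"
      using indep_vars_iid_pmf[of n P "\<lambda>b. of_bool (b = a) :: real"] .
  qed auto
  interpret Hoeffding_ineq ?M "{..<n}" ?X "\<lambda>_. 0" "\<lambda>_. 1" "\<Sum>i<n. measure_pmf.expectation (iid_pmf n P) (?X i)"
    by unfold_locales simp
  have "measure_pmf.expectation (iid_pmf n P) (?X i) = pmf P a" if "i < n" for i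
  proof -
    have "measure_pmf.expectation (iid_pmf n P) (?X i)
        = measure_pmf.expectation (map_pmf (\<lambda>x. x i) (iid_pmf n P)) (\<lambda>b. of_bool (b = a))"
      by simp
    also have "(\<lambda>b. of_bool (b = a) :: real) = indicator {a}"
      by (auto simp: indicator_def)
    also have "measure_pmf.expectation (map_pmf (\<lambda>x. x i) (iid_pmf n P)) (indicator {a} :: _ \<Rightarrow> real) = measure P {a}"
      unfolding iid_pmf_component[OF that] by simp
    finally show ?thesis by (simp add: measure_pmf_single indicator_def of_bool_def)
  qed
  then have mu: "(\<Sum>i<n. measure_pmf.expectation (iid_pmf n P) (?X i)) = real n * pmf P a"
    by simp
  have iff: "s \<le> \<bar>fluct P n x $ a\<bar> \<longleftrightarrow> sqrt n * s \<le> \<bar>(\<Sum>i<n. ?X i x) - n * pmf P a\<bar>" for x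
    using False by (simp add: fluct_def sum_subtractf field_simps)
  have "measure_pmf.prob (iid_pmf n P) {x. sqrt n * s \<le> \<bar>(\<Sum>i<n. ?X i x) - n * pmf P a\<bar>}
      \<le> 2 * exp (-2 * (sqrt n * s)\<^sup>2 / (\<Sum>i<n. (1 - 0)\<^sup>2))"
    using Hoeffding_ineq_abs_ge[of "sqrt n * s"] s False unfolding mu by simp
  also have "\<dots> = 2 * exp (- 2 * s\<^sup>2)"
    using False by (simp add: power_mult_distrib)
  finally show ?thesis unfolding iff .
qed

text \<open>A union bound over the letters; the radius \<open>d * s\<close> comes from bounding the
  norm by the sum of the absolute values of the \<open>d\<close> coordinates.\<close>

lemma fluct_law_tight:
  fixes P :: "'a::finite pmf"
  assumes "0 < e"
  shows "\<exists>K. \<forall>n. 1 - e < measure (fluct_law P n) {x. norm x \<le> K}"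
proof -
  define d where "d = real CARD('a)"
  have d: "d > 0" by (simp add: d_def)
  have "((\<lambda>s::real. d * (2 * exp (- 2 * s\<^sup>2))) \<longlongrightarrow> 0) at_top"
    by real_asymp
  then have "\<forall>\<^sub>F s in at_top. d * (2 * exp (- 2 * s\<^sup>2)) < e"
    using assms by (intro order_tendstoD)
  then have "\<forall>\<^sub>F s in at_top. d * (2 * exp (- 2 * s\<^sup>2)) < e \<and> 0 < s"
    using eventually_gt_at_top by eventually_elim auto
  then obtain s where s: "d * (2 * exp (- 2 * s\<^sup>2)) < e" "0 < s"
    by (auto dest!: eventually_happens)
  show ?thesis
  proof (intro exI allI)
    fix n
    let ?M = "measure_pmf (iid_pmf n P)"
    interpret L: prob_space "fluct_law P n" by (rule prob_space_fluct_law)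
    have sub: "{x. \<not> norm (fluct P n x) \<le> d * s} \<subseteq> (\<Union>a. {x. s \<le> \<bar>fluct P n x $ a\<bar>})"
    proof (rule ccontr)
      assume "\<not> ?thesis"
      then obtain x where x: "\<not> norm (fluct P n x) \<le> d * s" and small: "\<And>a. \<bar>fluct P n x $ a\<bar> < s"
        by (auto simp: not_le) (meson not_le)
      have "norm (fluct P n x) \<le> (\<Sum>a\<in>UNIV. \<bar>fluct P n x $ a\<bar>)" by (rule norm_le_l1_cart)
      also have "\<dots> \<le> (\<Sum>a\<in>(UNIV :: 'a set). s)" using small by (intro sum_mono) (simp add: less_imp_le)
      finally show False using x by (simp add: d_def)
    qed
    have "measure ?M {x. \<not> norm (fluct P n x) \<le> d * s} \<le> measure ?M (\<Union>a. {x. s \<le> \<bar>fluct P n x $ a\<bar>})"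
      using sub by (intro measure_pmf.finite_measure_mono) auto
    also have "\<dots> \<le> (\<Sum>a\<in>UNIV. measure ?M {x. s \<le> \<bar>fluct P n x $ a\<bar>})"
      by (intro measure_pmf.finite_measure_subadditive_finite) auto
    also have "\<dots> \<le> (\<Sum>a\<in>(UNIV :: 'a set). 2 * exp (- 2 * s\<^sup>2))"
      using s by (intro sum_mono fluct_component_tail)
    also have "\<dots> < e" using s by (simp add: d_def)
    finally have "measure ?M {x. \<not> norm (fluct P n x) \<le> d * s} < e" .
    moreover have "measure ?M {x. \<not> norm (fluct P n x) \<le> d * s} = 1 - measure ?M {x. norm (fluct P n x) \<le> d * s}"
      using measure_pmf.prob_compl[of "{x. norm (fluct P n x) \<le> d * s}" "iid_pmf n P"]
      by (simp add: Compl_eq_Diff_UNIV[symmetric] Collect_neg_eq)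
    moreover have "measure (fluct_law P n) {x. norm x \<le> d * s} = measure ?M {x. norm (fluct P n x) \<le> d * s}"
      unfolding fluct_law_def by (subst measure_distr) (auto simp: vimage_def)
    ultimately show "1 - e < measure (fluct_law P n) {x. norm x \<le> d * s}" by linarith
  qed
qed

text \<open>\<open>t \<bullet> fluct P n x\<close> is a normalised sum of independent centred
  variables \<open>W (x i)\<close> of variance \<open>v\<close>, so the characteristic function is
  an \<open>n\<close>-th power. A third-order Taylor bound leaves an error of order
  \<open>1 / (n * sqrt n)\<close> per factor, hence \<open>1 / sqrt n\<close> for the power.\<close>

lemma fluct_law_char_limit:
  fixes P :: "'a::finite pmf"
  shows "(\<lambda>n. \<integral>x. iexp (t \<bullet> x) \<partial>fluct_law P n)
    \<longlonglongrightarrow> exp (- complex_of_real (t \<bullet> (cov_matrix P *v t)) / 2)"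
proof -
  define W where "W b = t $ b - (\<Sum>a\<in>UNIV. t $ a * pmf P a)" for b
  define v where "v = t \<bullet> (cov_matrix P *v t)"
  define \<mu> where "\<mu> = distr (measure_pmf P) borel W"
  define C where "C = (\<Sum>b\<in>UNIV. \<bar>W b\<bar> ^ 3)"
  interpret \<mu>: real_distribution \<mu> unfolding \<mu>_def by (rule prob_space.real_distribution_distr[OF prob_space_measure_pmf]) simp
  have s1: "(\<Sum>b\<in>UNIV. pmf P b) = 1" using sum_pmf_eq_1[of UNIV P] by simp
  have EP: "measure_pmf.expectation P f = (\<Sum>b\<in>UNIV. f b * pmf P b)" for f :: "'a \<Rightarrow> real"
    by (subst integral_measure_pmf_real[where A=UNIV]) auto
  have W0: "measure_pmf.expectation P W = 0"
    unfolding EP by (simp add: W_def left_diff_distrib sum_subtractf s1 flip: sum_distrib_left sum_distrib_right)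
  have W2: "measure_pmf.expectation P (\<lambda>b. (W b)\<^sup>2) = v"
  proof -
    define m where "m = (\<Sum>a\<in>UNIV. t $ a * pmf P a)"
    have "measure_pmf.expectation P (\<lambda>b. (W b)\<^sup>2) =
      (\<Sum>b\<in>UNIV. (t $ b)\<^sup>2 * pmf P b - 2 * m * (t $ b * pmf P b) + m\<^sup>2 * pmf P b)"
      unfolding EP W_def m_def[symmetric]
      by (intro sum.cong refl) (simp add: power2_eq_square algebra_simps)
    also have "\<dots> = (\<Sum>b\<in>UNIV. (t $ b)\<^sup>2 * pmf P b) - 2 * m * m + m\<^sup>2 * 1"
      by (simp only: sum.distrib sum_subtractf sum_distrib_left[symmetric] m_def[symmetric] s1)
    also have "\<dots> = (\<Sum>b\<in>UNIV. (t $ b)\<^sup>2 * pmf P b) - m\<^sup>2"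
      by (simp add: power2_eq_square)
    finally have l: "measure_pmf.expectation P (\<lambda>b. (W b)\<^sup>2) = (\<Sum>b\<in>UNIV. (t $ b)\<^sup>2 * pmf P b) - m\<^sup>2" .
    have cov: "(cov_matrix P *v t) $ x = pmf P x * t $ x - pmf P x * m" for x
    proof -
      have "(cov_matrix P *v t) $ x = (\<Sum>y\<in>UNIV. (if y = x then pmf P x * t $ x else 0) - pmf P x * (t $ y * pmf P y))"
        unfolding cov_matrix_def matrix_vector_mult_def
        by (auto intro!: sum.cong simp: of_bool_def algebra_simps)
      then show ?thesis by (simp add: sum_subtractf m_def flip: sum_distrib_left)
    qed
    have "v = (\<Sum>x\<in>UNIV. (t $ x)\<^sup>2 * pmf P x - m * (t $ x * pmf P x))"
      unfolding v_def inner_vec_def cov by (simp add: power2_eq_square algebra_simps)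
    also have "\<dots> = (\<Sum>b\<in>UNIV. (t $ b)\<^sup>2 * pmf P b) - m * m"
      by (simp only: sum_subtractf sum_distrib_left[symmetric] m_def[symmetric])
    finally show ?thesis using l by (simp add: power2_eq_square)
  qed
  have v0: "0 \<le> v" unfolding W2[symmetric] by simp
  have intP: "integrable (measure_pmf P) f" for f :: "'a \<Rightarrow> real"
    by (rule integrable_measure_pmf_finite) simp
  have char_eq: "(\<integral>x. iexp (t \<bullet> x) \<partial>fluct_law P n) = char \<mu> (1 / sqrt n) ^ n" if "n > 0" for n
  proof -
    have tf: "t \<bullet> fluct P n x = (\<Sum>i<n. W (x i)) / sqrt n" for x
    proof -
      have "t \<bullet> fluct P n x = (\<Sum>a\<in>UNIV. \<Sum>i<n. t $ a * (of_bool (x i = a) - pmf P a)) / sqrt n"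
        unfolding inner_vec_def fluct_def by (simp add: sum_distrib_left sum_divide_distrib)
      also have "(\<Sum>a\<in>UNIV. \<Sum>i<n. t $ a * (of_bool (x i = a) - pmf P a))
          = (\<Sum>i<n. \<Sum>a\<in>UNIV. t $ a * of_bool (x i = a) - t $ a * pmf P a)"
        by (subst sum.swap) (simp add: right_diff_distrib)
      also have "\<dots> = (\<Sum>i<n. W (x i))"
        by (intro sum.cong refl) (simp add: W_def sum_subtractf of_bool_def if_distrib[of "\<lambda>u. _ * u"])
      finally show ?thesis .
    qed
    have "(\<integral>x. iexp (t \<bullet> x) \<partial>fluct_law P n) = (\<integral>x. iexp (t \<bullet> fluct P n x) \<partial>measure_pmf (iid_pmf n P))"
      unfolding fluct_law_def by (subst integral_distr) auto
    also have "\<dots> = char (distr (measure_pmf (iid_pmf n P)) borel (\<lambda>x. \<Sum>i<n. W (x i))) (1 / sqrt n)"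
      unfolding char_def by (subst integral_distr) (auto simp: tf)
    also have "\<dots> = (\<Prod>i<n. char (distr (measure_pmf (iid_pmf n P)) borel (\<lambda>x. W (x i))) (1 / sqrt n))"
      by (intro prob_space.char_distr_sum[OF prob_space_measure_pmf] indep_vars_iid_pmf)
    also have "\<dots> = (\<Prod>i<n. char \<mu> (1 / sqrt n))"
    proof (intro prod.cong refl)
      fix i assume "i \<in> {..<n}"
      then have "\<mu> = distr (measure_pmf (map_pmf (\<lambda>x. x i) (iid_pmf n P))) borel W"
        unfolding \<mu>_def by (simp add: iid_pmf_component)
      also have "\<dots> = distr (measure_pmf (iid_pmf n P)) borel (\<lambda>x. W (x i))"
        unfolding map_pmf_rep_eq by (subst distr_distr) (auto simp: comp_def)
      finally show "char (distr (measure_pmf (iid_pmf n P)) borel (\<lambda>x. W (x i))) (1 / sqrt n) = char \<mu> (1 / sqrt n)"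
        by simp
    qed
    finally show ?thesis by simp
  qed
  have C: "\<bar>W b\<bar> ^ 3 \<le> C" for b
    unfolding C_def by (intro member_le_sum) auto
  have approx: "cmod (char \<mu> (1 / sqrt n) - (1 - v / 2 / n)) \<le> C / (6 * n * sqrt n)" if "n > 0" for n :: nat
  proof -
    have "cmod (char \<mu> (1 / sqrt n) - (1 - (1 / sqrt n)\<^sup>2 * v / 2))
      \<le> ((1 / sqrt n)\<^sup>2 / 6) * measure_pmf.expectation P (\<lambda>b. min (6 * (W b)\<^sup>2) (\<bar>1 / sqrt n\<bar> * \<bar>W b\<bar> ^ 3))"
      by (rule prob_space.char_approx3'[OF prob_space_measure_pmf]) (auto simp: intP W0 W2 \<mu>_def)
    also have "measure_pmf.expectation P (\<lambda>b. min (6 * (W b)\<^sup>2) (\<bar>1 / sqrt n\<bar> * \<bar>W b\<bar> ^ 3))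
        \<le> measure_pmf.expectation P (\<lambda>b. C / sqrt n)"
    proof (intro integral_mono intP)
      fix b
      have "\<bar>1 / sqrt n\<bar> * \<bar>W b\<bar> ^ 3 \<le> C / sqrt n"
        using C[of b] that by (simp add: divide_right_mono)
      then show "min (6 * (W b)\<^sup>2) (\<bar>1 / sqrt n\<bar> * \<bar>W b\<bar> ^ 3) \<le> C / sqrt n"
        by (rule min.coboundedI2)
    qed
    also have "\<dots> = C / sqrt n" by simp
    finally show ?thesis using that by (simp add: field_simps mult_left_mono power_divide)
  qed
  have main: "\<forall>\<^sub>F n in sequentially. norm ((\<integral>x. iexp (t \<bullet> x) \<partial>fluct_law P n) - complex_of_real ((1 + (- v / 2) / n) ^ n))
      \<le> C / (6 * sqrt n)"
    \<comment> \<open>For \<open>n\<close> at least \<open>v\<close> the number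
      \<open>1 - v / (2 * n)\<close> has absolute value at most 1, which the comparison of
      \<open>n\<close>-th powers requires.\<close>
    using eventually_gt_at_top[of "nat \<lceil>v\<rceil>"]
  proof eventually_elim
    case (elim n)
    then have n: "n > 0" "v \<le> n" by linarith+
    have "norm (char \<mu> (1 / sqrt n) ^ n - complex_of_real (1 + (- v / 2) / n) ^ n)
      \<le> n * norm (char \<mu> (1 / sqrt n) - complex_of_real (1 + (- v / 2) / n))"
    proof (rule norm_power_diff)
      show "norm (char \<mu> (1 / sqrt n)) \<le> 1" by (rule \<mu>.cmod_char_le_1)
      have "\<bar>1 + (- v / 2) / n\<bar> \<le> 1" using n v0 by (auto simp: abs_le_iff field_simps)
      then show "norm (complex_of_real (1 + (- v / 2) / n)) \<le> 1" by (simp only: norm_of_real)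
    qed
    also have "\<dots> \<le> n * (C / (6 * n * sqrt n))"
      using approx[OF n(1)] by (intro mult_left_mono) simp_all
    also have "\<dots> = C / (6 * sqrt n)" using n by simp
    finally show ?case using char_eq[OF n(1)] by simp
  qed
  have "(\<lambda>n. C / (6 * sqrt n)) \<longlonglongrightarrow> 0" by real_asymp
  then have null: "(\<lambda>n. (\<integral>x. iexp (t \<bullet> x) \<partial>fluct_law P n) - complex_of_real ((1 + (- v / 2) / n) ^ n)) \<longlonglongrightarrow> 0"
    by (rule Lim_null_comparison[OF main])
  have "(\<lambda>n. complex_of_real ((1 + (- v / 2) / n) ^ n)) \<longlonglongrightarrow> complex_of_real (exp (- v / 2))"
    by (intro tendsto_of_real tendsto_exp_limit_sequentially)
  from tendsto_add[OF null this] show ?thesis by (simp add: v_def exp_of_real[symmetric])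
qed

lemma prob_space_centered_gaussian: "prob_space (centered_gaussian \<Sigma>)"
proof -
  have "prob_space (\<Pi>\<^sub>M i\<in>UNIV. std_normal_distribution)"
    by (intro prob_space_PiM prob_space_normal_density) simp
  then show ?thesis
    unfolding centered_gaussian_def by (rule prob_space.prob_space_distr) (rule measurable_matrix_chi)
qed

text \<open>Dominated convergence passes the pointwise convergence on to characteristic functions,
  whose limit is already known. Together with \<open>skorokhod_euclidean\<close> this plays the role
  of Levy's continuity theorem in several dimensions.\<close>

lemma fluct_limit_law:
  fixes P :: "'a::finite pmf"
  assumes "prob_space \<Omega>" and Y [measurable]: "\<And>n. Y n \<in> borel_measurable \<Omega>"
    and law: "\<And>n. distr \<Omega> borel (Y n) = fluct_law P (r n)" and r: "filterlim r sequentially sequentially"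
    and Z [measurable]: "Z \<in> borel_measurable \<Omega>"
    and lim: "\<And>\<omega>. \<omega> \<in> space \<Omega> \<Longrightarrow> (\<lambda>n. Y n \<omega>) \<longlonglongrightarrow> Z \<omega>"
  shows "distr \<Omega> borel Z = centered_gaussian (cov_matrix P)"
proof (rule char_vec_unique)
  interpret prob_space \<Omega> by fact
  show "prob_space (distr \<Omega> borel Z)" by (rule prob_space_distr) simp
  show "prob_space (centered_gaussian (cov_matrix P))" by (rule prob_space_centered_gaussian)
  fix t
  have "(\<lambda>n. \<integral>\<omega>. iexp (t \<bullet> Y n \<omega>) \<partial>\<Omega>) \<longlonglongrightarrow> (\<integral>\<omega>. iexp (t \<bullet> Z \<omega>) \<partial>\<Omega>)"
  proof (rule integral_dominated_convergence[where w="\<lambda>_. 1"])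
    show "AE \<omega> in \<Omega>. (\<lambda>n. iexp (t \<bullet> Y n \<omega>)) \<longlonglongrightarrow> iexp (t \<bullet> Z \<omega>)"
      by (intro AE_I2 tendsto_intros lim)
  qed auto
  moreover have "(\<integral>\<omega>. iexp (t \<bullet> Y n \<omega>) \<partial>\<Omega>) = (\<integral>x. iexp (t \<bullet> x) \<partial>fluct_law P (r n))" for n
    unfolding law[symmetric] by (subst integral_distr) auto
  moreover have "(\<lambda>n. \<integral>x. iexp (t \<bullet> x) \<partial>fluct_law P (r n))
      \<longlonglongrightarrow> exp (- complex_of_real (t \<bullet> (cov_matrix P *v t)) / 2)"
    by (rule filterlim_compose[OF fluct_law_char_limit r])
  ultimately have "(\<integral>\<omega>. iexp (t \<bullet> Z \<omega>) \<partial>\<Omega>) = exp (- complex_of_real (t \<bullet> (cov_matrix P *v t)) / 2)"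
    using LIMSEQ_unique by auto
  then show "(\<integral>x. iexp (t \<bullet> x) \<partial>distr \<Omega> borel Z) = (\<integral>x. iexp (t \<bullet> x) \<partial>centered_gaussian (cov_matrix P))"
    by (subst integral_distr) (auto simp: char_centered_gaussian[OF cov_matrix_factorization])
qed (auto simp: centered_gaussian_def)

section \<open>The function \<open>\<theta>\<close>\<close>

text \<open>The optimal coupling enters as its vector of weights \<open>p\<close>, so that
  perturbations \<open>p + t *\<^sub>R B\<close> live in the same space as the signed
  couplings.\<close>

locale finite_ot =
  fixes PX :: "'a::finite pmf" and PY :: "'b::finite pmf" and c :: "'a \<Rightarrow> 'b \<Rightarrow> real"
    and p :: "real ^ ('a \<times> 'b)" and S :: "('a \<times> 'b) set"
  assumes pos_X: "0 < pmf PX x" and pos_Y: "0 < pmf PY y" and cost_nonneg: "0 \<le> c x y"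
    and p_nonneg: "0 \<le> p $ z" and S_def: "S = {z. 0 < p $ z}"
    and p_fst: "(\<Sum>y\<in>UNIV. p $ (x, y)) = pmf PX x"
    and p_snd: "(\<Sum>x\<in>UNIV. p $ (x, y)) = pmf PY y"
    and p_optimal: "\<lbrakk>\<And>z. 0 \<le> q $ z; \<And>x. (\<Sum>y\<in>UNIV. q $ (x, y)) = pmf PX x;
        \<And>y. (\<Sum>x\<in>UNIV. q $ (x, y)) = pmf PY y\<rbrakk>
      \<Longrightarrow> (\<Sum>(x, y)\<in>UNIV. p $ (x, y) * c x y) \<le> (\<Sum>(x, y)\<in>UNIV. q $ (x, y) * c x y)"
begin

definition cost :: "real ^ ('a \<times> 'b) \<Rightarrow> real" where
  "cost B = (\<Sum>(x, y)\<in>UNIV. B $ (x, y) * c x y)"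

definition feasible :: "real ^ 'a \<Rightarrow> real ^ 'b \<Rightarrow> (real ^ ('a \<times> 'b)) set" where
  "feasible \<beta>X \<beta>Y = {B \<in> signed_couplings \<beta>X \<beta>Y. {z. B $ z < 0} \<subseteq> S}"

lemma theta_eq: "theta c S \<beta>X \<beta>Y = (INF B\<in>feasible \<beta>X \<beta>Y. cost B)"
  unfolding theta_def feasible_def cost_def ..

lemma cost_add: "cost (A + B) = cost A + cost B"
  unfolding cost_def by (simp add: case_prod_unfold distrib_right sum.distrib)

lemma cost_scaleR: "cost (t *\<^sub>R B) = t * cost B"
  unfolding cost_def by (simp add: case_prod_unfold sum_distrib_left mult_ac)

lemma feasibleD:
  assumes "B \<in> feasible \<beta>X \<beta>Y"
  shows "(\<Sum>y\<in>UNIV. B $ (x, y)) = \<beta>X $ x" "(\<Sum>x\<in>UNIV. B $ (x, y)) = \<beta>Y $ y" "B $ z < 0 \<Longrightarrow> z \<in> S"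
  using assms by (auto simp: feasible_def signed_couplings_def)

lemma feasibleI:
  assumes "\<And>x. (\<Sum>y\<in>UNIV. B $ (x, y)) = \<beta>X $ x" "\<And>y. (\<Sum>x\<in>UNIV. B $ (x, y)) = \<beta>Y $ y"
    "\<And>z. B $ z < 0 \<Longrightarrow> z \<in> S"
  shows "B \<in> feasible \<beta>X \<beta>Y"
  using assms by (auto simp: feasible_def signed_couplings_def)

lemma feasible_add:
  assumes "A \<in> feasible \<beta>X \<beta>Y" "B \<in> feasible \<gamma>X \<gamma>Y"
  shows "A + B \<in> feasible (\<beta>X + \<gamma>X) (\<beta>Y + \<gamma>Y)"
proof (rule feasibleI)
  fix z assume "(A + B) $ z < 0"
  then have "A $ z < 0 \<or> B $ z < 0" by auto
  then show "z \<in> S" using assms feasibleD(3) by blast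
qed (use assms in \<open>simp_all add: sum.distrib feasibleD(1,2)\<close>)

lemma p_sum: "(\<Sum>z\<in>UNIV. p $ z) = 1"
proof -
  have "(\<Sum>z\<in>UNIV. p $ z) = (\<Sum>x\<in>UNIV. \<Sum>y\<in>UNIV. p $ (x, y))"
    by (simp add: sum.cartesian_product)
  then show ?thesis using sum_pmf_eq_1[of UNIV PX] by (simp add: p_fst)
qed

lemma p_le_1: "p $ z \<le> 1"
  unfolding p_sum[symmetric] by (intro member_le_sum p_nonneg) auto

lemma p_min: obtains \<delta> where "0 < \<delta>" "\<And>z. z \<in> S \<Longrightarrow> \<delta> \<le> p $ z"
proof
  \<comment> \<open>The element 1 keeps the set nonempty without an argument that \<open>S\<close>
    is.\<close>
  show "0 < Min (insert 1 (($) p ` S))" unfolding S_def by (subst Min_gr_iff) auto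
  show "Min (insert 1 (($) p ` S)) \<le> p $ z" if "z \<in> S" for z using that by (intro Min_le) auto
qed

text \<open>Where \<open>B\<close> is negative, feasibility puts the entry into \<open>S\<close>,
  and there \<open>p\<close> has the reserve \<open>\<delta>\<close>.\<close>

lemma perturbation_nonneg:
  assumes \<delta>: "\<And>z. z \<in> S \<Longrightarrow> \<delta> \<le> p $ z" and B: "B \<in> feasible \<beta>X \<beta>Y" and t: "0 \<le> t"
    and small: "\<And>z. t * \<bar>B $ z\<bar> \<le> \<delta>"
  shows "0 \<le> (p + t *\<^sub>R B) $ z"
proof (cases "B $ z < 0")
  case True
  then have "\<delta> \<le> p $ z" using feasibleD(3)[OF B] \<delta> by blast
  moreover have "- \<delta> \<le> t * B $ z" using small[of z] True by simp
  ultimately show ?thesis by simp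
next
  case False
  then show ?thesis using p_nonneg[of z] t by simp
qed

text \<open>A small step from \<open>p\<close> along \<open>B\<close> is again a coupling with the
  same marginals, so it cannot lower the cost. Optimality of \<open>p\<close> enters here, and it is
  what bounds \<open>theta\<close> from below.\<close>

lemma cost_feasible_zero:
  assumes B: "B \<in> feasible 0 0"
  shows "0 \<le> cost B"
proof -
  obtain \<delta> where \<delta>: "0 < \<delta>" "\<And>z. z \<in> S \<Longrightarrow> \<delta> \<le> p $ z" using p_min by blast
  define t where "t = \<delta> / (1 + norm B)"
  have t: "0 < t" using \<delta> by (simp add: t_def add_pos_nonneg)
  have "t * \<bar>B $ z\<bar> \<le> \<delta>" for z
  proof -
    have "t * \<bar>B $ z\<bar> \<le> t * (1 + norm B)"
      using t component_le_norm_cart[of B z] by (intro mult_left_mono) auto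
    also have "\<dots> = \<delta>" unfolding t_def using norm_ge_zero[of B] by (simp add: add_nonneg_eq_0_iff)
    finally show ?thesis .
  qed
  then have nn: "0 \<le> (p + t *\<^sub>R B) $ z" for z
    using perturbation_nonneg[OF \<delta>(2) B] t by simp
  have "cost p \<le> cost (p + t *\<^sub>R B)"
    unfolding cost_def
    by (rule p_optimal[OF nn]) (simp_all add: sum.distrib p_fst p_snd feasibleD(1,2)[OF B] flip: sum_distrib_left)
  then show ?thesis using t by (simp add: cost_add cost_scaleR zero_le_mult_iff)
qed

lemma cost_abs_le:
  assumes "\<And>z. \<bar>B $ z\<bar> \<le> K"
  shows "\<bar>cost B\<bar> \<le> K * (\<Sum>(x, y)\<in>UNIV. c x y)"
proof -
  have "\<bar>cost B\<bar> \<le> (\<Sum>(x, y)\<in>UNIV. \<bar>B $ (x, y) * c x y\<bar>)"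
    unfolding cost_def case_prod_unfold by (rule sum_abs)
  also have "\<dots> \<le> (\<Sum>(x, y)\<in>UNIV. K * c x y)"
    using assms cost_nonneg by (intro sum_mono) (auto simp: abs_mult intro!: mult_right_mono)
  finally show ?thesis by (simp add: case_prod_unfold sum_distrib_left)
qed

text \<open>Witness: \<open>(\<beta>X + K PX) \<otimes> (\<beta>Y + K PY) / K - K p\<close>, with \<open>K\<close> so large that both factors
  are nonnegative.\<close>
lemma ex_small_feasible:
  obtains C where "0 \<le> C" "\<And>\<beta>X \<beta>Y. \<beta>X \<in> zero_sum \<Longrightarrow> \<beta>Y \<in> zero_sum \<Longrightarrow>
    \<exists>B\<in>feasible \<beta>X \<beta>Y. \<forall>z. \<bar>B $ z\<bar> \<le> C * (norm \<beta>X + norm \<beta>Y)"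
proof -
  define m where "m = Min (range (pmf PX) \<union> range (pmf PY))"
  have m: "0 < m" "\<And>x. m \<le> pmf PX x" "\<And>y. m \<le> pmf PY y"
    unfolding m_def using pos_X pos_Y by (auto simp: Min_gr_iff intro!: Min_le)
  have m1: "m \<le> 1" using m(2) pmf_le_1 by (rule order_trans)
  show ?thesis
  proof (rule that)
    \<comment> \<open>Both factors of the witness are at most \<open>2 * K\<close>, so the product
      term is at most \<open>4 * K\<close>; the subtracted multiple of \<open>p\<close> contributes
      at most \<open>K\<close>, hence 5.\<close>
    show "0 \<le> 5 / m" using m by simp
    fix \<beta>X :: "real ^ 'a" and \<beta>Y :: "real ^ 'b"
    assume z: "\<beta>X \<in> zero_sum" "\<beta>Y \<in> zero_sum"
    \<comment> \<open>As \<open>m\<close> is the least probability, \<open>K\<close> times any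
      probability dominates every entry of both deviations.\<close>
    define K where "K = (norm \<beta>X + norm \<beta>Y) / m"
    show "\<exists>B\<in>feasible \<beta>X \<beta>Y. \<forall>z. \<bar>B $ z\<bar> \<le> 5 / m * (norm \<beta>X + norm \<beta>Y)"
    proof (cases "K = 0")
      case True
      then have "norm \<beta>X + norm \<beta>Y = 0" using m unfolding K_def by simp
      then have "\<beta>X = 0" "\<beta>Y = 0" by (simp_all add: add_nonneg_eq_0_iff)
      then show ?thesis by (intro bexI[of _ 0] feasibleI) auto
    next
      case False
      then have K: "0 < K" using m by (auto simp: K_def less_le)
      have mK: "m * K = norm \<beta>X + norm \<beta>Y" using m by (simp add: K_def)
      define u where "u x = \<beta>X $ x + K * pmf PX x" for x
      define v where "v y = \<beta>Y $ y + K * pmf PY y" for y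
      have bx: "\<bar>\<beta>X $ x\<bar> \<le> m * K" for x
        using component_le_norm_cart[of \<beta>X x] norm_ge_zero[of \<beta>Y] mK by linarith
      have "\<bar>\<beta>Y $ y\<bar> \<le> m * K" for y
        using component_le_norm_cart[of \<beta>Y y] norm_ge_zero[of \<beta>X] mK by linarith
      note bounds = bx this
      have mK': "m * K \<le> K * pmf PX x" "m * K \<le> K * pmf PY y" for x y
        using m K by (simp_all add: mult.commute mult_left_mono)
      have K': "K * pmf PX x \<le> K" "K * pmf PY y \<le> K" "m * K \<le> K" for x y
        using K m1 by (simp_all add: pmf_le_1 mult_le_cancel_right2)
      have u: "0 \<le> u x" "u x \<le> 2 * K" for x
        using bounds(1)[of x] mK'(1)[of x] K'(1)[of x] K'(3) unfolding u_def by linarith+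
      have v: "0 \<le> v y" "v y \<le> 2 * K" for y
        using bounds(2)[of y] mK'(2)[of y] K'(2)[of y] K'(3) unfolding v_def by linarith+
      have su: "(\<Sum>x\<in>UNIV. u x) = K" and sv: "(\<Sum>y\<in>UNIV. v y) = K"
        using z sum_pmf_eq_1[of UNIV PX] sum_pmf_eq_1[of UNIV PY]
        by (simp_all add: u_def v_def sum.distrib zero_sum_def flip: sum_distrib_left)
      define B where "B = (\<chi> z. u (fst z) * v (snd z) / K - K * p $ z)"
      have "B \<in> feasible \<beta>X \<beta>Y"
      proof (rule feasibleI)
        show "(\<Sum>y\<in>UNIV. B $ (x, y)) = \<beta>X $ x" for x
          using K by (simp add: B_def sum_subtractf p_fst sv flip: sum_distrib_left sum_divide_distrib)
            (simp add: u_def)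
        show "(\<Sum>x\<in>UNIV. B $ (x, y)) = \<beta>Y $ y" for y
          using K by (simp add: B_def sum_subtractf p_snd su flip: sum_distrib_left sum_distrib_right sum_divide_distrib)
            (simp add: v_def)
        fix z assume "B $ z < 0"
        moreover have "0 \<le> u (fst z) * v (snd z) / K" using u v K by simp
        ultimately have "0 < K * p $ z" unfolding B_def by simp
        then show "z \<in> S" unfolding S_def using K by (simp add: zero_less_mult_iff)
      qed
      moreover have "\<bar>B $ z\<bar> \<le> 5 * K" for z
      proof -
        have "u (fst z) * v (snd z) / K \<le> 2 * K * (2 * K) / K"
          using u v K by (intro divide_right_mono mult_mono) auto
        then have "u (fst z) * v (snd z) / K \<le> 4 * K" using K by simp
        moreover have "0 \<le> u (fst z) * v (snd z) / K" using u v K by simp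
        moreover have "0 \<le> K * p $ z" "K * p $ z \<le> K" using K p_nonneg p_le_1 by (simp_all add: mult_le_cancel_left2)
        ultimately show ?thesis unfolding B_def by simp
      qed
      ultimately show ?thesis unfolding K_def by auto
    qed
  qed
qed

lemma zero_sum_minus: "\<beta> \<in> zero_sum \<Longrightarrow> - \<beta> \<in> zero_sum"
  by (simp add: zero_sum_def sum_negf)

lemma zero_sum_diff: "\<beta> \<in> zero_sum \<Longrightarrow> \<gamma> \<in> zero_sum \<Longrightarrow> \<beta> - \<gamma> \<in> zero_sum"
  by (simp add: zero_sum_def sum_subtractf)

lemma feasible_nonempty: "\<beta>X \<in> zero_sum \<Longrightarrow> \<beta>Y \<in> zero_sum \<Longrightarrow> feasible \<beta>X \<beta>Y \<noteq> {}"
  by (rule ex_small_feasible) blast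

text \<open>Adding a fixed feasible matrix for the negated marginals turns every feasible one into a
  feasible matrix for zero marginals, whose cost is nonnegative.\<close>

lemma bdd_below_cost:
  assumes "\<beta>X \<in> zero_sum" "\<beta>Y \<in> zero_sum"
  shows "bdd_below (cost ` feasible \<beta>X \<beta>Y)"
proof -
  obtain B' where B': "B' \<in> feasible (- \<beta>X) (- \<beta>Y)"
    using feasible_nonempty[OF assms[THEN zero_sum_minus]] by blast
  show ?thesis
  proof (rule bdd_belowI2)
    fix B assume "B \<in> feasible \<beta>X \<beta>Y"
    from feasible_add[OF this B'] have "B + B' \<in> feasible 0 0" by simp
    from cost_feasible_zero[OF this] show "- cost B' \<le> cost B" unfolding cost_add by simp
  qed
qed

lemma theta_le_cost:
  assumes "\<beta>X \<in> zero_sum" "\<beta>Y \<in> zero_sum" "B \<in> feasible \<beta>X \<beta>Y"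
  shows "theta c S \<beta>X \<beta>Y \<le> cost B"
  unfolding theta_eq by (rule cINF_lower[OF bdd_below_cost[OF assms(1,2)] assms(3)])

lemma theta_approx:
  assumes "\<beta>X \<in> zero_sum" "\<beta>Y \<in> zero_sum" "0 < \<epsilon>"
  obtains B where "B \<in> feasible \<beta>X \<beta>Y" "cost B < theta c S \<beta>X \<beta>Y + \<epsilon>"
proof -
  have "\<exists>v\<in>cost ` feasible \<beta>X \<beta>Y. v < theta c S \<beta>X \<beta>Y + \<epsilon>"
    using feasible_nonempty[OF assms(1,2)] assms(3) by (intro cInf_lessD) (auto simp: theta_eq)
  then show ?thesis using that by blast
qed

text \<open>Sublinearity: the difference is at most \<open>\<theta>(\<beta>X - \<gamma>X, \<beta>Y - \<gamma>Y)\<close>.\<close>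
lemma theta_lipschitz:
  obtains L where "0 \<le> L" "\<And>\<beta>X \<beta>Y \<gamma>X \<gamma>Y. \<lbrakk>\<beta>X \<in> zero_sum; \<beta>Y \<in> zero_sum; \<gamma>X \<in> zero_sum; \<gamma>Y \<in> zero_sum\<rbrakk>
    \<Longrightarrow> theta c S \<beta>X \<beta>Y \<le> theta c S \<gamma>X \<gamma>Y + L * (norm (\<beta>X - \<gamma>X) + norm (\<beta>Y - \<gamma>Y))"
proof -
  obtain C where C: "0 \<le> C" "\<And>\<beta>X \<beta>Y. \<beta>X \<in> zero_sum \<Longrightarrow> \<beta>Y \<in> zero_sum \<Longrightarrow>
    \<exists>B\<in>feasible \<beta>X \<beta>Y. \<forall>z. \<bar>B $ z\<bar> \<le> C * (norm \<beta>X + norm \<beta>Y)"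
    by (fact ex_small_feasible)
  define s where "s = (\<Sum>(x, y)\<in>UNIV. c x y)"
  have s: "0 \<le> s" unfolding s_def using cost_nonneg by (intro sum_nonneg) auto
  show ?thesis
  proof (rule that)
    show "0 \<le> C * s" using C(1) s by simp
    fix \<beta>X \<gamma>X :: "real ^ 'a" and \<beta>Y \<gamma>Y :: "real ^ 'b"
    assume z: "\<beta>X \<in> zero_sum" "\<beta>Y \<in> zero_sum" "\<gamma>X \<in> zero_sum" "\<gamma>Y \<in> zero_sum"
    obtain D where D: "D \<in> feasible (\<beta>X - \<gamma>X) (\<beta>Y - \<gamma>Y)"
      "\<And>z. \<bar>D $ z\<bar> \<le> C * (norm (\<beta>X - \<gamma>X) + norm (\<beta>Y - \<gamma>Y))"
      using C(2)[OF zero_sum_diff[OF z(1,3)] zero_sum_diff[OF z(2,4)]] by blast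
    have cD: "cost D \<le> C * s * (norm (\<beta>X - \<gamma>X) + norm (\<beta>Y - \<gamma>Y))"
      using cost_abs_le[of D, OF D(2)] by (simp add: s_def mult_ac)
    show "theta c S \<beta>X \<beta>Y \<le> theta c S \<gamma>X \<gamma>Y + C * s * (norm (\<beta>X - \<gamma>X) + norm (\<beta>Y - \<gamma>Y))"
    proof (rule field_le_epsilon)
      fix \<epsilon> :: real assume "0 < \<epsilon>"
      obtain B where B: "B \<in> feasible \<gamma>X \<gamma>Y" "cost B < theta c S \<gamma>X \<gamma>Y + \<epsilon>"
        using theta_approx[OF z(3,4) \<open>0 < \<epsilon>\<close>] by blast
      have "B + D \<in> feasible \<beta>X \<beta>Y" using feasible_add[OF B(1) D(1)] by simp
      from theta_le_cost[OF z(1,2) this] have "theta c S \<beta>X \<beta>Y \<le> cost B + cost D"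
        unfolding cost_add .
      then show "theta c S \<beta>X \<beta>Y \<le> theta c S \<gamma>X \<gamma>Y + C * s * (norm (\<beta>X - \<gamma>X) + norm (\<beta>Y - \<gamma>Y)) + \<epsilon>"
        using B(2) cD by linarith
    qed
  qed
qed

lemma closed_zero_sum: "closed (zero_sum :: (real ^ 'c::finite) set)"
  unfolding zero_sum_def by (intro closed_Collect_eq continuous_intros)

lemma theta_tendsto:
  assumes lim: "X \<longlonglongrightarrow> \<beta>X" "Y \<longlonglongrightarrow> \<beta>Y" and z: "\<And>n. X n \<in> zero_sum" "\<And>n. Y n \<in> zero_sum"
  shows "(\<lambda>n. theta c S (X n) (Y n)) \<longlonglongrightarrow> theta c S \<beta>X \<beta>Y"
proof -
  have z': "\<beta>X \<in> zero_sum" "\<beta>Y \<in> zero_sum"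
    using closed_sequentially[OF closed_zero_sum z(1) lim(1)] closed_sequentially[OF closed_zero_sum z(2) lim(2)] .
  obtain L where "0 \<le> L" and L: "\<And>\<beta>X \<beta>Y \<gamma>X \<gamma>Y. \<lbrakk>\<beta>X \<in> zero_sum; \<beta>Y \<in> zero_sum; \<gamma>X \<in> zero_sum; \<gamma>Y \<in> zero_sum\<rbrakk>
    \<Longrightarrow> theta c S \<beta>X \<beta>Y \<le> theta c S \<gamma>X \<gamma>Y + L * (norm (\<beta>X - \<gamma>X) + norm (\<beta>Y - \<gamma>Y))"
    by (fact theta_lipschitz)
  have bound: "\<forall>\<^sub>F n in sequentially. norm (theta c S (X n) (Y n) - theta c S \<beta>X \<beta>Y)
      \<le> L * (norm (X n - \<beta>X) + norm (Y n - \<beta>Y))"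
  proof (intro always_eventually allI)
    fix n
    show "norm (theta c S (X n) (Y n) - theta c S \<beta>X \<beta>Y) \<le> L * (norm (X n - \<beta>X) + norm (Y n - \<beta>Y))"
      using L[OF z(1)[of n] z(2)[of n] z'] L[OF z' z(1)[of n] z(2)[of n]]
      by (simp add: norm_minus_commute abs_le_iff)
  qed
  have "(\<lambda>n. L * (norm (X n - \<beta>X) + norm (Y n - \<beta>Y))) \<longlonglongrightarrow> L * (norm (\<beta>X - \<beta>X) + norm (\<beta>Y - \<beta>Y))"
    by (intro tendsto_intros lim)
  then have "(\<lambda>n. L * (norm (X n - \<beta>X) + norm (Y n - \<beta>Y))) \<longlonglongrightarrow> 0" by simp
  from Lim_null_comparison[OF bound this]
  have "(\<lambda>n. theta c S (X n) (Y n) - theta c S \<beta>X \<beta>Y) \<longlonglongrightarrow> 0" .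
  then show ?thesis by (rule LIM_zero_cancel)
qed

text \<open>The bound \<open>M\<close> depends only on \<open>K\<close> and \<open>\<eta>\<close>,
  so a single threshold for \<open>n\<close> will make the perturbed plans nonnegative for all
  bounded deviations. By compactness counterexamples for growing bounds would accumulate; a
  near-minimizer at the limit point, corrected by a small feasible matrix for the remaining
  difference, then stays bounded and near-minimal.\<close>

lemma uniformly_bounded_minimizers:
  assumes \<eta>: "0 < \<eta>"
  obtains M where "\<And>\<beta>X \<beta>Y. \<lbrakk>\<beta>X \<in> zero_sum; \<beta>Y \<in> zero_sum; norm \<beta>X \<le> K; norm \<beta>Y \<le> K\<rbrakk>
    \<Longrightarrow> \<exists>B\<in>feasible \<beta>X \<beta>Y. cost B \<le> theta c S \<beta>X \<beta>Y + \<eta> \<and> (\<forall>z. \<bar>B $ z\<bar> \<le> M)"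
proof (rule ccontr)
  assume "\<not> thesis"
  define bad where "bad M q \<longleftrightarrow> fst q \<in> zero_sum \<and> snd q \<in> zero_sum \<and> norm (fst q) \<le> K \<and> norm (snd q) \<le> K \<and>
      \<not> (\<exists>B\<in>feasible (fst q) (snd q). cost B \<le> theta c S (fst q) (snd q) + \<eta> \<and> (\<forall>z. \<bar>B $ z\<bar> \<le> M))"
    for M q
  have "\<exists>q. bad M q" for M
  proof (rule ccontr)
    assume "\<not> (\<exists>q. bad M q)"
    then have none: "\<not> bad M (\<beta>X, \<beta>Y)" for \<beta>X \<beta>Y by blast
    have "thesis"
    proof (rule that[of M])
      fix \<beta>X :: "real ^ 'a" and \<beta>Y :: "real ^ 'b"
      assume "\<beta>X \<in> zero_sum" "\<beta>Y \<in> zero_sum" "norm \<beta>X \<le> K" "norm \<beta>Y \<le> K"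
      with none[of \<beta>X \<beta>Y]
      show "\<exists>B\<in>feasible \<beta>X \<beta>Y. cost B \<le> theta c S \<beta>X \<beta>Y + \<eta> \<and> (\<forall>z. \<bar>B $ z\<bar> \<le> M)"
        unfolding bad_def fst_conv snd_conv by blast
    qed
    with \<open>\<not> thesis\<close> show False by contradiction
  qed
  then have "\<forall>n. \<exists>q. bad (real n) q" by blast
  from choice[OF this] obtain q where q: "\<And>n. bad (real n) (q n)" by blast
  define X where "X n = fst (q n)" for n
  define Y where "Y n = snd (q n)" for n
  have XY: "X n \<in> zero_sum" "Y n \<in> zero_sum" "norm (X n) \<le> K" "norm (Y n) \<le> K"
    and no: "\<not> (\<exists>B\<in>feasible (X n) (Y n). cost B \<le> theta c S (X n) (Y n) + \<eta> \<and> (\<forall>z. \<bar>B $ z\<bar> \<le> real n))" for n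
    using q[of n] unfolding bad_def X_def Y_def by blast+
  have "seq_compact (cball (0 :: real ^ 'a) K \<times> cball (0 :: real ^ 'b) K)"
    unfolding compact_eq_seq_compact_metric[symmetric] by (intro compact_Times compact_cball)
  moreover have "\<forall>n. (X n, Y n) \<in> cball 0 K \<times> cball 0 K" using XY by simp
  ultimately obtain l r where r: "strict_mono (r :: nat \<Rightarrow> nat)" and l: "((\<lambda>n. (X n, Y n)) \<circ> r) \<longlonglongrightarrow> l"
    by (rule seq_compactE)
  define \<beta>X where "\<beta>X = fst l"
  define \<beta>Y where "\<beta>Y = snd l"
  have lim: "(\<lambda>n. X (r n)) \<longlonglongrightarrow> \<beta>X" "(\<lambda>n. Y (r n)) \<longlonglongrightarrow> \<beta>Y"
    using tendsto_fst[OF l] tendsto_snd[OF l] by (simp_all add: \<beta>X_def \<beta>Y_def comp_def)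
  have z: "\<beta>X \<in> zero_sum" "\<beta>Y \<in> zero_sum"
    using closed_sequentially[OF closed_zero_sum XY(1) lim(1)] closed_sequentially[OF closed_zero_sum XY(2) lim(2)] .
  obtain C where C: "0 \<le> C" "\<And>\<beta>X \<beta>Y. \<beta>X \<in> zero_sum \<Longrightarrow> \<beta>Y \<in> zero_sum \<Longrightarrow>
    \<exists>B\<in>feasible \<beta>X \<beta>Y. \<forall>z. \<bar>B $ z\<bar> \<le> C * (norm \<beta>X + norm \<beta>Y)"
    by (fact ex_small_feasible)
  \<comment> \<open>One half of \<open>\<eta>\<close> is for near-minimality at the limit point; the
    other absorbs the change of \<open>theta\<close> and the cost of the correction
    \<open>D n\<close>.\<close>
  obtain B where B: "B \<in> feasible \<beta>X \<beta>Y" "cost B < theta c S \<beta>X \<beta>Y + \<eta> / 2"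
    using theta_approx[OF z, of "\<eta> / 2"] \<eta> by auto
  obtain D where D: "\<And>n. D n \<in> feasible (X (r n) - \<beta>X) (Y (r n) - \<beta>Y)"
    "\<And>n z. \<bar>D n $ z\<bar> \<le> C * (norm (X (r n) - \<beta>X) + norm (Y (r n) - \<beta>Y))"
  proof -
    have "\<forall>n. \<exists>D. D \<in> feasible (X (r n) - \<beta>X) (Y (r n) - \<beta>Y) \<and>
      (\<forall>z. \<bar>D $ z\<bar> \<le> C * (norm (X (r n) - \<beta>X) + norm (Y (r n) - \<beta>Y)))"
      using C(2)[OF zero_sum_diff[OF XY(1) z(1)] zero_sum_diff[OF XY(2) z(2)]] by blast
    from choice[OF this] show ?thesis using that by blast
  qed
  define s where "s = (\<Sum>(x, y)\<in>UNIV. c x y)"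
  define e where "e n = C * (norm (X (r n) - \<beta>X) + norm (Y (r n) - \<beta>Y))" for n
  have "e \<longlonglongrightarrow> C * (norm (\<beta>X - \<beta>X) + norm (\<beta>Y - \<beta>Y))"
    unfolding e_def by (intro tendsto_intros lim)
  then have e: "e \<longlonglongrightarrow> 0" by simp
  have "(\<lambda>n. theta c S (X (r n)) (Y (r n)) - e n * s) \<longlonglongrightarrow> theta c S \<beta>X \<beta>Y - 0 * s"
    by (intro tendsto_intros theta_tendsto lim XY e)
  then have ev1: "\<forall>\<^sub>F n in sequentially. theta c S \<beta>X \<beta>Y - \<eta> / 2 < theta c S (X (r n)) (Y (r n)) - e n * s"
    using \<eta> by (intro order_tendstoD) auto
  have ev2: "\<forall>\<^sub>F n in sequentially. e n < 1" using e by (rule order_tendstoD) simp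
  have "filterlim (\<lambda>n. real (r n)) at_top sequentially"
    by (rule filterlim_compose[OF filterlim_real_sequentially filterlim_subseq[OF r]])
  then have ev3: "\<forall>\<^sub>F n in sequentially. norm B + 1 \<le> real (r n)"
    unfolding filterlim_at_top by blast
  from ev1 ev2 ev3 have "\<forall>\<^sub>F n in sequentially. False"
  proof eventually_elim
    case (elim n)
    have "B + D n \<in> feasible (X (r n)) (Y (r n))" using feasible_add[OF B(1) D(1)[of n]] by simp
    moreover have "cost (B + D n) \<le> theta c S (X (r n)) (Y (r n)) + \<eta>"
    proof -
      have "cost (D n) \<le> e n * s"
        using cost_abs_le[of "D n" "e n"] D(2)[of n] by (simp add: s_def e_def)
      then show ?thesis unfolding cost_add using B(2) elim by linarith
    qed
    moreover have "\<bar>(B + D n) $ z\<bar> \<le> real (r n)" for z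
      using component_le_norm_cart[of B z] D(2)[of n z] elim unfolding e_def by simp
    ultimately show False using no[of "r n"] by blast
  qed
  then show False by simp
qed

end

section \<open>Matching words with given empirical distributions\<close>

text \<open>Greedy choice: every new set is taken from what the earlier ones left of
  \<open>A\<close>.\<close>

lemma ex_disjoint_subsets:
  assumes "finite J" "finite A" "(\<Sum>j\<in>J. f j) \<le> card A"
  shows "\<exists>I. (\<forall>j\<in>J. I j \<subseteq> A \<and> card (I j) = f j) \<and> disjoint_family_on I J"
  using assms(1,3)
proof (induction J rule: finite_induct)
  case empty
  then show ?case by (simp add: disjoint_family_on_def)
next
  case (insert j J)
  then obtain I where I: "\<forall>j\<in>J. I j \<subseteq> A \<and> card (I j) = f j" "disjoint_family_on I J"
    by auto
  have fin: "\<forall>j\<in>J. finite (I j)" using I(1) assms(2) finite_subset by blast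
  have "card (\<Union>j\<in>J. I j) = (\<Sum>j\<in>J. card (I j))"
    using fin I(2) insert(1) by (intro card_UN_disjoint) (auto simp: disjoint_family_on_def)
  also have "\<dots> = (\<Sum>j\<in>J. f j)" using I(1) by simp
  finally have card: "card (\<Union>j\<in>J. I j) = (\<Sum>j\<in>J. f j)" .
  have sub: "(\<Union>j\<in>J. I j) \<subseteq> A" using I(1) by auto
  have "f j \<le> card (A - (\<Union>j\<in>J. I j))"
    using card_Diff_subset[OF _ sub] finite_subset[OF sub assms(2)] card insert by simp
  then obtain T where T: "T \<subseteq> A - (\<Union>j\<in>J. I j)" "card T = f j"
    using obtain_subset_with_card_n by metis
  let ?I = "I(j := T)"
  have "\<forall>i\<in>insert j J. ?I i \<subseteq> A \<and> card (?I i) = f i"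
    using I(1) T insert(2) by auto
  moreover have "disjoint_family_on ?I (insert j J)"
    unfolding disjoint_family_on_def
  proof (intro ballI impI)
    fix k l assume kl: "k \<in> insert j J" "l \<in> insert j J" "k \<noteq> l"
    show "?I k \<inter> ?I l = {}"
    proof (cases "k = j \<or> l = j")
      case True
      then show ?thesis using kl T(1) by auto
    next
      case False
      then show ?thesis using kl I(2) by (auto simp: disjoint_family_on_def)
    qed
  qed
  ultimately show ?case by blast
qed

text \<open>Disjointness has to be arranged only for a fixed letter \<open>a\<close>; blocks of
  different letters lie in different level sets of \<open>x\<close>.\<close>

lemma ex_labelled_subsets:
  fixes x :: "nat \<Rightarrow> 'a" and N :: "'a \<Rightarrow> 'b::finite \<Rightarrow> nat"
  assumes "\<And>a. (\<Sum>b\<in>UNIV. N a b) \<le> card {i\<in>{..<n}. x i = a}"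
  obtains I where "\<And>a b. I a b \<subseteq> {i\<in>{..<n}. x i = a}" "\<And>a b. card (I a b) = N a b"
    "\<And>i a b a' b'. i \<in> I a b \<Longrightarrow> i \<in> I a' b' \<Longrightarrow> a = a' \<and> b = b'"
proof -
  have "\<exists>I. \<forall>a. (\<forall>b\<in>UNIV. I a b \<subseteq> {i\<in>{..<n}. x i = a} \<and> card (I a b) = N a b)
      \<and> disjoint_family_on (I a) UNIV"
    by (intro choice allI ex_disjoint_subsets assms) auto
  then obtain I where I0: "\<forall>a. (\<forall>b\<in>UNIV. I a b \<subseteq> {i\<in>{..<n}. x i = a} \<and> card (I a b) = N a b)
      \<and> disjoint_family_on (I a) UNIV" by (rule exE)
  have I: "I a b \<subseteq> {i\<in>{..<n}. x i = a}" "card (I a b) = N a b" "disjoint_family_on (I a) UNIV" for a b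
    using I0 by blast+
  have "a = a' \<and> b = b'" if "i \<in> I a b" "i \<in> I a' b'" for i a b a' b'
  proof -
    have "x i = a" "x i = a'" using subsetD[OF I(1) that(1)] subsetD[OF I(1) that(2)] by simp_all
    then have "a = a'" by simp
    with that I(3)[of a] show ?thesis by (auto simp: disjoint_family_on_def)
  qed
  then show ?thesis by (rule that[OF I(1,2)])
qed

lemma ex_permutation_matching:
  fixes x :: "nat \<Rightarrow> 'a::finite" and y :: "nat \<Rightarrow> 'b::finite" and N :: "'a \<times> 'b \<Rightarrow> nat"
  assumes Nx: "\<And>a. (\<Sum>b\<in>UNIV. N (a, b)) \<le> card {i\<in>{..<n}. x i = a}"
    and Ny: "\<And>b. (\<Sum>a\<in>UNIV. N (a, b)) \<le> card {i\<in>{..<n}. y i = b}"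
  obtains \<sigma> where "\<sigma> permutes {..<n}"
    "\<And>z. N z \<le> card {i\<in>{..<n}. (x i, y (\<sigma> i)) = z}"
proof -
  obtain I where I: "\<And>a b. I a b \<subseteq> {i\<in>{..<n}. x i = a}" "\<And>a b. card (I a b) = N (a, b)"
    "\<And>i a b a' b'. i \<in> I a b \<Longrightarrow> i \<in> I a' b' \<Longrightarrow> a = a' \<and> b = b'"
    by (rule ex_labelled_subsets[of "\<lambda>a b. N (a, b)" n x, OF Nx]) blast
  obtain J where J: "\<And>b a. J b a \<subseteq> {i\<in>{..<n}. y i = b}" "\<And>b a. card (J b a) = N (a, b)"
    "\<And>i b a b' a'. i \<in> J b a \<Longrightarrow> i \<in> J b' a' \<Longrightarrow> b = b' \<and> a = a'"
    by (rule ex_labelled_subsets[of "\<lambda>b a. N (a, b)" n y, OF Ny]) blast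
  define A where "A z = I (fst z) (snd z)" for z
  define B where "B z = J (snd z) (fst z)" for z
  have A: "A z \<subseteq> {i\<in>{..<n}. x i = fst z}" "card (A z) = N z" for z
    using I by (auto simp: A_def)
  have B: "B z \<subseteq> {i\<in>{..<n}. y i = snd z}" "card (B z) = N z" for z
    using J by (auto simp: B_def)
  have fin: "finite (A z)" "finite (B z)" for z
    using A(1)[of z] B(1)[of z] by (auto elim: finite_subset)
  have dA: "z = z'" if "i \<in> A z" "i \<in> A z'" for i z z'
    using I(3)[OF that[unfolded A_def]] by (simp add: prod_eq_iff)
  have dB: "z = z'" if "i \<in> B z" "i \<in> B z'" for i z z'
    using J(3)[OF that[unfolded B_def]] by (simp add: prod_eq_iff)
  have "\<forall>z. \<exists>g. bij_betw g (A z) (B z)"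
    using fin A(2) B(2) by (intro allI finite_same_card_bij) auto
  then obtain g where g: "\<And>z. bij_betw (g z) (A z) (B z)" by metis
  define lab where "lab i = (THE z. i \<in> A z)" for i
  have lab: "lab i = z" if "i \<in> A z" for i z
    unfolding lab_def using that dA by (intro the_equality) auto
  define f where "f i = g (lab i) i" for i
  let ?U = "\<Union>z. A z" and ?V = "\<Union>z. B z"
  have f: "bij_betw f ?U ?V"
  proof (rule bij_betw_UNION_disjoint)
    show "disjoint_family_on B UNIV" using dB by (auto simp: disjoint_family_on_def)
    show "bij_betw f (A z) (B z)" for z
      using g[of z] lab by (subst bij_betw_cong[where g="g z"]) (auto simp: f_def)
  qed
  have UV: "?U \<subseteq> {..<n}" "?V \<subseteq> {..<n}" using A(1) B(1) by blast+
  have "card ?U = card ?V" using f by (rule bij_betw_same_card)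
  then have "card ({..<n} - ?U) = card ({..<n} - ?V)"
    using card_Diff_subset[OF finite_subset[OF UV(1) finite_lessThan] UV(1)]
      card_Diff_subset[OF finite_subset[OF UV(2) finite_lessThan] UV(2)] by linarith
  then obtain h where h: "bij_betw h ({..<n} - ?U) ({..<n} - ?V)"
    using finite_same_card_bij[of "{..<n} - ?U" "{..<n} - ?V"] by auto
  define \<sigma> where "\<sigma> i = (if i \<in> ?U then f i else if i < n then h i else i)" for i
  have "bij_betw \<sigma> (?U \<union> ({..<n} - ?U)) (?V \<union> ({..<n} - ?V))"
  proof (rule bij_betw_combine)
    show "bij_betw \<sigma> ?U ?V"
      using f by (subst bij_betw_cong[where g=f]) (auto simp: \<sigma>_def)
    show "bij_betw \<sigma> ({..<n} - ?U) ({..<n} - ?V)"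
      using h by (subst bij_betw_cong[where g=h]) (auto simp: \<sigma>_def)
  qed auto
  also have "?U \<union> ({..<n} - ?U) = {..<n}" using UV by auto
  also have "?V \<union> ({..<n} - ?V) = {..<n}" using UV by auto
  finally have "bij_betw \<sigma> {..<n} {..<n}" .
  moreover have "\<sigma> i = i" if "i \<notin> {..<n}" for i
    using that UV unfolding \<sigma>_def by auto
  ultimately have perm: "\<sigma> permutes {..<n}" by (rule bij_imp_permutes)
  moreover have "N z \<le> card {i\<in>{..<n}. (x i, y (\<sigma> i)) = z}" for z
  proof -
    have "i < n \<and> (x i, y (\<sigma> i)) = z" if "i \<in> A z" for i
    proof -
      have "i \<in> ?U" using that by blast
      then have "\<sigma> i = g z i" using lab[OF that] unfolding \<sigma>_def f_def by (simp only: if_True)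
      moreover have "g z i \<in> B z" using g[of z] that by (auto simp: bij_betw_def)
      ultimately show ?thesis using subsetD[OF A(1) that] subsetD[OF B(1), of "g z i" z] by (cases z) auto
    qed
    then have "A z \<subseteq> {i\<in>{..<n}. (x i, y (\<sigma> i)) = z}" by auto
    then have "card (A z) \<le> card {i\<in>{..<n}. (x i, y (\<sigma> i)) = z}" by (intro card_mono) auto
    then show ?thesis using A(2) by simp
  qed
  ultimately show ?thesis by (rule that)
qed

text \<open>Round the transport plan down and match the leftover letters arbitrarily.\<close>
lemma ex_permutation_cost:
  fixes x :: "nat \<Rightarrow> 'a::finite" and y :: "nat \<Rightarrow> 'b::finite" and w :: "'a \<times> 'b \<Rightarrow> real"
  assumes w: "\<And>z. 0 \<le> w z"
    and wx: "\<And>a. (\<Sum>b\<in>UNIV. w (a, b)) = (\<Sum>i<n. of_bool (x i = a))"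
    and wy: "\<And>b. (\<Sum>a\<in>UNIV. w (a, b)) = (\<Sum>i<n. of_bool (y i = b))"
    and c: "\<And>a b. 0 \<le> c a b" "\<And>a b. c a b \<le> D"
  obtains \<sigma> where "\<sigma> permutes {..<n}"
    "(\<Sum>i<n. c (x i) (y (\<sigma> i))) \<le> (\<Sum>(a, b)\<in>UNIV. w (a, b) * c a b) + real CARD('a \<times> 'b) * D"
proof -
  define N where "N z = nat \<lfloor>w z\<rfloor>" for z
  have N: "real (N z) \<le> w z" "w z \<le> real (N z) + 1" for z
    using w[of z] unfolding N_def by linarith+
  have "real (\<Sum>b\<in>UNIV. N (a, b)) \<le> real (card {i\<in>{..<n}. x i = a})" for a
  proof -
    have "real (\<Sum>b\<in>UNIV. N (a, b)) \<le> (\<Sum>b\<in>UNIV. w (a, b))"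
      using N(1) by (simp add: sum_mono)
    also have "\<dots> = real (card {i\<in>{..<n}. x i = a})"
      unfolding wx by (simp add: of_bool_def sum.If_cases Int_def)
    finally show ?thesis .
  qed
  moreover have "real (\<Sum>a\<in>UNIV. N (a, b)) \<le> real (card {i\<in>{..<n}. y i = b})" for b
  proof -
    have "real (\<Sum>a\<in>UNIV. N (a, b)) \<le> (\<Sum>a\<in>UNIV. w (a, b))"
      using N(1) by (simp add: sum_mono)
    also have "\<dots> = real (card {i\<in>{..<n}. y i = b})"
      unfolding wy by (simp add: of_bool_def sum.If_cases Int_def)
    finally show ?thesis .
  qed
  ultimately obtain \<sigma> where \<sigma>: "\<sigma> permutes {..<n}"
    and ge: "\<And>z. N z \<le> card {i\<in>{..<n}. (x i, y (\<sigma> i)) = z}"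
    unfolding of_nat_le_iff by (rule ex_permutation_matching) blast
  define m where "m z = real (card {i\<in>{..<n}. (x i, y (\<sigma> i)) = z})" for z
  have m_eq: "m z = (\<Sum>i<n. of_bool ((x i, y (\<sigma> i)) = z))" for z
    unfolding m_def by (simp add: of_bool_def sum.If_cases Int_def)
  have swap: "(\<Sum>z\<in>UNIV. m z * h z) = (\<Sum>i<n. h (x i, y (\<sigma> i)))" for h
    unfolding m_eq sum_distrib_right
    by (subst sum.swap) (simp add: of_bool_def if_distrib[of "\<lambda>u. u * _"] cong: if_cong)
  have "(\<Sum>z\<in>UNIV. w z) = (\<Sum>a\<in>UNIV. \<Sum>b\<in>UNIV. w (a, b))"
    by (simp add: sum.cartesian_product)
  also have "\<dots> = (\<Sum>i<n. \<Sum>a\<in>UNIV. of_bool (x i = a))"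
    unfolding wx by (rule sum.swap)
  also have "\<dots> = n" by (simp add: of_bool_def)
  finally have wn: "(\<Sum>z\<in>UNIV. w z) = n" .
  have mn: "(\<Sum>z\<in>UNIV. m z) = n" using swap[of "\<lambda>_. 1"] by simp
  define k where "k z = c (fst z) (snd z)" for z
  have k: "0 \<le> k z" "k z \<le> D" for z using c by (auto simp: k_def)
  have "(\<Sum>i<n. c (x i) (y (\<sigma> i))) = (\<Sum>z\<in>UNIV. m z * k z)"
    unfolding swap by (simp add: k_def)
  \<comment> \<open>\<open>m z\<close> falls below \<open>w z\<close> by at most 1, so
    \<open>m z - w z + 1\<close> is nonnegative and its cost may be raised to \<open>D\<close>. As
    \<open>m\<close> and \<open>w\<close> both have total \<open>n\<close>, these terms add up to
    the number of letter pairs.\<close>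
  also have "\<dots> \<le> (\<Sum>z\<in>UNIV. w z * k z + (m z - w z + 1) * D)"
  proof (rule sum_mono)
    fix z
    have "m z - w z + 1 \<ge> 0" using ge[of z] N[of z] by (simp add: m_def)
    then have "(m z - w z + 1) * k z \<le> (m z - w z + 1) * D" using k by (intro mult_left_mono)
    then show "m z * k z \<le> w z * k z + (m z - w z + 1) * D"
      using k[of z] by (simp add: algebra_simps)
  qed
  also have "\<dots> = (\<Sum>z\<in>UNIV. w z * k z) + (\<Sum>z\<in>UNIV. m z - w z + 1) * D"
    unfolding sum.distrib[of "\<lambda>z. w z * k z"] sum_distrib_right ..
  also have "(\<Sum>z\<in>UNIV. m z - w z + 1) = real CARD('a \<times> 'b)"
    by (simp add: sum.distrib sum_subtractf wn mn)
  also have "(\<Sum>z\<in>UNIV. w z * k z) = (\<Sum>(a, b)\<in>UNIV. w (a, b) * c a b)"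
    by (simp add: k_def case_prod_unfold)
  finally show ?thesis using \<sigma> that by blast
qed

context finite_ot
begin

lemma theta_le_excess:
  assumes n: "0 < n"
  shows "theta c S (fluct PX n x) (fluct PY n y) \<le> sqrt n * (avg_cost c n x y - cost p)"
proof -
  define B where "B = (\<chi> z. (\<Sum>i<n. of_bool ((x i, y i) = z) - p $ z) / sqrt n)"
  have "B \<in> feasible (fluct PX n x) (fluct PY n y)"
  proof (rule feasibleI)
    have "(\<Sum>b\<in>UNIV. of_bool ((x i, y i) = (a, b)) - p $ (a, b)) = of_bool (x i = a) - pmf PX a" for i a
      unfolding sum_subtractf p_fst by (cases "x i = a") (simp_all add: of_bool_def)
    then show "(\<Sum>b\<in>UNIV. B $ (a, b)) = fluct PX n x $ a" for a
      unfolding B_def fluct_def by (simp add: sum.swap[of _ "{..<n}"] flip: sum_divide_distrib)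
    have "(\<Sum>a\<in>UNIV. of_bool ((x i, y i) = (a, b)) - p $ (a, b)) = of_bool (y i = b) - pmf PY b" for i b
      unfolding sum_subtractf p_snd by (cases "y i = b") (simp_all add: of_bool_def)
    then show "(\<Sum>a\<in>UNIV. B $ (a, b)) = fluct PY n y $ b" for b
      unfolding B_def fluct_def by (simp add: sum.swap[of _ "{..<n}"] flip: sum_divide_distrib)
    fix z assume neg: "B $ z < 0"
    show "z \<in> S"
    proof (rule ccontr)
      assume "z \<notin> S"
      then have "p $ z = 0" using p_nonneg[of z] by (simp add: S_def)
      then have "0 \<le> B $ z" by (simp add: B_def sum_nonneg)
      with neg show False by simp
    qed
  qed
  then have "theta c S (fluct PX n x) (fluct PY n y) \<le> cost B"
    using theta_le_cost[OF fluct_in_zero_sum fluct_in_zero_sum] by blast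
  also have "cost B = (\<Sum>z\<in>UNIV. (\<Sum>i<n. (of_bool ((x i, y i) = z) - p $ z) * c (fst z) (snd z)) / sqrt n)"
    unfolding cost_def B_def by (intro sum.cong refl) (simp add: case_prod_unfold prod_eq_iff sum_distrib_right)
  also have "\<dots> = (\<Sum>i<n. \<Sum>z\<in>UNIV. (of_bool ((x i, y i) = z) - p $ z) * c (fst z) (snd z)) / sqrt n"
    by (subst sum.swap) (simp add: sum_divide_distrib)
  also have "(\<Sum>z\<in>UNIV. (of_bool ((x i, y i) = z) - p $ z) * c (fst z) (snd z)) = c (x i) (y i) - cost p" for i
    by (simp add: left_diff_distrib sum_subtractf cost_def case_prod_unfold of_bool_def if_distrib[of "\<lambda>u. u * _"] cong: if_cong)
  then have "(\<Sum>i<n. \<Sum>z\<in>UNIV. (of_bool ((x i, y i) = z) - p $ z) * c (fst z) (snd z)) / sqrt n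
      = ((\<Sum>i<n. c (x i) (y i)) - n * cost p) / sqrt n"
    by (simp add: sum_subtractf)
  also have "\<dots> = sqrt n * (avg_cost c n x y - cost p)"
  proof -
    have "(\<Sum>i<n. c (x i) (y i)) - n * cost p = n * (avg_cost c n x y - cost p)"
      using n by (simp add: avg_cost_def right_diff_distrib)
    then show ?thesis by (simp add: real_div_sqrt flip: times_divide_eq_left)
  qed
  finally show ?thesis .
qed

text \<open>\<open>w\<close> is a transport plan between the letter counts of the two words: the
  bound on \<open>B\<close> keeps it nonnegative, and its marginals are the counts because those of
  \<open>B\<close> are the deviations. Its cost is
  \<open>n * cost p + sqrt n * cost B\<close>.\<close>

lemma ex_permutation_excess:
  assumes n: "0 < n" and D: "\<And>a b. c a b \<le> D"
    and \<delta>: "\<And>z. z \<in> S \<Longrightarrow> \<delta> \<le> p $ z"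
    and B: "B \<in> feasible (fluct PX n x) (fluct PY n y)" "\<And>z. \<bar>B $ z\<bar> \<le> \<delta> * sqrt n"
  obtains \<sigma> where "\<sigma> permutes {..<n}"
    "sqrt n * (avg_cost c n x (y \<circ> \<sigma>) - cost p) \<le> cost B + real CARD('a \<times> 'b) * D / sqrt n"
proof -
  define w where "w z = n * (p + (1 / sqrt n) *\<^sub>R B) $ z" for z
  have sq: "sqrt n * sqrt n = n" "0 < sqrt n" using n by simp_all
  have w_eq: "w z = n * p $ z + sqrt n * B $ z" for z
    using n by (simp add: w_def distrib_left real_div_sqrt flip: times_divide_eq_left)
  have w0: "0 \<le> w z" for z
  proof -
    have "1 / sqrt n * \<bar>B $ z\<bar> \<le> \<delta>" for z using B(2)[of z] n by (simp add: field_simps)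
    then have "0 \<le> (p + (1 / sqrt n) *\<^sub>R B) $ z" by (intro perturbation_nonneg[OF \<delta> B(1)]) auto
    then show ?thesis unfolding w_def by (intro mult_nonneg_nonneg) simp_all
  qed
  have wx: "(\<Sum>b\<in>UNIV. w (a, b)) = (\<Sum>i<n. of_bool (x i = a))" for a
    unfolding w_eq using n
    by (simp add: sum.distrib p_fst feasibleD(1)[OF B(1)] fluct_def sum_subtractf flip: sum_distrib_left)
  have wy: "(\<Sum>a\<in>UNIV. w (a, b)) = (\<Sum>i<n. of_bool (y i = b))" for b
    unfolding w_eq using n
    by (simp add: sum.distrib p_snd feasibleD(2)[OF B(1)] fluct_def sum_subtractf flip: sum_distrib_left)
  obtain \<sigma> where \<sigma>: "\<sigma> permutes {..<n}"
    and le: "(\<Sum>i<n. c (x i) (y (\<sigma> i))) \<le> (\<Sum>(a, b)\<in>UNIV. w (a, b) * c a b) + real CARD('a \<times> 'b) * D"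
    by (rule ex_permutation_cost[OF w0 wx wy cost_nonneg D])
  have "(\<Sum>(a, b)\<in>UNIV. w (a, b) * c a b) = n * cost p + sqrt n * cost B"
    unfolding w_eq cost_def case_prod_unfold by (simp add: distrib_right sum.distrib sum_distrib_left mult.assoc)
  with le have "n * avg_cost c n x (y \<circ> \<sigma>) - n * cost p \<le> sqrt n * cost B + real CARD('a \<times> 'b) * D"
    using n by (simp add: avg_cost_def)
  then have "(n * avg_cost c n x (y \<circ> \<sigma>) - n * cost p) / sqrt n \<le> (sqrt n * cost B + real CARD('a \<times> 'b) * D) / sqrt n"
    by (rule divide_right_mono) simp
  moreover have "(n * avg_cost c n x (y \<circ> \<sigma>) - n * cost p) / sqrt n = sqrt n * (avg_cost c n x (y \<circ> \<sigma>) - cost p)"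
    using n by (simp add: right_diff_distrib diff_divide_distrib real_div_sqrt flip: times_divide_eq_left)
  ultimately show ?thesis using that[OF \<sigma>] n by (simp add: add_divide_distrib)
qed

end

section \<open>Couplings of words\<close>

lemma space_iid: "space (iid n P) = (\<Pi>\<^sub>E i\<in>{..<n}. UNIV)"
  by (simp add: iid_def space_PiM)

lemma restrict_measurable_iid: "(\<lambda>x. restrict x {..<n}) \<in> measure_pmf M \<rightarrow>\<^sub>M iid n P"
  by (simp add: measurable_pmf_measure1 space_iid)

text \<open>Checked on boxes, which determine a finite product measure. The restriction lands in the
  extensional functions, the space on which \<open>iid\<close> lives.\<close>

lemma iid_eq_distr: "distr (measure_pmf (iid_pmf n P)) (iid n P) (\<lambda>x. restrict x {..<n}) = iid n P"
proof -
  have psf: "product_sigma_finite (\<lambda>_ :: nat. measure_pmf P)"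
    unfolding product_sigma_finite_def by (intro allI prob_space_imp_sigma_finite prob_space_measure_pmf)
  have "distr (measure_pmf (iid_pmf n P)) (iid n P) (\<lambda>x. restrict x {..<n}) = (\<Pi>\<^sub>M i\<in>{..<n}. measure_pmf P)"
  proof (rule product_sigma_finite.PiM_eqI[OF psf])
    fix A :: "nat \<Rightarrow> 'a set"
    have sets: "Pi\<^sub>E {..<n} A \<in> sets (iid n P)"
      unfolding iid_def by (intro sets_PiM_I_finite) auto
    have pre: "(\<lambda>x. restrict x {..<n}) -` Pi\<^sub>E {..<n} A = Pi {..<n} A"
      unfolding vimage_def restrict_PiE_iff Pi_def Ball_def ..
    have "emeasure (distr (measure_pmf (iid_pmf n P)) (iid n P) (\<lambda>x. restrict x {..<n})) (Pi\<^sub>E {..<n} A)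
        = emeasure (measure_pmf (iid_pmf n P)) (Pi {..<n} A)"
      by (subst emeasure_distr[OF restrict_measurable_iid sets]) (simp only: pre space_measure_pmf Int_UNIV_right)
    also have "\<dots> = ennreal (\<Prod>i<n. measure_pmf.prob P (A i))"
      unfolding iid_pmf_def by (simp only: measure_pmf.emeasure_eq_measure measure_Pi_pmf_Pi finite_lessThan)
    also have "\<dots> = (\<Prod>i<n. emeasure (measure_pmf P) (A i))"
      unfolding measure_pmf.emeasure_eq_measure by (rule prod_ennreal[symmetric]) (rule measure_nonneg)
    finally show "emeasure (distr (measure_pmf (iid_pmf n P)) (iid n P) (\<lambda>x. restrict x {..<n})) (Pi\<^sub>E {..<n} A)
        = (\<Prod>i<n. emeasure (measure_pmf P) (A i))" .
  next
    show "sets (distr (measure_pmf (iid_pmf n P)) (iid n P) (\<lambda>x. restrict x {..<n})) = sets (\<Pi>\<^sub>M i\<in>{..<n}. measure_pmf P)"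
      unfolding sets_distr iid_def ..
  qed (rule finite_lessThan)
  then show ?thesis unfolding iid_def .
qed

text \<open>Finite alphabets make every set of words measurable, so events defined through
  \<open>avg_cost\<close> raise no measurability question.\<close>

lemma sets_iid:
  fixes P :: "'a::finite pmf"
  shows "sets (iid n P) = Pow (\<Pi>\<^sub>E i\<in>{..<n}. UNIV)"
proof -
  have "sets (iid n P) = sets (\<Pi>\<^sub>M i\<in>{..<n}. count_space (UNIV :: 'a set))"
    unfolding iid_def by (intro sets_PiM_cong) auto
  also have "\<dots> = Pow (\<Pi>\<^sub>E i\<in>{..<n}. UNIV)"
    by (subst count_space_PiM_finite) auto
  finally show ?thesis .
qed

lemma sets_iid_pair:
  fixes P :: "'a::finite pmf" and Q :: "'b::finite pmf"
  shows "sets (iid n P \<Otimes>\<^sub>M iid n Q) = Pow ((\<Pi>\<^sub>E i\<in>{..<n}. UNIV) \<times> (\<Pi>\<^sub>E i\<in>{..<n}. UNIV))"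
proof -
  have "finite (\<Pi>\<^sub>E i\<in>{..<n}. UNIV :: 'a set)" "finite (\<Pi>\<^sub>E i\<in>{..<n}. UNIV :: 'b set)"
    by (intro finite_PiE; simp)+
  then have "sets (count_space (\<Pi>\<^sub>E i\<in>{..<n}. UNIV :: 'a set) \<Otimes>\<^sub>M count_space (\<Pi>\<^sub>E i\<in>{..<n}. UNIV :: 'b set))
      = Pow ((\<Pi>\<^sub>E i\<in>{..<n}. UNIV) \<times> (\<Pi>\<^sub>E i\<in>{..<n}. UNIV))"
    by (subst pair_measure_countable) (auto intro: countable_finite)
  moreover have "sets (iid n P \<Otimes>\<^sub>M iid n Q)
      = sets (count_space (\<Pi>\<^sub>E i\<in>{..<n}. UNIV :: 'a set) \<Otimes>\<^sub>M count_space (\<Pi>\<^sub>E i\<in>{..<n}. UNIV :: 'b set))"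
    by (rule sets_pair_measure_cong) (simp_all add: sets_iid)
  ultimately show ?thesis by simp
qed

lemma fluct_restrict: "fluct P n (restrict x {..<n}) = fluct P n x"
proof -
  have "(\<Sum>i<n. of_bool (restrict x {..<n} i = a) - pmf P a) = (\<Sum>i<n. of_bool (x i = a) - pmf P a)" for a
    by (rule sum.cong) simp_all
  then show ?thesis unfolding fluct_def by simp
qed

lemma fluct_measurable_iid: "fluct P n \<in> iid n P \<rightarrow>\<^sub>M borel"
  by (rule measurableI) (auto simp: sets_iid space_iid)

lemma distr_iid_fluct:
  fixes P :: "'a::finite pmf"
  shows "distr (iid n P) borel (fluct P n) = fluct_law P n"
proof -
  have "distr (iid n P) borel (fluct P n)
      = distr (distr (measure_pmf (iid_pmf n P)) (iid n P) (\<lambda>x. restrict x {..<n})) borel (fluct P n)"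
    by (simp add: iid_eq_distr)
  also have "\<dots> = fluct_law P n"
    by (subst distr_distr[OF fluct_measurable_iid restrict_measurable_iid]) (simp add: comp_def fluct_restrict fluct_law_def)
  finally show ?thesis .
qed

text \<open>Restricting both words turns a pmf of word pairs into an admissible coupling of product
  measures; \<open>avg_cost\<close> reads only the first \<open>n\<close> letters and is
  unchanged.\<close>

lemma excess_prob_le_pmf:
  fixes P :: "'a::finite pmf" and Q :: "'b::finite pmf"
  assumes fst: "map_pmf fst W = iid_pmf n P" and snd: "map_pmf snd W = iid_pmf n Q"
  shows "excess_prob c P Q n \<alpha> \<le> measure_pmf.prob W {(x, y). avg_cost c n x y > \<alpha>}"
proof -
  let ?r = "\<lambda>z. (restrict (fst z) {..<n}, restrict (snd z) {..<n})"
  define R where "R = distr (measure_pmf W) (iid n P \<Otimes>\<^sub>M iid n Q) ?r"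
  have m: "?r \<in> measure_pmf W \<rightarrow>\<^sub>M iid n P \<Otimes>\<^sub>M iid n Q"
    unfolding measurable_pmf_measure1 space_pair_measure space_iid by auto
  have "R \<in> couplings (iid n P) (iid n Q)"
    unfolding couplings_def
  proof (intro CollectI conjI)
    show "prob_space R" unfolding R_def using m by (intro prob_space.prob_space_distr prob_space_measure_pmf)
    show "sets R = sets (iid n P \<Otimes>\<^sub>M iid n Q)" by (simp add: R_def)
    have "distr R (iid n P) fst = distr (measure_pmf W) (iid n P) (\<lambda>z. restrict (fst z) {..<n})"
      unfolding R_def by (subst distr_distr[OF measurable_fst m]) (simp add: comp_def)
    also have "\<dots> = distr (measure_pmf (map_pmf fst W)) (iid n P) (\<lambda>x. restrict x {..<n})"
      unfolding map_pmf_rep_eq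
      by (subst distr_distr) (auto simp: comp_def measurable_count_space_eq1 space_iid)
    finally show "distr R (iid n P) fst = iid n P" by (simp add: fst iid_eq_distr)
    have "distr R (iid n Q) snd = distr (measure_pmf W) (iid n Q) (\<lambda>z. restrict (snd z) {..<n})"
      unfolding R_def by (subst distr_distr[OF measurable_snd m]) (simp add: comp_def)
    also have "\<dots> = distr (measure_pmf (map_pmf snd W)) (iid n Q) (\<lambda>x. restrict x {..<n})"
      unfolding map_pmf_rep_eq
      by (subst distr_distr) (auto simp: comp_def measurable_count_space_eq1 space_iid)
    finally show "distr R (iid n Q) snd = iid n Q" by (simp add: snd iid_eq_distr)
  qed
  then have "excess_prob c P Q n \<alpha> \<le> measure R {z \<in> space R. avg_cost c n (fst z) (snd z) > \<alpha>}"
    unfolding excess_prob_def by (intro cINF_lower bdd_belowI2[where m=0]) auto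
  also have "\<dots> = measure_pmf.prob W (?r -` {z \<in> space R. avg_cost c n (fst z) (snd z) > \<alpha>})"
  proof -
    have "{z \<in> space R. avg_cost c n (fst z) (snd z) > \<alpha>} \<in> sets (iid n P \<Otimes>\<^sub>M iid n Q)"
      unfolding sets_iid_pair by (auto simp: R_def space_pair_measure space_iid)
    from measure_distr[OF m this] show ?thesis by (simp add: R_def)
  qed
  also have "?r -` {z \<in> space R. avg_cost c n (fst z) (snd z) > \<alpha>} = {(x, y). avg_cost c n x y > \<alpha>}"
  proof -
    have "avg_cost c n (restrict x {..<n}) (restrict y {..<n}) = avg_cost c n x y" for x y
      unfolding avg_cost_def by (intro arg_cong2[where f="(/)"] sum.cong) simp_all
    then show ?thesis by (auto simp: R_def space_pair_measure space_iid)
  qed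
  finally show ?thesis .
qed

section \<open>Permutations of words\<close>

lemma iid_pmf_permute:
  assumes "\<tau> permutes {..<n}"
  shows "map_pmf (\<lambda>x. x \<circ> \<tau>) (iid_pmf n P) = iid_pmf n P"
  unfolding iid_pmf_def
proof (rule Pi_pmf_bij_betw[symmetric])
  show "bij_betw \<tau> {..<n} {..<n}" by (rule permutes_imp_bij[OF assms])
  show "\<tau> i \<notin> {..<n}" if "i \<notin> {..<n}" for i
    using that by (simp only: permutes_in_image[OF assms] not_False_eq_True)
qed simp

lemma avg_cost_permute:
  assumes "\<tau> permutes {..<n}"
  shows "avg_cost c n (x \<circ> \<tau>) (y \<circ> \<tau>) = avg_cost c n x y"
  unfolding avg_cost_def sum.permute[OF assms, of "\<lambda>i. c (x i) (y i)"] comp_def ..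

text \<open>Left multiplication is a bijection of the symmetric group, so it preserves the uniform
  distribution.\<close>

lemma map_pmf_perms_compose:
  assumes "\<sigma> permutes A" "finite A"
  shows "map_pmf (\<lambda>\<tau>. \<sigma> \<circ> \<tau>) (pmf_of_set {\<tau>. \<tau> permutes A}) = pmf_of_set {\<tau>. \<tau> permutes A}"
proof (rule map_pmf_of_set_bij_betw)
  show "bij_betw (\<lambda>\<tau>. \<sigma> \<circ> \<tau>) {\<tau>. \<tau> permutes A} {\<tau>. \<tau> permutes A}"
    by (rule bij_betwI[where g="\<lambda>\<tau>. inv \<sigma> \<circ> \<tau>"])
      (use assms in \<open>auto simp: permutes_compose permutes_inv permutes_inv_o simp flip: o_assoc\<close>,
       auto simp: o_assoc permutes_inv_o)
  show "{\<tau>. \<tau> permutes A} \<noteq> {}" using permutes_id by blast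
  show "finite {\<tau>. \<tau> permutes A}" using assms by (intro finite_permutations)
qed

text \<open>Rearranging \<open>y\<close> by a permutation depending on \<open>(x, y)\<close> and then both words by an independent
  uniform permutation keeps the marginals, because the latter absorbs the former.\<close>
lemma excess_prob_le_rearranged:
  fixes P :: "'a::finite pmf" and Q :: "'b::finite pmf"
  assumes fst: "map_pmf fst W = iid_pmf n P" and snd: "map_pmf snd W = iid_pmf n Q"
    and \<sigma>: "\<And>x y. \<sigma> x y permutes {..<n}"
  shows "excess_prob c P Q n \<alpha> \<le> measure_pmf.prob W {(x, y). avg_cost c n x (y \<circ> \<sigma> x y) > \<alpha>}"
proof -
  define T where "T = pmf_of_set {\<tau>. \<tau> permutes {..<n}}"
  have fin: "finite {\<tau>. \<tau> permutes {..<n}}" "{\<tau>. \<tau> permutes {..<n}} \<noteq> {}"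
    using finite_permutations[of "{..<n}"] permutes_id[of "{..<n}"] by blast+
  have setT: "\<tau> \<in> set_pmf T \<Longrightarrow> \<tau> permutes {..<n}" for \<tau>
    using fin by (simp add: T_def)
  define W' where "W' = bind_pmf W (\<lambda>(x, y). map_pmf (\<lambda>\<tau>. (x \<circ> \<tau>, y \<circ> \<sigma> x y \<circ> \<tau>)) T)"
  have mix: "bind_pmf (iid_pmf n M) (\<lambda>x. map_pmf (\<lambda>\<tau>. x \<circ> \<tau>) T) = iid_pmf n M" for M :: "'c pmf"
  proof -
    have "bind_pmf (iid_pmf n M) (\<lambda>x. map_pmf (\<lambda>\<tau>. x \<circ> \<tau>) T)
        = bind_pmf T (\<lambda>\<tau>. map_pmf (\<lambda>x. x \<circ> \<tau>) (iid_pmf n M))"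
      unfolding map_pmf_def by (rule bind_commute_pmf)
    also have "\<dots> = bind_pmf T (\<lambda>\<tau>. iid_pmf n M)"
      using setT by (intro bind_pmf_cong refl iid_pmf_permute)
    finally show ?thesis by simp
  qed
  have "map_pmf fst W' = bind_pmf W (\<lambda>z. map_pmf (\<lambda>\<tau>. fst z \<circ> \<tau>) T)"
    unfolding W'_def by (simp add: map_bind_pmf case_prod_unfold map_pmf_comp)
  also have "\<dots> = bind_pmf (map_pmf fst W) (\<lambda>x. map_pmf (\<lambda>\<tau>. x \<circ> \<tau>) T)"
    by (simp add: bind_map_pmf)
  finally have f: "map_pmf fst W' = iid_pmf n P" by (simp add: fst mix)
  have absorb: "map_pmf (\<lambda>\<tau>. y \<circ> \<sigma> x y \<circ> \<tau>) T = map_pmf (\<lambda>\<tau>. y \<circ> \<tau>) T" for x y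
  proof -
    have "map_pmf (\<lambda>\<tau>. y \<circ> \<sigma> x y \<circ> \<tau>) T = map_pmf (\<lambda>\<tau>. y \<circ> \<tau>) (map_pmf (\<lambda>\<tau>. \<sigma> x y \<circ> \<tau>) T)"
      by (simp add: map_pmf_comp o_assoc)
    then show ?thesis unfolding T_def using map_pmf_perms_compose[OF \<sigma>] by simp
  qed
  have "map_pmf snd W' = bind_pmf W (\<lambda>z. map_pmf (\<lambda>\<tau>. snd z \<circ> \<sigma> (fst z) (snd z) \<circ> \<tau>) T)"
    unfolding W'_def by (simp add: map_bind_pmf case_prod_unfold map_pmf_comp)
  also have "\<dots> = bind_pmf (map_pmf snd W) (\<lambda>y. map_pmf (\<lambda>\<tau>. y \<circ> \<tau>) T)"
    by (simp add: bind_map_pmf absorb)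
  finally have s: "map_pmf snd W' = iid_pmf n Q" by (simp add: snd mix)
  let ?E = "{(x, y). avg_cost c n x y > \<alpha>}" and ?E' = "{(x, y). avg_cost c n x (y \<circ> \<sigma> x y) > \<alpha>}"
  \<comment> \<open>The uniform permutation acts on both words together and leaves the average cost
    unchanged, so the event depends on the original pair alone.\<close>
  have "map_pmf (\<lambda>z. z \<in> ?E) W' = bind_pmf W (\<lambda>z. map_pmf (\<lambda>\<tau>. z \<in> ?E') T)"
    unfolding W'_def map_bind_pmf
  proof (intro bind_pmf_cong refl)
    fix z
    have "map_pmf (\<lambda>z. z \<in> ?E) (case z of (x, y) \<Rightarrow> map_pmf (\<lambda>\<tau>. (x \<circ> \<tau>, y \<circ> \<sigma> x y \<circ> \<tau>)) T)
        = map_pmf (\<lambda>\<tau>. avg_cost c n (fst z \<circ> \<tau>) (snd z \<circ> \<sigma> (fst z) (snd z) \<circ> \<tau>) > \<alpha>) T"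
      by (simp add: case_prod_unfold map_pmf_comp)
    also have "\<dots> = map_pmf (\<lambda>\<tau>. z \<in> ?E') T"
    proof (rule map_pmf_cong[OF refl])
      fix \<tau> assume "\<tau> \<in> set_pmf T"
      then show "(avg_cost c n (fst z \<circ> \<tau>) (snd z \<circ> \<sigma> (fst z) (snd z) \<circ> \<tau>) > \<alpha>) = (z \<in> ?E')"
        by (simp only: avg_cost_permute[OF setT] case_prod_unfold mem_Collect_eq)
    qed
    finally show "map_pmf (\<lambda>z. z \<in> ?E) (case z of (x, y) \<Rightarrow> map_pmf (\<lambda>\<tau>. (x \<circ> \<tau>, y \<circ> \<sigma> x y \<circ> \<tau>)) T)
        = map_pmf (\<lambda>\<tau>. z \<in> ?E') T" .
  qed
  also have "\<dots> = map_pmf (\<lambda>z. z \<in> ?E') W"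
    by (simp add: map_pmf_const) (simp add: map_pmf_def)
  finally have eq: "map_pmf (\<lambda>z. z \<in> ?E) W' = map_pmf (\<lambda>z. z \<in> ?E') W" .
  have "measure_pmf.prob W' ?E = measure_pmf.prob (map_pmf (\<lambda>z. z \<in> ?E) W') {True}"
    by (simp add: vimage_def)
  also have "\<dots> = measure_pmf.prob W ?E'"
    unfolding eq by (simp add: vimage_def)
  finally show ?thesis by (rule ord_le_eq_trans[OF excess_prob_le_pmf[OF f s]])
qed

section \<open>Gluing and perturbing couplings\<close>

lemma bind_cond_pmf_map: "bind_pmf (map_pmf \<kappa> M) (\<lambda>i. cond_pmf M (\<kappa> -` {i})) = M"
proof -
  have "bind_pmf (map_pmf \<kappa> M) (\<lambda>i. cond_pmf M {y. \<kappa> y = i}) = M"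
  proof (rule bind_cond_pmf_cancel)
    fix i y assume "\<kappa> y = i"
    then show "measure_pmf.prob M {y. \<kappa> y = i} = measure_pmf.prob (map_pmf \<kappa> M) {j. \<kappa> y = j}"
      by (simp add: vimage_def)
  qed auto
  then show ?thesis by (simp add: vimage_def)
qed

text \<open>The labels are drawn from \<open>A\<close>, then the two components independently from
  their conditional laws given the labels. Mixing the conditional laws over the labels restores
  \<open>M\<close> and \<open>N\<close>.\<close>

lemma glue_coupling:
  assumes fst: "map_pmf fst A = map_pmf \<kappa> M" and snd: "map_pmf snd A = map_pmf \<kappa>' N"
  obtains W where "map_pmf fst W = M" "map_pmf snd W = N" "map_pmf (map_prod \<kappa> \<kappa>') W = A"
proof
  define W where "W = bind_pmf A (\<lambda>z. pair_pmf (cond_pmf M (\<kappa> -` {fst z})) (cond_pmf N (\<kappa>' -` {snd z})))"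
  have "map_pmf fst W = bind_pmf (map_pmf fst A) (\<lambda>i. cond_pmf M (\<kappa> -` {i}))"
    unfolding W_def by (simp add: map_bind_pmf bind_map_pmf map_fst_pair_pmf)
  then show "map_pmf fst W = M" by (simp add: fst bind_cond_pmf_map)
  have "map_pmf snd W = bind_pmf (map_pmf snd A) (\<lambda>i. cond_pmf N (\<kappa>' -` {i}))"
    unfolding W_def by (simp add: map_bind_pmf bind_map_pmf map_snd_pair_pmf)
  then show "map_pmf snd W = N" by (simp add: snd bind_cond_pmf_map)
  have "map_pmf (map_prod \<kappa> \<kappa>') W = bind_pmf A return_pmf"
    unfolding W_def map_bind_pmf
  proof (intro bind_pmf_cong refl)
    fix z assume z: "z \<in> set_pmf A"
    have "fst z \<in> set_pmf (map_pmf fst A)" "snd z \<in> set_pmf (map_pmf snd A)" using z by auto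
    then have ne: "set_pmf M \<inter> \<kappa> -` {fst z} \<noteq> {}" "set_pmf N \<inter> \<kappa>' -` {snd z} \<noteq> {}"
      unfolding fst snd by auto
    have "map_pmf (map_prod \<kappa> \<kappa>') (pair_pmf (cond_pmf M (\<kappa> -` {fst z})) (cond_pmf N (\<kappa>' -` {snd z})))
        = map_pmf (\<lambda>_. z) (pair_pmf (cond_pmf M (\<kappa> -` {fst z})) (cond_pmf N (\<kappa>' -` {snd z})))"
      using ne by (intro map_pmf_cong refl) (auto simp: set_cond_pmf)
    then show "map_pmf (map_prod \<kappa> \<kappa>') (pair_pmf (cond_pmf M (\<kappa> -` {fst z})) (cond_pmf N (\<kappa>' -` {snd z})))
        = return_pmf z" by (simp add: map_pmf_const)
  qed
  then show "map_pmf (map_prod \<kappa> \<kappa>') W = A" by (simp add: bind_return_pmf')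
qed

lemma pmf_mixture_residual:
  fixes p q :: "'i pmf"
  assumes e: "0 < e" and le: "\<And>i. (1 - e) * pmf p i \<le> pmf q i"
  obtains r where "\<And>i. pmf q i = (1 - e) * pmf p i + e * pmf r i"
proof -
  define f where "f i = (pmf q i - (1 - e) * pmf p i) / e" for i
  have f0: "0 \<le> f i" for i using e le[of i] by (simp add: f_def)
  have int: "integrable (count_space UNIV) f"
    unfolding f_def by (intro integrable_divide Bochner_Integration.integrable_diff integrable_mult_right integrable_pmf)
  have "(\<integral>i. f i \<partial>count_space UNIV) = ((\<integral>i. pmf q i \<partial>count_space UNIV) - (1 - e) * (\<integral>i. pmf p i \<partial>count_space UNIV)) / e"
    unfolding f_def by (simp add: integrable_pmf)
  also have "\<dots> = 1" using e by (simp add: integral_pmf)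
  finally have one: "(\<integral>\<^sup>+i. ennreal (f i) \<partial>count_space UNIV) = 1"
    using nn_integral_eq_integral[OF int] f0 by simp
  have "pmf (embed_pmf f) i = f i" for i by (rule pmf_embed_pmf[OF f0 one])
  then show ?thesis using e by (intro that[of "embed_pmf f"]) (simp add: f_def)
qed

text \<open>With probability \<open>1 - e\<close> a draw from \<open>A\<close>, otherwise
  independent draws from the two residual laws; only the second case can add to the probability of
  an event. The multiplicative hypotheses make the residuals nonnegative with total mass exactly
  \<open>e\<close>.\<close>

lemma perturb_coupling:
  assumes e: "0 < e" "e \<le> 1"
    and p: "\<And>i. (1 - e) * pmf (map_pmf fst A) i \<le> pmf p i"
    and q: "\<And>j. (1 - e) * pmf (map_pmf snd A) j \<le> pmf q j"
  obtains A' where "map_pmf fst A' = p" "map_pmf snd A' = q"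
    "\<And>E. measure_pmf.prob A' E \<le> measure_pmf.prob A E + e"
proof -
  obtain r where r: "\<And>i. pmf p i = (1 - e) * pmf (map_pmf fst A) i + e * pmf r i"
    using pmf_mixture_residual[OF e(1) p] by blast
  obtain s where s: "\<And>j. pmf q j = (1 - e) * pmf (map_pmf snd A) j + e * pmf s j"
    using pmf_mixture_residual[OF e(1) q] by blast
  define A' where "A' = bind_pmf (bernoulli_pmf e) (\<lambda>b. if b then pair_pmf r s else A)"
  have mix: "pmf (bind_pmf (bernoulli_pmf e) (\<lambda>b. if b then u else v)) i = (1 - e) * pmf v i + e * pmf u i"
    for u v :: "'c pmf" and i
    using e by (simp add: pmf_bind)
  have "map_pmf fst A' = bind_pmf (bernoulli_pmf e) (\<lambda>b. if b then r else map_pmf fst A)"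
    unfolding A'_def map_bind_pmf by (intro bind_pmf_cong refl) (auto simp: map_fst_pair_pmf)
  also have "\<dots> = p" by (rule pmf_eqI) (simp only: mix r)
  finally have 1: "map_pmf fst A' = p" .
  have "map_pmf snd A' = bind_pmf (bernoulli_pmf e) (\<lambda>b. if b then s else map_pmf snd A)"
    unfolding A'_def map_bind_pmf by (intro bind_pmf_cong refl) (auto simp: map_snd_pair_pmf)
  also have "\<dots> = q" by (rule pmf_eqI) (simp only: mix s)
  finally have 2: "map_pmf snd A' = q" .
  have "measure_pmf.prob A' E \<le> measure_pmf.prob A E + e" for E
  proof -
    have "measure_pmf.prob A' E = pmf (map_pmf (\<lambda>z. z \<in> E) A') True"
      by (simp add: pmf_map vimage_def)
    also have "map_pmf (\<lambda>z. z \<in> E) A' = bind_pmf (bernoulli_pmf e)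
        (\<lambda>b. if b then map_pmf (\<lambda>z. z \<in> E) (pair_pmf r s) else map_pmf (\<lambda>z. z \<in> E) A)"
      unfolding A'_def map_bind_pmf by (intro bind_pmf_cong refl) auto
    also have "pmf \<dots> True = (1 - e) * pmf (map_pmf (\<lambda>z. z \<in> E) A) True
        + e * pmf (map_pmf (\<lambda>z. z \<in> E) (pair_pmf r s)) True"
      by (rule mix)
    also have "\<dots> \<le> 1 * pmf (map_pmf (\<lambda>z. z \<in> E) A) True + e * 1"
      using e by (intro add_mono mult_mono) (auto simp: pmf_le_1)
    also have "pmf (map_pmf (\<lambda>z. z \<in> E) A) True = measure_pmf.prob A E"
      by (simp add: pmf_map vimage_def)
    finally show ?thesis by simp
  qed
  then show ?thesis using 1 2 that by blast
qed

section \<open>The limiting problem\<close>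

lemma zero_sum_borel [measurable]: "(zero_sum :: (real ^ 'a::finite) set) \<in> sets borel"
  unfolding zero_sum_def by (intro borel_closed closed_Collect_eq continuous_intros)

lemma sets_centered_gaussian [simp]: "sets (centered_gaussian \<Sigma>) = sets borel"
  by (simp add: centered_gaussian_def)

lemma space_centered_gaussian [simp]: "space (centered_gaussian \<Sigma>) = UNIV"
  by (simp add: centered_gaussian_def)

lemma space_Phi [simp]: "space (Phi P) = zero_sum"
  by (simp add: Phi_def space_restrict_space)

lemma sets_Phi: "sets (Phi P) = sets (restrict_space borel zero_sum)"
  by (simp add: Phi_def sets_restrict_space)

lemma emeasure_zero_sum: "emeasure (centered_gaussian (cov_matrix P)) zero_sum = 1"
proof -
  interpret prob_space "centered_gaussian (cov_matrix P)" by (rule prob_space_centered_gaussian)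
  have "prob zero_sum = 1"
    using centered_gaussian_zero_sum[of P] by (subst prob_eq_1) auto
  then show ?thesis by (simp add: emeasure_eq_measure)
qed

lemma prob_space_Phi: "prob_space (Phi P)"
  unfolding Phi_def by (rule prob_space_restrict_space) (simp_all add: emeasure_zero_sum)

lemma Phi_measurable_id: "(\<lambda>x. x) \<in> Phi P \<rightarrow>\<^sub>M borel"
  using measurable_cong_sets[OF sets_Phi refl] measurable_restrict_space1[of "\<lambda>x. x" borel borel] by auto

lemma measurable_into_Phi:
  "X \<in> borel_measurable M \<Longrightarrow> (\<And>\<omega>. \<omega> \<in> space M \<Longrightarrow> X \<omega> \<in> zero_sum) \<Longrightarrow> X \<in> M \<rightarrow>\<^sub>M Phi P"
  unfolding measurable_cong_sets[OF refl sets_Phi] by (rule measurable_restrict_space2) auto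

lemma sets_PhiD: "A \<in> sets (Phi P) \<Longrightarrow> A \<subseteq> zero_sum \<and> A \<in> sets borel"
  unfolding sets_Phi by (subst (asm) sets_restrict_space_iff) auto

lemma emeasure_Phi:
  "A \<in> sets (Phi P) \<Longrightarrow> emeasure (Phi P) A = emeasure (centered_gaussian (cov_matrix P)) A"
  using sets_PhiD[of A P] unfolding Phi_def by (intro emeasure_restrict_space) auto

text \<open>The space of \<open>Phi P\<close> is \<open>zero_sum\<close>, while a limit variable
  lies there only almost surely. It is therefore replaced by a modification \<open>X'\<close> that
  always does.\<close>

lemma distr_Phi:
  assumes X: "X \<in> borel_measurable \<Omega>" "distr \<Omega> borel X = centered_gaussian (cov_matrix P)"
    and X': "X' \<in> \<Omega> \<rightarrow>\<^sub>M Phi P" and ae: "AE \<omega> in \<Omega>. X' \<omega> = X \<omega>"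
  shows "distr \<Omega> (Phi P) X' = Phi P"
proof (rule measure_eqI)
  fix A assume A: "A \<in> sets (distr \<Omega> (Phi P) X')"
  then have A': "A \<in> sets (Phi P)" "A \<in> sets borel" using sets_PhiD by auto
  have "emeasure (distr \<Omega> (Phi P) X') A = emeasure \<Omega> (X' -` A \<inter> space \<Omega>)"
    using X' A' by (intro emeasure_distr)
  also have "\<dots> = emeasure \<Omega> (X -` A \<inter> space \<Omega>)"
    using ae measurable_sets[OF X' A'(1)] measurable_sets[OF X(1) A'(2)] by (intro emeasure_eq_AE) auto
  also have "\<dots> = emeasure (distr \<Omega> borel X) A"
    using X A' by (intro emeasure_distr[symmetric])
  also have "\<dots> = emeasure (Phi P) A" unfolding X(2) emeasure_Phi[OF A'(1)] ..
  finally show "emeasure (distr \<Omega> (Phi P) X') A = emeasure (Phi P) A" .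
qed simp

lemma couplingsD:
  assumes "R \<in> couplings M N"
  shows "prob_space R" "sets R = sets (M \<Otimes>\<^sub>M N)" "space R = space M \<times> space N"
    "distr R M fst = M" "distr R N snd = N" "fst \<in> R \<rightarrow>\<^sub>M M" "snd \<in> R \<rightarrow>\<^sub>M N"
proof -
  show 1: "prob_space R" "sets R = sets (M \<Otimes>\<^sub>M N)" "distr R M fst = M" "distr R N snd = N"
    using assms by (auto simp: couplings_def)
  show "space R = space M \<times> space N"
    using sets_eq_imp_space_eq[OF 1(2)] by (simp add: space_pair_measure)
  show "fst \<in> R \<rightarrow>\<^sub>M M" "snd \<in> R \<rightarrow>\<^sub>M N"
    unfolding measurable_cong_sets[OF 1(2) refl] by simp_all
qed

lemma pair_couplings:
  assumes "prob_space M" "prob_space N"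
  shows "M \<Otimes>\<^sub>M N \<in> couplings M N"
proof -
  interpret M: prob_space M by fact
  interpret N: prob_space N by fact
  interpret pair_prob_space M N ..
  have "distr (M \<Otimes>\<^sub>M N) M fst = M" by (rule N.distr_pair_fst)
  moreover have "distr (M \<Otimes>\<^sub>M N) N snd = N"
  proof (rule measure_eqI)
    fix A assume "A \<in> sets (distr (M \<Otimes>\<^sub>M N) N snd)"
    then have A: "A \<in> sets N" by simp
    have "snd -` A \<inter> space (M \<Otimes>\<^sub>M N) = space M \<times> A"
      using sets.sets_into_space[OF A] by (auto simp: space_pair_measure)
    then show "emeasure (distr (M \<Otimes>\<^sub>M N) N snd) A = emeasure N A"
      using A by (simp add: emeasure_distr N.emeasure_pair_measure_Times M.emeasure_space_1)
  qed simp
  ultimately show ?thesis by (simp add: couplings_def prob_space_axioms)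
qed

context finite_ot
begin

text \<open>Off \<^const>\<open>zero_sum\<close>, \<open>theta\<close> is an infimum over the empty set, hence meaningless.\<close>
definition excess_set :: "real \<Rightarrow> ((real ^ 'a) \<times> (real ^ 'b)) set" where
  "excess_set \<Delta> = {\<beta>. fst \<beta> \<in> zero_sum \<and> snd \<beta> \<in> zero_sum \<and> \<Delta> < theta c S (fst \<beta>) (snd \<beta>)}"

text \<open>\<open>theta\<close> is continuous on the closed set of pairs of zero-sum
  vectors.\<close>

lemma excess_set_borel [measurable]: "excess_set \<Delta> \<in> sets borel"
proof -
  let ?Z = "zero_sum \<times> zero_sum :: ((real ^ 'a) \<times> (real ^ 'b)) set"
  have Z: "?Z \<in> sets borel"
    by (intro borel_closed closed_Times closed_zero_sum)
  have "continuous_on ?Z (\<lambda>\<beta>. theta c S (fst \<beta>) (snd \<beta>))"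
    unfolding continuous_on_sequentially
  proof (intro allI ballI impI)
    fix x \<beta> assume "\<beta> \<in> ?Z" and x: "(\<forall>n. x n \<in> ?Z) \<and> x \<longlonglongrightarrow> \<beta>"
    then have "\<And>n. fst (x n) \<in> zero_sum" "\<And>n. snd (x n) \<in> zero_sum" by (auto simp: mem_Times_iff)
    with theta_tendsto[OF tendsto_fst[OF conjunct2[OF x]] tendsto_snd[OF conjunct2[OF x]]]
    show "((\<lambda>\<beta>. theta c S (fst \<beta>) (snd \<beta>)) \<circ> x) \<longlonglongrightarrow> theta c S (fst \<beta>) (snd \<beta>)"
      by (simp add: comp_def)
  qed
  then have "(\<lambda>\<beta>. theta c S (fst \<beta>) (snd \<beta>)) \<in> borel_measurable (restrict_space borel ?Z)"
    by (rule borel_measurable_continuous_on_restrict)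
  from measurable_sets[OF this, of "{\<Delta><..}"]
  have "(\<lambda>\<beta>. theta c S (fst \<beta>) (snd \<beta>)) -` {\<Delta><..} \<inter> ?Z \<in> sets (restrict_space borel ?Z)"
    by (simp add: space_restrict_space)
  also have "(\<lambda>\<beta>. theta c S (fst \<beta>) (snd \<beta>)) -` {\<Delta><..} \<inter> ?Z = excess_set \<Delta>"
    by (auto simp: excess_set_def mem_Times_iff)
  finally show ?thesis using Z by (subst (asm) sets_restrict_space_iff) auto
qed

lemma Phi_coupling_to_borel:
  assumes "\<Psi> \<in> couplings (Phi PX) (Phi PY)"
  shows "(\<lambda>\<beta>. \<beta>) \<in> \<Psi> \<rightarrow>\<^sub>M borel" "{\<beta> \<in> space \<Psi>. \<Delta> < theta c S (fst \<beta>) (snd \<beta>)} = excess_set \<Delta>"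
    "excess_set \<Delta> \<in> sets \<Psi>"
proof -
  note \<Psi> = couplingsD[OF assms]
  have "(\<lambda>\<beta>. (fst \<beta>, snd \<beta>)) \<in> \<Psi> \<rightarrow>\<^sub>M borel \<Otimes>\<^sub>M borel"
    using measurable_compose[OF \<Psi>(6) Phi_measurable_id] measurable_compose[OF \<Psi>(7) Phi_measurable_id]
    by (rule measurable_Pair)
  then show 1: "(\<lambda>\<beta>. \<beta>) \<in> \<Psi> \<rightarrow>\<^sub>M borel" by (simp add: borel_prod)
  have sp: "space \<Psi> = zero_sum \<times> zero_sum" using \<Psi>(3) by simp
  show 2: "{\<beta> \<in> space \<Psi>. \<Delta> < theta c S (fst \<beta>) (snd \<beta>)} = excess_set \<Delta>"
    unfolding sp excess_set_def by (auto simp: mem_Times_iff)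
  have "(\<lambda>\<beta>. \<beta>) -` excess_set \<Delta> \<inter> space \<Psi> = excess_set \<Delta>"
    unfolding sp excess_set_def by (auto simp: mem_Times_iff)
  then show "excess_set \<Delta> \<in> sets \<Psi>" using measurable_sets[OF 1 excess_set_borel[of \<Delta>]] by simp
qed

lemma Lambda_eq:
  "Lambda c S PX PY \<Delta> = (INF \<Psi>\<in>couplings (Phi PX) (Phi PY). measure \<Psi> (excess_set \<Delta>))"
  unfolding Lambda_def by (intro INF_cong refl arg_cong2[where f=measure] Phi_coupling_to_borel)

lemma Lambda_le: "\<Psi> \<in> couplings (Phi PX) (Phi PY) \<Longrightarrow> Lambda c S PX PY \<Delta> \<le> measure \<Psi> (excess_set \<Delta>)"
  unfolding Lambda_eq by (intro cINF_lower bdd_belowI2[where m=0]) auto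

lemma Lambda_approx:
  assumes "Lambda c S PX PY \<Delta> < b"
  obtains \<Psi> where "\<Psi> \<in> couplings (Phi PX) (Phi PY)" "measure \<Psi> (excess_set \<Delta>) < b"
proof -
  have "\<exists>v\<in>(\<lambda>\<Psi>. measure \<Psi> (excess_set \<Delta>)) ` couplings (Phi PX) (Phi PY). v < b"
    using assms pair_couplings[OF prob_space_Phi prob_space_Phi, of PX PY]
    unfolding Lambda_eq by (intro cInf_lessD) auto
  then show ?thesis using that by blast
qed

lemma Lambda_antimono:
  assumes "\<Delta> \<le> \<Delta>'"
  shows "Lambda c S PX PY \<Delta>' \<le> Lambda c S PX PY \<Delta>"
proof (rule field_le_epsilon)
  fix e :: real assume "0 < e"
  then obtain \<Psi> where \<Psi>: "\<Psi> \<in> couplings (Phi PX) (Phi PY)" "measure \<Psi> (excess_set \<Delta>) < Lambda c S PX PY \<Delta> + e"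
    using Lambda_approx[of \<Delta> "Lambda c S PX PY \<Delta> + e"] by auto
  interpret prob_space \<Psi> using couplingsD(1)[OF \<Psi>(1)] .
  have "measure \<Psi> (excess_set \<Delta>') \<le> measure \<Psi> (excess_set \<Delta>)"
    using assms Phi_coupling_to_borel(3)[OF \<Psi>(1)] by (intro finite_measure_mono) (auto simp: excess_set_def)
  then show "Lambda c S PX PY \<Delta>' \<le> Lambda c S PX PY \<Delta> + e"
    using Lambda_le[OF \<Psi>(1), of \<Delta>'] \<Psi>(2) by linarith
qed

lemma Lambda_nonneg: "0 \<le> Lambda c S PX PY \<Delta>"
  unfolding Lambda_eq using pair_couplings[OF prob_space_Phi prob_space_Phi, of PX PY]
  by (intro cINF_greatest) auto

end

section \<open>The lower bound\<close>

text \<open>Two events of probability above \<open>1 - e / 2\<close> meet with probability above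
  \<open>1 - e\<close>; the radii of the two components are added.\<close>

lemma tight_coupling:
  fixes \<mu> :: "nat \<Rightarrow> ('c::euclidean_space \<times> 'd::euclidean_space) measure"
  assumes prob: "\<And>n. prob_space (\<mu> n)" and sets: "\<And>n. sets (\<mu> n) = sets borel"
    and t1: "\<And>e. 0 < e \<Longrightarrow> \<exists>K. \<forall>n. 1 - e < measure (\<mu> n) {x. norm (fst x) \<le> K}"
    and t2: "\<And>e. 0 < e \<Longrightarrow> \<exists>K. \<forall>n. 1 - e < measure (\<mu> n) {x. norm (snd x) \<le> K}"
    and e: "0 < e"
  shows "\<exists>K. \<forall>n. 1 - e < measure (\<mu> n) {x. norm x \<le> K}"
proof -
  obtain K1 where K1: "\<And>n. 1 - e / 2 < measure (\<mu> n) {x. norm (fst x) \<le> K1}"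
    using t1[of "e / 2"] e by auto
  obtain K2 where K2: "\<And>n. 1 - e / 2 < measure (\<mu> n) {x. norm (snd x) \<le> K2}"
    using t2[of "e / 2"] e by auto
  show ?thesis
  proof (intro exI allI)
    fix n
    interpret prob_space "\<mu> n" by (rule prob)
    have sp: "space (\<mu> n) = UNIV" using sets_eq_imp_space_eq[OF sets] by simp
    let ?A = "{x :: 'c \<times> 'd. norm (fst x) \<le> K1}" and ?B = "{x :: 'c \<times> 'd. norm (snd x) \<le> K2}"
    have m: "?A \<in> events" "?B \<in> events" "{x. norm x \<le> K1 + K2} \<in> events"
      unfolding sets by (intro borel_closed closed_Collect_le continuous_intros)+
    have "?A \<inter> ?B \<subseteq> {x. norm x \<le> K1 + K2}"
    proof
      fix x assume "x \<in> ?A \<inter> ?B"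
      then have "norm (fst x) + norm (snd x) \<le> K1 + K2" by simp
      then show "x \<in> {x. norm x \<le> K1 + K2}"
        using norm_Pair_le[of "fst x" "snd x"] by simp
    qed
    then have "prob (?A \<inter> ?B) \<le> prob {x. norm x \<le> K1 + K2}" using m by (intro finite_measure_mono)
    moreover have "prob (?A \<union> ?B) = prob ?A + prob ?B - prob (?A \<inter> ?B)"
      using m by (simp add: finite_measure_Union')
        (simp add: finite_measure_Diff' Int_commute)
    moreover have "prob (?A \<union> ?B) \<le> 1" by (rule prob_le_1)
    ultimately show "1 - e < prob {x. norm x \<le> K1 + K2}"
      using K1[of n] K2[of n] by linarith
  qed
qed

lemma prob_space_iid: "prob_space (iid n P)"
  unfolding iid_def by (intro prob_space_PiM prob_space_measure_pmf)

context finite_ot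
begin

text \<open>The limit of a pointwise convergent realisation of the deviations provides a coupling of
  the two Gaussians. Since an excess is a strict inequality and \<open>theta\<close> is continuous,
  an excess of the limit forces one of all late terms, so Fatou's lemma for events carries the bound
  \<open>b\<close> to the limit.\<close>

lemma excess_subsequence_bound:
  fixes r :: "nat \<Rightarrow> nat"
  assumes r: "strict_mono r" and r0: "\<And>k. 0 < r k"
    and less: "\<And>k. excess_prob c PX PY (r k) (cost p + \<Delta> / sqrt (r k)) < b"
  shows "Lambda c S PX PY \<Delta> \<le> b"
proof -
  let ?ex = "\<lambda>n R. measure R {z \<in> space R. avg_cost c n (fst z) (snd z) > cost p + \<Delta> / sqrt (real n)}"
  have "\<exists>R. R \<in> couplings (iid (r k) PX) (iid (r k) PY) \<and> ?ex (r k) R < b" for k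
  proof -
    have "couplings (iid (r k) PX) (iid (r k) PY) \<noteq> {}"
      using pair_couplings[OF prob_space_iid prob_space_iid] by blast
    then have "\<exists>v\<in>?ex (r k) ` couplings (iid (r k) PX) (iid (r k) PY). v < b"
      using less[of k] unfolding excess_prob_def by (intro cInf_lessD) auto
    then show ?thesis by blast
  qed
  then have "\<exists>R. \<forall>k. R k \<in> couplings (iid (r k) PX) (iid (r k) PY) \<and> ?ex (r k) (R k) < b"
    by (intro choice allI)
  then obtain R where R: "\<And>k. R k \<in> couplings (iid (r k) PX) (iid (r k) PY)" "\<And>k. ?ex (r k) (R k) < b"
    by auto
  define f where "f k z = (fluct PX (r k) (fst z), fluct PY (r k) (snd z))" for k z
  define \<mu> where "\<mu> k = distr (R k) borel (f k)" for k
  have sets_R: "A \<in> sets (R k)" if "A \<subseteq> space (R k)" for A k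
    using that unfolding couplingsD(2)[OF R(1)] couplingsD(3)[OF R(1)] sets_iid_pair by (simp add: space_iid)
  have f_meas [measurable]: "f k \<in> borel_measurable (R k)" for k
    by (rule measurableI) (auto intro: sets_R)
  have prob_\<mu>: "prob_space (\<mu> k)" for k
    unfolding \<mu>_def by (intro prob_space.prob_space_distr couplingsD(1)[OF R(1)] f_meas)
  have sets_\<mu>: "sets (\<mu> k) = sets borel" for k by (simp add: \<mu>_def)
  have law1: "distr (\<mu> k) borel fst = fluct_law PX (r k)" for k
  proof -
    have "distr (\<mu> k) borel fst = distr (R k) borel (\<lambda>z. fluct PX (r k) (fst z))"
      unfolding \<mu>_def by (subst distr_distr) (auto simp: comp_def f_def borel_measurable_continuous_onI continuous_on_fst)
    also have "\<dots> = distr (distr (R k) (iid (r k) PX) fst) borel (fluct PX (r k))"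
      by (subst distr_distr[OF fluct_measurable_iid couplingsD(6)[OF R(1)]]) (simp add: comp_def)
    finally show ?thesis unfolding couplingsD(4)[OF R(1)] distr_iid_fluct .
  qed
  have law2: "distr (\<mu> k) borel snd = fluct_law PY (r k)" for k
  proof -
    have "distr (\<mu> k) borel snd = distr (R k) borel (\<lambda>z. fluct PY (r k) (snd z))"
      unfolding \<mu>_def by (subst distr_distr) (auto simp: comp_def f_def borel_measurable_continuous_onI continuous_on_snd)
    also have "\<dots> = distr (distr (R k) (iid (r k) PY) snd) borel (fluct PY (r k))"
      by (subst distr_distr[OF fluct_measurable_iid couplingsD(7)[OF R(1)]]) (simp add: comp_def)
    finally show ?thesis unfolding couplingsD(5)[OF R(1)] distr_iid_fluct .
  qed
  have fs_meas: "fst \<in> \<mu> k \<rightarrow>\<^sub>M borel" "snd \<in> \<mu> k \<rightarrow>\<^sub>M borel" for k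
    unfolding measurable_cong_sets[OF sets_\<mu> refl]
    by (auto intro!: borel_measurable_continuous_onI continuous_intros)
  have sp\<mu>: "space (\<mu> k) = UNIV" for k by (simp add: \<mu>_def)
  have tight: "\<exists>K. \<forall>k. 1 - e < measure (\<mu> k) {x. norm (f x) \<le> K}"
    if "0 < e" and law: "\<And>k. distr (\<mu> k) borel f = fluct_law P (r k)" and f: "\<And>k. f \<in> \<mu> k \<rightarrow>\<^sub>M borel"
    for e f and P :: "'z::finite pmf"
  proof -
    obtain K where K: "\<And>n. 1 - e < measure (fluct_law P n) {x. norm x \<le> K}"
      using fluct_law_tight[OF \<open>0 < e\<close>] by blast
    have "measure (fluct_law P (r k)) {x. norm x \<le> K} = measure (\<mu> k) {x. norm (f x) \<le> K}" for k
      unfolding law[symmetric] using f by (subst measure_distr) (auto simp: vimage_def sp\<mu>)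
    then show ?thesis using K by metis
  qed
  obtain q :: "nat \<Rightarrow> nat" and \<Omega> :: "real measure" and Y Z where q: "strict_mono q" and \<Omega>: "prob_space \<Omega>"
    and Y [measurable]: "\<And>n. Y n \<in> borel_measurable \<Omega>" and lawY: "\<And>n. distr \<Omega> borel (Y n) = \<mu> (q n)"
    and Z [measurable]: "Z \<in> borel_measurable \<Omega>" and lim: "\<And>\<omega>. \<omega> \<in> space \<Omega> \<Longrightarrow> (\<lambda>n. Y n \<omega>) \<longlonglongrightarrow> Z \<omega>"
    by (rule skorokhod_euclidean[OF prob_\<mu> sets_\<mu> tight_coupling[OF prob_\<mu> sets_\<mu> tight[OF _ law1 fs_meas(1)] tight[OF _ law2 fs_meas(2)]]]) blast+
  interpret \<Omega>: prob_space \<Omega> by (rule \<Omega>)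
  have [measurable]: "(\<lambda>\<omega>. fst (Y n \<omega>)) \<in> borel_measurable \<Omega>" "(\<lambda>\<omega>. snd (Y n \<omega>)) \<in> borel_measurable \<Omega>" for n
    by (auto intro!: borel_measurable_continuous_on[OF _ Y] continuous_intros)
  have [measurable]: "(\<lambda>\<omega>. fst (Z \<omega>)) \<in> borel_measurable \<Omega>" "(\<lambda>\<omega>. snd (Z \<omega>)) \<in> borel_measurable \<Omega>"
    by (auto intro!: borel_measurable_continuous_on[OF _ Z] continuous_intros)
  have rq: "filterlim (\<lambda>k. r (q k)) sequentially sequentially"
    using filterlim_subseq[OF strict_mono_o[OF r q]] by (simp add: comp_def)
  have lawY1: "distr \<Omega> borel (\<lambda>\<omega>. fst (Y n \<omega>)) = fluct_law PX (r (q n))" for n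
    unfolding law1[symmetric] lawY[symmetric]
    by (subst distr_distr) (auto simp: comp_def intro!: borel_measurable_continuous_onI continuous_intros)
  have lawY2: "distr \<Omega> borel (\<lambda>\<omega>. snd (Y n \<omega>)) = fluct_law PY (r (q n))" for n
    unfolding law2[symmetric] lawY[symmetric]
    by (subst distr_distr) (auto simp: comp_def intro!: borel_measurable_continuous_onI continuous_intros)
  have lawZ1: "distr \<Omega> borel (\<lambda>\<omega>. fst (Z \<omega>)) = centered_gaussian (cov_matrix PX)"
    by (rule fluct_limit_law[OF \<Omega> _ lawY1 rq]) (auto intro!: tendsto_fst lim)
  have lawZ2: "distr \<Omega> borel (\<lambda>\<omega>. snd (Z \<omega>)) = centered_gaussian (cov_matrix PY)"
    by (rule fluct_limit_law[OF \<Omega> _ lawY2 rq]) (auto intro!: tendsto_snd lim)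
  have aeY: "AE \<omega> in \<Omega>. f (Y n \<omega>) \<in> zero_sum"
    if law: "distr \<Omega> borel (\<lambda>\<omega>. f (Y n \<omega>)) = fluct_law P k" and [measurable]: "(\<lambda>\<omega>. f (Y n \<omega>)) \<in> borel_measurable \<Omega>"
    for f n k and P :: "'z::finite pmf"
  proof -
    have "AE x in fluct_law P k. x \<in> zero_sum"
      unfolding fluct_law_def by (subst AE_distr_iff) (auto simp: fluct_in_zero_sum)
    then show ?thesis unfolding law[symmetric] by (subst (asm) AE_distr_iff) auto
  qed
  \<comment> \<open>Only the law of \<open>Y n\<close> is known, so it lies in the zero-sum
    subspaces merely almost surely; countably many \<open>n\<close> share one null set.\<close>
  have good: "AE \<omega> in \<Omega>. (\<forall>n. fst (Y n \<omega>) \<in> zero_sum) \<and> (\<forall>n. snd (Y n \<omega>) \<in> zero_sum)"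
    using aeY[OF lawY1] aeY[OF lawY2] by (simp add: AE_all_countable)
  \<comment> \<open>Forced into the zero-sum subspaces everywhere, since a map into
    \<open>Phi\<close> must have its values there; 0 is a harmless default.\<close>
  define Z' where "Z' \<omega> = (if fst (Z \<omega>) \<in> zero_sum \<and> snd (Z \<omega>) \<in> zero_sum then Z \<omega> else 0)" for \<omega>
  have Z'_zs: "fst (Z' \<omega>) \<in> zero_sum" "snd (Z' \<omega>) \<in> zero_sum" for \<omega>
    by (auto simp: Z'_def zero_sum_def)
  have Z'_meas [measurable]: "Z' \<in> borel_measurable \<Omega>" unfolding Z'_def by measurable
  have aeZ: "AE \<omega> in \<Omega>. Z' \<omega> = Z \<omega>"
  proof -
    have "AE \<omega> in \<Omega>. fst (Z \<omega>) \<in> zero_sum"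
      using centered_gaussian_zero_sum[of PX] unfolding lawZ1[symmetric] by (subst (asm) AE_distr_iff) auto
    moreover have "AE \<omega> in \<Omega>. snd (Z \<omega>) \<in> zero_sum"
      using centered_gaussian_zero_sum[of PY] unfolding lawZ2[symmetric] by (subst (asm) AE_distr_iff) auto
    ultimately show ?thesis by eventually_elim (simp add: Z'_def)
  qed
  have "(\<lambda>\<omega>. fst (Z' \<omega>)) \<in> borel_measurable \<Omega>" "(\<lambda>\<omega>. snd (Z' \<omega>)) \<in> borel_measurable \<Omega>"
    by (auto intro!: borel_measurable_continuous_on[OF _ Z'_meas] continuous_intros)
  then have m1: "(\<lambda>\<omega>. fst (Z' \<omega>)) \<in> \<Omega> \<rightarrow>\<^sub>M Phi PX" and m2: "(\<lambda>\<omega>. snd (Z' \<omega>)) \<in> \<Omega> \<rightarrow>\<^sub>M Phi PY"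
    by (auto intro!: measurable_into_Phi Z'_zs)
  have m: "Z' \<in> \<Omega> \<rightarrow>\<^sub>M Phi PX \<Otimes>\<^sub>M Phi PY"
    using measurable_Pair[OF m1 m2] by simp
  define \<Psi> where "\<Psi> = distr \<Omega> (Phi PX \<Otimes>\<^sub>M Phi PY) Z'"
  have \<Psi>: "\<Psi> \<in> couplings (Phi PX) (Phi PY)"
    unfolding couplings_def
  proof (intro CollectI conjI)
    show "prob_space \<Psi>" unfolding \<Psi>_def by (rule \<Omega>.prob_space_distr[OF m])
    show "sets \<Psi> = sets (Phi PX \<Otimes>\<^sub>M Phi PY)" by (simp add: \<Psi>_def)
    have "distr \<Psi> (Phi PX) fst = distr \<Omega> (Phi PX) (\<lambda>\<omega>. fst (Z' \<omega>))"
      unfolding \<Psi>_def by (subst distr_distr[OF measurable_fst m]) (simp add: comp_def)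
    also have "\<dots> = Phi PX"
      using aeZ by (intro distr_Phi[OF _ lawZ1 m1]) (auto elim: eventually_mono)
    finally show "distr \<Psi> (Phi PX) fst = Phi PX" .
    have "distr \<Psi> (Phi PY) snd = distr \<Omega> (Phi PY) (\<lambda>\<omega>. snd (Z' \<omega>))"
      unfolding \<Psi>_def by (subst distr_distr[OF measurable_snd m]) (simp add: comp_def)
    also have "\<dots> = Phi PY"
      using aeZ by (intro distr_Phi[OF _ lawZ2 m2]) (auto elim: eventually_mono)
    finally show "distr \<Psi> (Phi PY) snd = Phi PY" .
  qed
  let ?E = "\<lambda>n. Y n -` excess_set \<Delta> \<inter> space \<Omega>"
  have E [measurable]: "?E n \<in> sets \<Omega>" for n using measurable_sets[OF Y excess_set_borel] .
  have PE: "\<Omega>.prob (?E n) \<le> b" for n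
  proof -
    interpret Rk: prob_space "R (q n)" by (rule couplingsD(1)[OF R(1)])
    have "\<Omega>.prob (?E n) = measure (\<mu> (q n)) (excess_set \<Delta>)"
      unfolding lawY[symmetric] by (subst measure_distr) auto
    also have "\<dots> = Rk.prob (f (q n) -` excess_set \<Delta> \<inter> space (R (q n)))"
      unfolding \<mu>_def by (subst measure_distr) auto
    also have "\<dots> \<le> ?ex (r (q n)) (R (q n))"
    proof (rule Rk.finite_measure_mono)
      show "f (q n) -` excess_set \<Delta> \<inter> space (R (q n))
        \<subseteq> {z \<in> space (R (q n)). avg_cost c (r (q n)) (fst z) (snd z) > cost p + \<Delta> / sqrt (real (r (q n)))}"
      proof
        fix z assume z: "z \<in> f (q n) -` excess_set \<Delta> \<inter> space (R (q n))"
        then have "\<Delta> < sqrt (r (q n)) * (avg_cost c (r (q n)) (fst z) (snd z) - cost p)"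
          using theta_le_excess[OF r0[of "q n"], of "fst z" "snd z"] by (simp add: f_def excess_set_def)
        then have "\<Delta> / sqrt (r (q n)) < avg_cost c (r (q n)) (fst z) (snd z) - cost p"
          using r0[of "q n"] by (simp add: divide_less_eq mult.commute)
        then show "z \<in> {z \<in> space (R (q n)). avg_cost c (r (q n)) (fst z) (snd z) > cost p + \<Delta> / sqrt (real (r (q n)))}"
          using z by simp
      qed
    qed (auto intro: sets_R)
    also have "\<dots> \<le> b" using R(2)[of "q n"] by simp
    finally show ?thesis .
  qed
  \<comment> \<open>The events that all terms from \<open>n\<close> on exceed. They increase to the
    lower limit of the events \<open>?E k\<close>, and each has probability at most
    \<open>b\<close>.\<close>
  define A where "A n = (\<Inter>k\<in>{n..}. ?E k)" for n
  have A_meas: "A n \<in> sets \<Omega>" for n unfolding A_def by (intro sets.countable_INT') auto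
  have "incseq A" unfolding A_def by (intro monoI INF_superset_mono) auto
  then have "(\<lambda>n. \<Omega>.prob (A n)) \<longlonglongrightarrow> \<Omega>.prob (\<Union>n. A n)"
    using A_meas by (intro \<Omega>.finite_Lim_measure_incseq) auto
  moreover have "\<Omega>.prob (A n) \<le> b" for n
  proof -
    have "\<Omega>.prob (A n) \<le> \<Omega>.prob (?E n)" by (rule \<Omega>.finite_measure_mono) (auto simp: A_def)
    then show ?thesis using PE[of n] by linarith
  qed
  ultimately have bound: "\<Omega>.prob (\<Union>n. A n) \<le> b" by (intro LIMSEQ_le_const2) auto
  have "Lambda c S PX PY \<Delta> \<le> measure \<Psi> (excess_set \<Delta>)" by (rule Lambda_le[OF \<Psi>])
  also have "\<dots> = \<Omega>.prob (Z' -` excess_set \<Delta> \<inter> space \<Omega>)"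
    using Phi_coupling_to_borel(3)[OF \<Psi>] m unfolding \<Psi>_def by (subst measure_distr) auto
  also have "\<dots> \<le> \<Omega>.prob (\<Union>n. A n)"
  proof (rule \<Omega>.finite_measure_mono_AE)
    show "AE \<omega> in \<Omega>. \<omega> \<in> Z' -` excess_set \<Delta> \<inter> space \<Omega> \<longrightarrow> \<omega> \<in> (\<Union>n. A n)"
      using good aeZ
    proof eventually_elim
      case (elim \<omega>)
      show ?case
      proof
        assume w: "\<omega> \<in> Z' -` excess_set \<Delta> \<inter> space \<Omega>"
        then have "\<Delta> < theta c S (fst (Z \<omega>)) (snd (Z \<omega>))" using elim by (simp add: excess_set_def)
        moreover have "(\<lambda>n. theta c S (fst (Y n \<omega>)) (snd (Y n \<omega>))) \<longlonglongrightarrow> theta c S (fst (Z \<omega>)) (snd (Z \<omega>))"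
          using elim w by (intro theta_tendsto tendsto_fst tendsto_snd lim) auto
        ultimately have "\<forall>\<^sub>F n in sequentially. \<Delta> < theta c S (fst (Y n \<omega>)) (snd (Y n \<omega>))"
          by (intro order_tendstoD(1))
        then obtain N where "\<And>n. n \<ge> N \<Longrightarrow> \<Delta> < theta c S (fst (Y n \<omega>)) (snd (Y n \<omega>))"
          by (auto simp: eventually_sequentially)
        then have "\<omega> \<in> A N" using elim w by (auto simp: A_def excess_set_def)
        then show "\<omega> \<in> (\<Union>n. A n)" by blast
      qed
    qed
    show "(\<Union>n. A n) \<in> sets \<Omega>" using A_meas by auto
  qed
  finally show ?thesis using bound by linarith
qed

text \<open>Otherwise infinitely many \<open>n\<close> would stay below some \<open>b\<close>
  smaller than \<open>Lambda\<close>, against the bound for subsequences. The index 0 is discarded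
  because the comparison with \<open>theta\<close> needs nonempty words.\<close>

lemma Lambda_le_liminf:
  "ereal (Lambda c S PX PY \<Delta>) \<le> liminf (\<lambda>n. ereal (excess_prob c PX PY n (cost p + \<Delta> / sqrt (real n))))"
  unfolding le_Liminf_iff
proof (intro allI impI)
  fix y assume "y < ereal (Lambda c S PX PY \<Delta>)"
  then obtain b where b: "y < ereal b" "b < Lambda c S PX PY \<Delta>"
    by (metis ereal_dense2 ereal_less(2) less_ereal.simps(1))
  let ?ex = "\<lambda>n. excess_prob c PX PY n (cost p + \<Delta> / sqrt (real n))"
  show "\<forall>\<^sub>F n in sequentially. y < ereal (?ex n)"
  proof (rule ccontr)
    assume "\<not> ?thesis"
    then have "\<exists>\<^sub>F n in sequentially. \<not> y < ereal (?ex n)" by (simp add: not_eventually)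
    then have "\<exists>\<^sub>F n in sequentially. \<not> y < ereal (?ex n) \<and> 0 < n"
      using eventually_gt_at_top[of "0::nat"] by (rule frequently_eventually_frequently)
    then have "infinite {n. \<not> y < ereal (?ex n) \<and> 0 < n}"
      by (simp add: cofinite_eq_sequentially[symmetric] frequently_cofinite)
    from infinite_enumerate[OF this] obtain r :: "nat \<Rightarrow> nat" where r: "strict_mono r"
      and rn: "\<And>k. \<not> y < ereal (?ex (r k)) \<and> 0 < r k" by blast
    have "?ex (r k) < b" for k
    proof -
      have "ereal (?ex (r k)) \<le> y" using rn[of k] unfolding not_less by blast
      from le_less_trans[OF this b(1)] have "ereal (?ex (r k)) < ereal b" .
      then show ?thesis by simp
    qed
    then have "Lambda c S PX PY \<Delta> \<le> b" using rn by (intro excess_subsequence_bound[OF r]) auto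
    with b(2) show False by simp
  qed
qed

end

section \<open>Discretization\<close>

text \<open>The grid cube of side \<open>h\<close> and offset \<open>a\<close> that contains the
  vector, given by its integer coordinates. Clamping leaves finitely many labels; a coordinate of
  absolute value \<open>N\<close> marks an unbounded cell.\<close>

definition cell :: "real \<Rightarrow> real \<Rightarrow> int \<Rightarrow> real ^ 'd::finite \<Rightarrow> 'd \<Rightarrow> int" where
  "cell a h N \<beta> = (\<lambda>x. max (- N) (min N \<lfloor>(\<beta> $ x - a) / h\<rfloor>))"

lemma finite_cells: "finite (UNIV \<rightarrow>\<^sub>E {- N..N :: int} :: ('d::finite \<Rightarrow> int) set)"
  by (intro finite_PiE) auto

lemma cell_in_cells: "0 \<le> N \<Longrightarrow> cell a h N \<beta> \<in> UNIV \<rightarrow>\<^sub>E {- N..N}"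
  by (auto simp: cell_def)

lemma cell_borel [measurable]: "{\<beta>. cell a h N \<beta> = i} \<in> sets borel"
proof -
  have "{\<beta> \<in> space borel. \<forall>x\<in>UNIV. max (- N) (min N \<lfloor>(\<beta> $ x - a) / h\<rfloor>) = i x} \<in> sets borel"
    by measurable
  then show ?thesis by (simp add: cell_def fun_eq_iff)
qed

text \<open>Off the grid hyperplanes the floor is locally constant.\<close>

lemma eventually_cell_eq:
  fixes z :: "real ^ 'd::finite"
  assumes h: "0 < h" and lim: "Y \<longlonglongrightarrow> z" and off: "\<And>x (k::int). z $ x \<noteq> a + of_int k * h"
  shows "\<forall>\<^sub>F n in sequentially. cell a h N (Y n) = cell a h N z"
proof -
  have "\<forall>\<^sub>F n in sequentially. \<lfloor>(Y n $ x - a) / h\<rfloor> = \<lfloor>(z $ x - a) / h\<rfloor>" for x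
  proof -
    let ?w = "(z $ x - a) / h"
    have "of_int \<lfloor>?w\<rfloor> \<noteq> ?w"
      using off[of x "\<lfloor>?w\<rfloor>"] h by (auto simp: field_simps)
    then have w: "of_int \<lfloor>?w\<rfloor> < ?w" "?w < of_int \<lfloor>?w\<rfloor> + 1" by linarith+
    have l: "(\<lambda>n. (Y n $ x - a) / h) \<longlonglongrightarrow> ?w"
      using h by (intro tendsto_intros lim) auto
    from order_tendstoD(1)[OF l w(1)] order_tendstoD(2)[OF l w(2)]
    show ?thesis by eventually_elim (intro floor_unique, simp_all)
  qed
  then have "\<forall>\<^sub>F n in sequentially. \<forall>x. \<lfloor>(Y n $ x - a) / h\<rfloor> = \<lfloor>(z $ x - a) / h\<rfloor>"
    by (rule eventually_all_finite)
  then show ?thesis by eventually_elim (simp add: cell_def)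
qed

text \<open>Null hyperplanes make the cell a continuity set of the Gaussian. A subsequence staying
  away from the limit would have a pointwise convergent realisation, along which the indicators of
  the cell converge almost surely.\<close>

lemma fluct_law_cell_limit:
  fixes P :: "'d::finite pmf"
  assumes h: "0 < h"
    and null: "\<And>x (k::int). measure (centered_gaussian (cov_matrix P)) {\<beta>. \<beta> $ x = a + of_int k * h} = 0"
  shows "(\<lambda>n. measure (fluct_law P n) {\<beta>. cell a h N \<beta> = i})
    \<longlonglongrightarrow> measure (centered_gaussian (cov_matrix P)) {\<beta>. cell a h N \<beta> = i}"
    (is "?X \<longlonglongrightarrow> ?L")
proof (rule ccontr)
  let ?C = "{\<beta> :: real ^ 'd. cell a h N \<beta> = i}"
  assume "\<not> ?X \<longlonglongrightarrow> ?L"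
  then obtain e where e: "0 < e" and "\<not> (\<forall>\<^sub>F n in sequentially. dist (?X n) ?L < e)"
    unfolding tendsto_iff by blast
  then have "\<exists>\<^sub>F n in sequentially. \<not> dist (?X n) ?L < e" by (simp add: not_eventually)
  then have "infinite {n. \<not> dist (?X n) ?L < e}"
    by (simp add: cofinite_eq_sequentially[symmetric] frequently_cofinite)
  from infinite_enumerate[OF this] obtain r :: "nat \<Rightarrow> nat" where r: "strict_mono r"
    and far: "\<And>k. \<not> dist (?X (r k)) ?L < e" by blast
  have tight: "\<exists>K. \<forall>k. 1 - \<epsilon> < measure (fluct_law P (r k)) {x. norm x \<le> K}" if "0 < \<epsilon>" for \<epsilon>
    using fluct_law_tight[OF that, of P] by blast
  obtain q :: "nat \<Rightarrow> nat" and \<Omega> :: "real measure" and Y Z where q: "strict_mono q" and \<Omega>: "prob_space \<Omega>"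
    and Y [measurable]: "\<And>n. Y n \<in> borel_measurable \<Omega>"
    and lawY: "\<And>n. distr \<Omega> borel (Y n) = fluct_law P (r (q n))"
    and Z [measurable]: "Z \<in> borel_measurable \<Omega>" and lim: "\<And>\<omega>. \<omega> \<in> space \<Omega> \<Longrightarrow> (\<lambda>n. Y n \<omega>) \<longlonglongrightarrow> Z \<omega>"
    by (rule skorokhod_euclidean[OF prob_space_fluct_law sets_fluct_law tight]) blast+
  interpret \<Omega>: prob_space \<Omega> by (rule \<Omega>)
  interpret G: prob_space "centered_gaussian (cov_matrix P)" by (rule prob_space_centered_gaussian)
  have rq: "filterlim (\<lambda>k. r (q k)) sequentially sequentially"
    using filterlim_subseq[OF strict_mono_o[OF r q]] by (simp add: comp_def)
  have lawZ: "distr \<Omega> borel Z = centered_gaussian (cov_matrix P)"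
    by (rule fluct_limit_law[OF \<Omega> Y lawY rq Z lim])
  have "AE \<beta> in centered_gaussian (cov_matrix P). \<forall>x. \<forall>k::int. \<beta> $ x \<noteq> a + of_int k * h"
    unfolding AE_all_countable
  proof (intro allI)
    fix x :: 'd and k :: int
    have "{\<beta> \<in> space (borel :: (real ^ 'd) measure). \<beta> $ x = a + of_int k * h} \<in> sets borel" by measurable
    then have "{\<beta> :: real ^ 'd. \<beta> $ x = a + of_int k * h} \<in> null_sets (centered_gaussian (cov_matrix P))"
      using null[of x k] by (auto simp: null_sets_def G.emeasure_eq_measure)
    then show "AE \<beta> in centered_gaussian (cov_matrix P). \<beta> $ x \<noteq> a + of_int k * h"
      by (rule AE_I') auto
  qed
  then have off: "AE \<omega> in \<Omega>. \<forall>x. \<forall>k::int. Z \<omega> $ x \<noteq> a + of_int k * h"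
    unfolding lawZ[symmetric] by (subst (asm) AE_distr_iff) auto
  have conv: "(\<lambda>n. \<integral>\<omega>. indicator ?C (Y n \<omega>) \<partial>\<Omega>) \<longlonglongrightarrow> (\<integral>\<omega>. indicator ?C (Z \<omega>) \<partial>\<Omega> :: real)"
  proof (rule integral_dominated_convergence[where w="\<lambda>_. 1"])
    show "AE \<omega> in \<Omega>. (\<lambda>n. indicator ?C (Y n \<omega>)) \<longlonglongrightarrow> (indicator ?C (Z \<omega>) :: real)"
      using off
    proof (rule AE_mp, intro AE_I2 impI)
      fix \<omega> assume w: "\<omega> \<in> space \<Omega>" "\<forall>x. \<forall>k::int. Z \<omega> $ x \<noteq> a + of_int k * h"
      have "\<forall>\<^sub>F n in sequentially. cell a h N (Y n \<omega>) = cell a h N (Z \<omega>)"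
        using w by (intro eventually_cell_eq[OF h lim]) auto
      then have "\<forall>\<^sub>F n in sequentially. indicator ?C (Y n \<omega>) = (indicator ?C (Z \<omega>) :: real)"
        by eventually_elim (simp add: indicator_def)
      then show "(\<lambda>n. indicator ?C (Y n \<omega>)) \<longlonglongrightarrow> (indicator ?C (Z \<omega>) :: real)"
        by (rule tendsto_eventually)
    qed
  qed auto
  have ind: "(\<integral>\<omega>. indicator ?C (W \<omega>) \<partial>\<Omega>) = measure (distr \<Omega> borel W) ?C"
    if "W \<in> borel_measurable \<Omega>" for W
  proof -
    have "measure (distr \<Omega> borel W) ?C = (\<integral>\<beta>. indicator ?C \<beta> \<partial>distr \<Omega> borel W)" by simp
    also have "\<dots> = (\<integral>\<omega>. indicator ?C (W \<omega>) \<partial>\<Omega>)" using that by (intro integral_distr) auto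
    finally show ?thesis by simp
  qed
  have "(\<lambda>n. ?X (r (q n))) \<longlonglongrightarrow> ?L"
    using conv unfolding ind[OF Y] ind[OF Z] lawY lawZ .
  then have "\<forall>\<^sub>F n in sequentially. dist (?X (r (q n))) ?L < e"
    using e unfolding tendsto_iff by blast
  then show False using far by simp
qed

text \<open>A bad offset is an atom of a coordinate law minus a multiple of \<open>h\<close>, and
  each coordinate law has countably many atoms. Atoms do occur for degenerate Gaussians, for
  instance over an alphabet with one letter, so a good offset has to be chosen.\<close>

lemma countable_bad_offsets:
  fixes M :: "(real ^ 'd::finite) measure"
  assumes M: "prob_space M" "sets M = sets borel"
  shows "countable {a. \<exists>x. \<exists>k::int. measure M {\<beta>. \<beta> $ x = a + of_int k * h} \<noteq> 0}"
proof -
  have sp: "space M = UNIV" using sets_eq_imp_space_eq[OF M(2)] by simp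
  have m: "(\<lambda>\<beta>. \<beta> $ x) \<in> borel_measurable M" for x
    unfolding measurable_cong_sets[OF M(2) refl] by measurable
  define A where "A x = {v. measure (distr M borel (\<lambda>\<beta>. \<beta> $ x)) {v} > 0}" for x
  have "countable (A x)" for x
  proof -
    interpret real_distribution "distr M borel (\<lambda>\<beta>. \<beta> $ x)"
      by (rule prob_space.real_distribution_distr[OF M(1) m])
    show ?thesis unfolding A_def by (rule countable_atoms)
  qed
  then have "countable (\<Union>x. \<Union>k::int. (\<lambda>v. v - of_int k * h) ` A x)" by auto
  moreover have "{a. \<exists>x. \<exists>k::int. measure M {\<beta>. \<beta> $ x = a + of_int k * h} \<noteq> 0}
      \<subseteq> (\<Union>x. \<Union>k::int. (\<lambda>v. v - of_int k * h) ` A x)"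
  proof
    fix a assume "a \<in> {a. \<exists>x. \<exists>k::int. measure M {\<beta>. \<beta> $ x = a + of_int k * h} \<noteq> 0}"
    then obtain x and k :: int where xk: "measure M {\<beta>. \<beta> $ x = a + of_int k * h} \<noteq> 0" by blast
    have "measure (distr M borel (\<lambda>\<beta>. \<beta> $ x)) {a + of_int k * h} = measure M {\<beta>. \<beta> $ x = a + of_int k * h}"
      using m by (subst measure_distr) (auto simp: vimage_def sp)
    then have "a + of_int k * h \<in> A x" using xk by (simp add: A_def less_le)
    then show "a \<in> (\<Union>x. \<Union>k::int. (\<lambda>v. v - of_int k * h) ` A x)" by force
  qed
  ultimately show ?thesis by (rule countable_subset[rotated])
qed

lemma ex_norm_bound:
  fixes M :: "(real ^ 'd::finite) measure"
  assumes "prob_space M" "sets M = sets borel" "0 < e"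
  obtains K where "measure M {\<beta>. K < norm \<beta>} < e"
proof -
  interpret prob_space M by fact
  have sp: "space M = UNIV" using sets_eq_imp_space_eq[OF assms(2)] by simp
  have m: "{\<beta>. real n < norm \<beta>} \<in> sets M" for n
    unfolding assms(2) by (intro borel_open open_Collect_less continuous_intros)
  have "(\<lambda>n. prob {\<beta>. real n < norm \<beta>}) \<longlonglongrightarrow> prob (\<Inter>n. {\<beta>. real n < norm \<beta>})"
    using m by (intro finite_Lim_measure_decseq) (auto simp: decseq_def)
  also have "(\<Inter>n. {\<beta> :: real ^ 'd. real n < norm \<beta>}) = {}"
  proof -
    have "\<exists>n. \<not> real n < norm \<beta>" for \<beta> :: "real ^ 'd"
      using real_arch_simple[of "norm \<beta>"] by (simp add: not_less)
    then show ?thesis by blast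
  qed
  finally have "\<forall>\<^sub>F n in sequentially. prob {\<beta>. real n < norm \<beta>} < e"
    using assms(3) by (intro order_tendstoD) auto
  then show ?thesis using that by (auto dest!: eventually_happens)
qed

text \<open>Turns the law of the cell labels into a pmf, to which gluing and perturbation
  apply.\<close>

lemma ex_pmf_of_finite_range:
  assumes M: "prob_space M" and fin: "finite F" and range: "\<And>\<omega>. \<omega> \<in> space M \<Longrightarrow> f \<omega> \<in> F"
    and meas: "\<And>i. f -` {i} \<inter> space M \<in> sets M"
  obtains A where "\<And>E. measure_pmf.prob A E = measure M (f -` E \<inter> space M)"
proof -
  interpret prob_space M by fact
  have f: "f \<in> M \<rightarrow>\<^sub>M count_space UNIV"
  proof (rule measurableI)
    fix E
    have "f -` E \<inter> space M = (\<Union>i\<in>E \<inter> F. f -` {i} \<inter> space M)" using range by auto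
    also have "\<dots> \<in> sets M" using fin meas by (intro sets.finite_UN) auto
    finally show "f -` E \<inter> space M \<in> sets M" .
  qed simp
  define D where "D = distr M (count_space UNIV) f"
  interpret D: prob_space D unfolding D_def by (rule prob_space_distr[OF f])
  have sets_D: "sets D = UNIV" by (simp add: D_def)
  have "AE x in D. x \<in> F"
    unfolding D_def using f range by (subst AE_distr_iff) auto
  moreover have "AE x in D. \<forall>i\<in>F. x = i \<longrightarrow> measure D {i} \<noteq> 0"
  proof (subst AE_finite_all[OF fin], intro ballI)
    fix i
    show "AE x in D. x = i \<longrightarrow> measure D {i} \<noteq> 0"
    proof (cases "measure D {i} = 0")
      case True
      then have "{i} \<in> null_sets D" using sets_D by (auto simp: null_sets_def D.emeasure_eq_measure)
      then show ?thesis by (rule AE_I') auto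
    qed simp
  qed
  ultimately have "AE x in D. measure D {x} \<noteq> 0" by eventually_elim auto
  then have "measure_pmf (Abs_pmf D) = D"
    using sets_D D.prob_space_axioms by (intro Abs_pmf_inverse) auto
  then have "measure_pmf.prob (Abs_pmf D) E = measure M (f -` E \<inter> space M)" for E
    using f by (simp add: D_def measure_distr)
  then show ?thesis by (rule that)
qed

text \<open>For cells of positive Gaussian mass the inequality is strict in the limit, for null
  cells it is trivial, and only finitely many labels occur.\<close>

lemma eventually_cell_mass:
  fixes P :: "'d::finite pmf"
  assumes h: "0 < h" and N: "0 \<le> N" and e: "0 < e"
    and null: "\<And>x (k::int). measure (centered_gaussian (cov_matrix P)) {\<beta>. \<beta> $ x = a + of_int k * h} = 0"
    and A: "\<And>i. pmf A i = measure (centered_gaussian (cov_matrix P)) {\<beta>. cell a h N \<beta> = i}"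
  shows "\<forall>\<^sub>F n in sequentially. \<forall>i. (1 - e) * pmf A i
    \<le> pmf (map_pmf (\<lambda>x. cell a h N (fluct P n x)) (iid_pmf n P)) i"
proof -
  let ?F = "UNIV \<rightarrow>\<^sub>E {- N..N} :: ('d \<Rightarrow> int) set"
  have q: "pmf (map_pmf (\<lambda>x. cell a h N (fluct P n x)) (iid_pmf n P)) i
      = measure (fluct_law P n) {\<beta>. cell a h N \<beta> = i}" for n i
    unfolding fluct_law_def by (subst measure_distr) (auto simp: pmf_map vimage_def)
  have "\<forall>\<^sub>F n in sequentially. (1 - e) * pmf A i
    \<le> pmf (map_pmf (\<lambda>x. cell a h N (fluct P n x)) (iid_pmf n P)) i" for i
  proof (cases "pmf A i = 0")
    case False
    then have "(1 - e) * pmf A i < pmf A i" using e by (simp add: less_le)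
    with fluct_law_cell_limit[OF h null, of N i]
    have "\<forall>\<^sub>F n in sequentially. (1 - e) * pmf A i < measure (fluct_law P n) {\<beta>. cell a h N \<beta> = i}"
      unfolding A by (rule order_tendstoD(1))
    then show ?thesis unfolding q by eventually_elim simp
  qed simp
  then have ev: "\<forall>\<^sub>F n in sequentially. \<forall>i\<in>?F. (1 - e) * pmf A i
    \<le> pmf (map_pmf (\<lambda>x. cell a h N (fluct P n x)) (iid_pmf n P)) i"
    by (simp add: eventually_ball_finite finite_cells)
  have zero: "pmf A i = 0" if "i \<notin> ?F" for i
  proof -
    have "{\<beta> :: real ^ 'd. cell a h N \<beta> = i} = {}" using that cell_in_cells[OF N] by blast
    then show ?thesis unfolding A by simp
  qed
  from ev show ?thesis
  proof eventually_elim
    case (elim n)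
    show ?case
    proof
      fix i
      show "(1 - e) * pmf A i \<le> pmf (map_pmf (\<lambda>x. cell a h N (fluct P n x)) (iid_pmf n P)) i"
        using elim zero[of i] by (cases "i \<in> ?F") auto
    qed
  qed
qed

text \<open>A label without clamped coordinates describes a true cube of side \<open>h\<close>; as
  both vectors share the label, a condition on one is enough. Norms are bounded by sums over
  coordinates.\<close>

lemma cell_interior_bounds:
  fixes \<beta> \<gamma> :: "real ^ 'd::finite" and h :: real
  assumes h: "0 < h" and N: "0 \<le> N" and same: "cell a h N \<beta> = cell a h N \<gamma>"
    and int: "\<And>x. \<bar>cell a h N \<beta> x\<bar> \<noteq> N"
  shows "norm (\<beta> - \<gamma>) \<le> CARD('d) * h" "norm \<beta> \<le> CARD('d) * (\<bar>a\<bar> + (real_of_int N + 1) * h)"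
proof -
  have fl: "\<lfloor>(\<beta> $ x - a) / h\<rfloor> = \<lfloor>(\<gamma> $ x - a) / h\<rfloor> \<and> \<bar>\<lfloor>(\<beta> $ x - a) / h\<rfloor>\<bar> \<le> N" for x
  proof -
    have "p = q \<and> \<bar>p\<bar> \<le> N" if "\<bar>max (- N) (min N p)\<bar> \<noteq> N" "max (- N) (min N p) = max (- N) (min N q)" for p q
      using that N by linarith
    from this[of "\<lfloor>(\<beta> $ x - a) / h\<rfloor>" "\<lfloor>(\<gamma> $ x - a) / h\<rfloor>"] show ?thesis
      using int[of x] fun_cong[OF same, of x] unfolding cell_def by blast
  qed
  have b: "\<bar>\<beta> $ x - \<gamma> $ x\<bar> \<le> h \<and> \<bar>\<beta> $ x\<bar> \<le> \<bar>a\<bar> + (real_of_int N + 1) * h" for x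
  proof -
    define f where "f = \<lfloor>(\<beta> $ x - a) / h\<rfloor>"
    have "real_of_int f \<le> (\<beta> $ x - a) / h" "(\<beta> $ x - a) / h < real_of_int f + 1"
      "real_of_int f \<le> (\<gamma> $ x - a) / h" "(\<gamma> $ x - a) / h < real_of_int f + 1"
      using fl[of x] unfolding f_def by linarith+
    then have k: "real_of_int f * h \<le> \<beta> $ x - a" "\<beta> $ x - a < real_of_int f * h + h"
      "real_of_int f * h \<le> \<gamma> $ x - a" "\<gamma> $ x - a < real_of_int f * h + h"
      using h by (simp_all add: field_simps)
    have "\<bar>real_of_int f\<bar> \<le> real_of_int N" using fl[of x] unfolding f_def by linarith
    then have "\<bar>real_of_int f * h\<bar> \<le> real_of_int N * h"
      using h by (simp add: abs_mult mult_right_mono)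
    then have "\<bar>\<beta> $ x\<bar> \<le> \<bar>a\<bar> + (real_of_int N * h + h)" using k(1,2) by linarith
    then show ?thesis using k by (auto simp: distrib_right)
  qed
  have "norm (\<beta> - \<gamma>) \<le> (\<Sum>x\<in>UNIV. \<bar>(\<beta> - \<gamma>) $ x\<bar>)" by (rule norm_le_l1_cart)
  also have "\<dots> \<le> (\<Sum>x\<in>(UNIV :: 'd set). h)" using b by (intro sum_mono) auto
  finally show "norm (\<beta> - \<gamma>) \<le> CARD('d) * h" by simp
  have "norm \<beta> \<le> (\<Sum>x\<in>UNIV. \<bar>\<beta> $ x\<bar>)" by (rule norm_le_l1_cart)
  also have "\<dots> \<le> (\<Sum>x\<in>(UNIV :: 'd set). \<bar>a\<bar> + (real_of_int N + 1) * h)" using b by (intro sum_mono) auto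
  finally show "norm \<beta> \<le> CARD('d) * (\<bar>a\<bar> + (real_of_int N + 1) * h)" by simp
qed

text \<open>The added 1 in the bound on \<open>N\<close> pays for the floor, which can exceed its
  argument in absolute value by up to 1.\<close>

lemma cell_interior:
  fixes \<beta> :: "real ^ 'd::finite"
  assumes h: "0 < h" and \<beta>: "norm \<beta> \<le> K" and N: "(K + \<bar>a\<bar>) / h + 1 < real_of_int N"
  shows "\<bar>cell a h N \<beta> x\<bar> \<noteq> N"
proof -
  have "\<bar>\<beta> $ x - a\<bar> \<le> K + \<bar>a\<bar>" using component_le_norm_cart[of \<beta> x] \<beta> by linarith
  then have "\<bar>(\<beta> $ x - a) / h\<bar> \<le> (K + \<bar>a\<bar>) / h" using h by (simp add: divide_right_mono)
  then have "\<bar>\<lfloor>(\<beta> $ x - a) / h\<rfloor>\<bar> < N" using N by linarith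
  then show ?thesis unfolding cell_def by linarith
qed

section \<open>The upper bound\<close>

lemma measure_centered_gaussian_Int_zero_sum:
  assumes "C \<in> sets borel"
  shows "measure (centered_gaussian (cov_matrix P)) (C \<inter> zero_sum) = measure (centered_gaussian (cov_matrix P)) C"
proof -
  interpret prob_space "centered_gaussian (cov_matrix P)" by (rule prob_space_centered_gaussian)
  show ?thesis
    using centered_gaussian_zero_sum[of P] assms by (intro finite_measure_eq_AE) auto
qed

lemma measure_Phi:
  assumes "C \<in> sets borel"
  shows "measure (Phi P) (C \<inter> zero_sum) = measure (centered_gaussian (cov_matrix P)) C"
proof -
  have "C \<inter> zero_sum \<in> sets (Phi P)"
    unfolding sets_Phi using assms by (subst sets_restrict_space_iff) auto
  then show ?thesis
    using measure_centered_gaussian_Int_zero_sum[OF assms, of P] by (simp add: measure_def emeasure_Phi)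
qed

lemma measure_Phi_marginal:
  assumes X: "X \<in> \<Psi> \<rightarrow>\<^sub>M Phi P" "distr \<Psi> (Phi P) X = Phi P" and C: "C \<in> sets borel"
  shows "X -` C \<inter> space \<Psi> \<in> sets \<Psi>"
    "measure \<Psi> (X -` C \<inter> space \<Psi>) = measure (centered_gaussian (cov_matrix P)) C"
proof -
  show "X -` C \<inter> space \<Psi> \<in> sets \<Psi>"
    using measurable_sets[OF measurable_compose[OF X(1) Phi_measurable_id] C] .
  have "C \<inter> zero_sum \<in> sets (Phi P)"
    unfolding sets_Phi using C by (subst sets_restrict_space_iff) auto
  with X(1) have "measure (distr \<Psi> (Phi P) X) (C \<inter> zero_sum) = measure \<Psi> (X -` (C \<inter> zero_sum) \<inter> space \<Psi>)"
    by (rule measure_distr)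
  also have "X -` (C \<inter> zero_sum) \<inter> space \<Psi> = X -` C \<inter> space \<Psi>"
    using measurable_space[OF X(1)] by auto
  finally show "measure \<Psi> (X -` C \<inter> space \<Psi>) = measure (centered_gaussian (cov_matrix P)) C"
    unfolding X(2) measure_Phi[OF C] by simp
qed

context finite_ot
begin

text \<open>One half of \<open>d\<close> pays for the choice of a near-minimizer, the other for the
  rounding error of order \<open>1 / sqrt n\<close>. The uniform bound \<open>M\<close> lets one
  threshold for \<open>n\<close> serve all words.\<close>

lemma ex_bounded_rearrangement:
  fixes K d :: real
  assumes d: "0 < d"
  shows "\<forall>\<^sub>F n in sequentially. \<forall>x y. norm (fluct PX n x) \<le> K \<longrightarrow> norm (fluct PY n y) \<le> K \<longrightarrow>
    (\<exists>\<sigma>. \<sigma> permutes {..<n} \<and> avg_cost c n x (y \<circ> \<sigma>)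
      \<le> cost p + (theta c S (fluct PX n x) (fluct PY n y) + d) / sqrt n)"
proof -
  obtain M where M: "\<And>\<beta>X \<beta>Y. \<lbrakk>\<beta>X \<in> zero_sum; \<beta>Y \<in> zero_sum; norm \<beta>X \<le> K; norm \<beta>Y \<le> K\<rbrakk>
    \<Longrightarrow> \<exists>B\<in>feasible \<beta>X \<beta>Y. cost B \<le> theta c S \<beta>X \<beta>Y + d / 2 \<and> (\<forall>z. \<bar>B $ z\<bar> \<le> M)"
    using uniformly_bounded_minimizers[of "d / 2" K] d by auto
  obtain \<delta> where \<delta>: "0 < \<delta>" "\<And>z. z \<in> S \<Longrightarrow> \<delta> \<le> p $ z" using p_min by blast
  define D where "D = (\<Sum>z\<in>UNIV. c (fst z) (snd z))"
  have D: "c a b \<le> D" for a b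
    unfolding D_def using member_le_sum[of "(a, b)" UNIV "\<lambda>z. c (fst z) (snd z)"] cost_nonneg by simp
  have sq: "filterlim (\<lambda>n. sqrt (real n)) at_top sequentially"
    by (intro filterlim_compose[OF sqrt_at_top] filterlim_real_sequentially)
  have "\<forall>\<^sub>F n in sequentially. M / \<delta> \<le> sqrt (real n)"
    using sq unfolding filterlim_at_top by blast
  moreover have "\<forall>\<^sub>F n in sequentially. real CARD('a \<times> 'b) * D / (d / 2) \<le> sqrt (real n)"
    using sq unfolding filterlim_at_top by blast
  ultimately show ?thesis using eventually_gt_at_top[of "0::nat"]
  proof eventually_elim
    case (elim n)
    have sn: "0 < sqrt (real n)" using elim by simp
    show ?case
    proof (intro allI impI)
      fix x y assume xy: "norm (fluct PX n x) \<le> K" "norm (fluct PY n y) \<le> K"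
      obtain B where B: "B \<in> feasible (fluct PX n x) (fluct PY n y)"
        "cost B \<le> theta c S (fluct PX n x) (fluct PY n y) + d / 2" "\<And>z. \<bar>B $ z\<bar> \<le> M"
        using M[OF fluct_in_zero_sum fluct_in_zero_sum xy] by blast
      have "M \<le> \<delta> * sqrt n" using elim(1) \<delta>(1) by (simp add: divide_le_eq mult.commute)
      then have "\<bar>B $ z\<bar> \<le> \<delta> * sqrt n" for z using B(3)[of z] by linarith
      then obtain \<sigma> where \<sigma>: "\<sigma> permutes {..<n}"
        "sqrt n * (avg_cost c n x (y \<circ> \<sigma>) - cost p) \<le> cost B + real CARD('a \<times> 'b) * D / sqrt n"
        using ex_permutation_excess[OF elim(3) D \<delta>(2) B(1)] by blast
      have "real CARD('a \<times> 'b) * D / sqrt n \<le> d / 2"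
        using elim(2) d sn by (simp add: field_simps)
      then have "sqrt n * (avg_cost c n x (y \<circ> \<sigma>) - cost p) \<le> theta c S (fluct PX n x) (fluct PY n y) + d"
        using \<sigma>(2) B(2) by linarith
      then have "avg_cost c n x (y \<circ> \<sigma>) - cost p \<le> (theta c S (fluct PX n x) (fluct PY n y) + d) / sqrt n"
        using sn by (simp add: le_divide_eq mult.commute)
      then show "\<exists>\<sigma>. \<sigma> permutes {..<n} \<and> avg_cost c n x (y \<circ> \<sigma>)
          \<le> cost p + (theta c S (fluct PX n x) (fluct PY n y) + d) / sqrt n"
        using \<sigma>(1) by (intro exI[of _ \<sigma>]) linarith
    qed
  qed
qed

text \<open>The three \<open>e\<close> are the two Gaussian tails outside the bounded cells and the
  perturbation of the discretized coupling. The gap between \<open>\<Delta>'\<close> and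
  \<open>\<Delta>\<close> is spent in two halves \<open>d\<close>: on the oscillation of
  \<open>theta\<close> inside a cell and on the rearrangement of the words.\<close>

lemma eventually_excess_le:
  assumes \<Psi>: "\<Psi> \<in> couplings (Phi PX) (Phi PY)" and \<Delta>: "\<Delta>' < \<Delta>" and e: "0 < e" "e \<le> 1"
  shows "\<forall>\<^sub>F n in sequentially. excess_prob c PX PY n (cost p + \<Delta> / sqrt (real n))
    \<le> measure \<Psi> (excess_set \<Delta>') + 3 * e"
proof -
  let ?GX = "centered_gaussian (cov_matrix PX)" and ?GY = "centered_gaussian (cov_matrix PY)"
  interpret \<Psi>: prob_space \<Psi> by (rule couplingsD(1)[OF \<Psi>])
  note margX = measure_Phi_marginal[OF couplingsD(6,4)[OF \<Psi>]]
    and margY = measure_Phi_marginal[OF couplingsD(7,5)[OF \<Psi>]]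
  have sp: "space \<Psi> = zero_sum \<times> zero_sum" using couplingsD(3)[OF \<Psi>] by simp
  define d where "d = (\<Delta> - \<Delta>') / 2"
  have d: "0 < d" using \<Delta> by (simp add: d_def)
  obtain L where L: "0 \<le> L" "\<And>\<beta>X \<beta>Y \<gamma>X \<gamma>Y. \<lbrakk>\<beta>X \<in> zero_sum; \<beta>Y \<in> zero_sum; \<gamma>X \<in> zero_sum; \<gamma>Y \<in> zero_sum\<rbrakk>
    \<Longrightarrow> theta c S \<beta>X \<beta>Y \<le> theta c S \<gamma>X \<gamma>Y + L * (norm (\<beta>X - \<gamma>X) + norm (\<beta>Y - \<gamma>Y))"
    by (fact theta_lipschitz)
  define m where "m = real CARD('a) + real CARD('b)"
  have m: "0 < m" unfolding m_def by (intro add_pos_pos) simp_all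
  \<comment> \<open>Small enough that the Lipschitz bound over a pair of cells,
    \<open>L * (m * h)\<close>, is at most \<open>d\<close>; the 1 covers
    \<open>L = 0\<close>.\<close>
  define h where "h = d / ((L + 1) * m)"
  have h: "0 < h" using d m L(1) by (simp add: h_def)
  have "L * (m * h) \<le> (L + 1) * (m * h)" using m h by (intro mult_right_mono) auto
  also have "\<dots> = d" using m L(1) by (simp add: h_def)
  finally have Lh: "L * (m * h) \<le> d" .
  \<comment> \<open>Removing countably many offsets from the real line leaves an \<open>a\<close>
    whose grid hyperplanes are all null for both Gaussians.\<close>
  have "countable ({a. \<exists>x. \<exists>k::int. measure ?GX {\<beta>. \<beta> $ x = a + of_int k * h} \<noteq> 0}
      \<union> {a. \<exists>x. \<exists>k::int. measure ?GY {\<beta>. \<beta> $ x = a + of_int k * h} \<noteq> 0})" (is "countable ?Off")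
    by (intro countable_Un countable_bad_offsets prob_space_centered_gaussian) simp_all
  then have "?Off \<noteq> UNIV" using uncountable_UNIV_real by metis
  then obtain a where "a \<notin> ?Off" by blast
  then have nullX: "\<And>x (k::int). measure ?GX {\<beta>. \<beta> $ x = a + of_int k * h} = 0"
    and nullY: "\<And>x (k::int). measure ?GY {\<beta>. \<beta> $ x = a + of_int k * h} = 0" by auto
  obtain KX where KX: "measure ?GX {\<beta>. KX < norm \<beta>} < e"
    using ex_norm_bound[OF prob_space_centered_gaussian _ e(1)] by (metis sets_centered_gaussian)
  obtain KY where KY: "measure ?GY {\<beta>. KY < norm \<beta>} < e"
    using ex_norm_bound[OF prob_space_centered_gaussian _ e(1)] by (metis sets_centered_gaussian)
  \<comment> \<open>Large enough that vectors of norm at most \<open>KX\<close> or \<open>KY\<close>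
    have unclamped labels.\<close>
  define N where "N = max 0 (max \<lceil>(KX + \<bar>a\<bar>) / h + 1\<rceil> \<lceil>(KY + \<bar>a\<bar>) / h + 1\<rceil> + 1)"
  have N: "0 \<le> N" "(KX + \<bar>a\<bar>) / h + 1 < real_of_int N" "(KY + \<bar>a\<bar>) / h + 1 < real_of_int N"
    unfolding N_def by linarith+
  define \<kappa>X where "\<kappa>X = (cell a h N :: real ^ 'a \<Rightarrow> _)"
  define \<kappa>Y where "\<kappa>Y = (cell a h N :: real ^ 'b \<Rightarrow> _)"
  have \<kappa>_borel: "{\<beta>. \<kappa>X \<beta> = i} \<in> sets borel" "{\<beta>. \<kappa>Y \<beta> = j} \<in> sets borel" for i j
    unfolding \<kappa>X_def \<kappa>Y_def by (rule cell_borel)+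
  obtain A where A: "\<And>E. measure_pmf.prob A E = measure \<Psi> (map_prod \<kappa>X \<kappa>Y -` E \<inter> space \<Psi>)"
  proof (rule ex_pmf_of_finite_range[OF \<Psi>.prob_space_axioms, of "(UNIV \<rightarrow>\<^sub>E {- N..N}) \<times> (UNIV \<rightarrow>\<^sub>E {- N..N})" "map_prod \<kappa>X \<kappa>Y"])
    show "finite ((UNIV \<rightarrow>\<^sub>E {- N..N}) \<times> (UNIV \<rightarrow>\<^sub>E {- N..N}) :: (('a \<Rightarrow> int) \<times> ('b \<Rightarrow> int)) set)"
      by (intro finite_cartesian_product finite_cells)
    show "map_prod \<kappa>X \<kappa>Y \<beta> \<in> (UNIV \<rightarrow>\<^sub>E {- N..N}) \<times> (UNIV \<rightarrow>\<^sub>E {- N..N})" for \<beta>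
      unfolding \<kappa>X_def \<kappa>Y_def mem_Times_iff by (simp only: fst_map_prod snd_map_prod cell_in_cells[OF N(1)] simp_thms)
    show "map_prod \<kappa>X \<kappa>Y -` {i} \<inter> space \<Psi> \<in> sets \<Psi>" for i
    proof -
      have "map_prod \<kappa>X \<kappa>Y -` {i} \<inter> space \<Psi>
        = (fst -` {\<beta>. \<kappa>X \<beta> = fst i} \<inter> space \<Psi>) \<inter> (snd -` {\<beta>. \<kappa>Y \<beta> = snd i} \<inter> space \<Psi>)"
        by (auto simp: map_prod_def)
      also have "\<dots> \<in> sets \<Psi>" by (intro sets.Int margX(1) margY(1) \<kappa>_borel)
      finally show ?thesis .
    qed
  qed blast
  have pA1: "pmf (map_pmf fst A) i = measure ?GX {\<beta>. \<kappa>X \<beta> = i}" for i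
  proof -
    have "map_prod \<kappa>X \<kappa>Y -` (fst -` {i}) \<inter> space \<Psi> = fst -` {\<beta>. \<kappa>X \<beta> = i} \<inter> space \<Psi>" by auto
    then show ?thesis unfolding pmf_map A using margX(2)[OF \<kappa>_borel(1)] by (simp only:)
  qed
  have pA2: "pmf (map_pmf snd A) j = measure ?GY {\<beta>. \<kappa>Y \<beta> = j}" for j
  proof -
    have "map_prod \<kappa>X \<kappa>Y -` (snd -` {j}) \<inter> space \<Psi> = snd -` {\<beta>. \<kappa>Y \<beta> = j} \<inter> space \<Psi>" by auto
    then show ?thesis unfolding pmf_map A using margY(2)[OF \<kappa>_borel(2)] by (simp only:)
  qed
  \<comment> \<open>Pairs of bounded cells that contain some pair of zero-sum vectors with
    \<open>theta\<close> at most \<open>\<Delta>'\<close>. One witness suffices, because the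
    Lipschitz bound spreads the estimate over both cells.\<close>
  define Good where "Good = {(i, j). (\<forall>x. \<bar>i x\<bar> \<noteq> N) \<and> (\<forall>y. \<bar>j y\<bar> \<noteq> N) \<and>
    (\<exists>\<gamma>X\<in>zero_sum. \<exists>\<gamma>Y\<in>zero_sum. \<kappa>X \<gamma>X = i \<and> \<kappa>Y \<gamma>Y = j \<and> theta c S \<gamma>X \<gamma>Y \<le> \<Delta>')}"
  have bad: "measure_pmf.prob A (- Good) \<le> measure \<Psi> (excess_set \<Delta>') + 2 * e"
  proof -
    let ?TX = "fst -` {\<beta>. KX < norm \<beta>} \<inter> space \<Psi>" and ?TY = "snd -` {\<beta>. KY < norm \<beta>} \<inter> space \<Psi>"
    have bX: "{\<beta> :: real ^ 'a. KX < norm \<beta>} \<in> sets borel" and bY: "{\<beta> :: real ^ 'b. KY < norm \<beta>} \<in> sets borel"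
      by (intro borel_open open_Collect_less continuous_intros)+
    have T: "?TX \<in> sets \<Psi>" "?TY \<in> sets \<Psi>" "excess_set \<Delta>' \<in> sets \<Psi>"
      using margX(1)[OF bX] margY(1)[OF bY] Phi_coupling_to_borel(3)[OF \<Psi>] by blast+
    have "map_prod \<kappa>X \<kappa>Y -` (- Good) \<inter> space \<Psi> \<subseteq> excess_set \<Delta>' \<union> (?TX \<union> ?TY)"
    proof
      fix \<beta> assume \<beta>: "\<beta> \<in> map_prod \<kappa>X \<kappa>Y -` (- Good) \<inter> space \<Psi>"
      then have zs: "fst \<beta> \<in> zero_sum" "snd \<beta> \<in> zero_sum" unfolding sp by auto
      show "\<beta> \<in> excess_set \<Delta>' \<union> (?TX \<union> ?TY)"
      proof (rule ccontr)
        assume no: "\<beta> \<notin> excess_set \<Delta>' \<union> (?TX \<union> ?TY)"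
        then have n: "norm (fst \<beta>) \<le> KX" "norm (snd \<beta>) \<le> KY" "theta c S (fst \<beta>) (snd \<beta>) \<le> \<Delta>'"
          using \<beta> zs by (auto simp: excess_set_def not_less)
        have "\<forall>x. \<bar>\<kappa>X (fst \<beta>) x\<bar> \<noteq> N" "\<forall>y. \<bar>\<kappa>Y (snd \<beta>) y\<bar> \<noteq> N"
          unfolding \<kappa>X_def \<kappa>Y_def using cell_interior[OF h n(1) N(2)] cell_interior[OF h n(2) N(3)] by blast+
        then have "(\<kappa>X (fst \<beta>), \<kappa>Y (snd \<beta>)) \<in> Good" unfolding Good_def using zs n(3) by blast
        then show False using \<beta> by (simp add: map_prod_def case_prod_unfold)
      qed
    qed
    then have "measure_pmf.prob A (- Good) \<le> measure \<Psi> (excess_set \<Delta>' \<union> (?TX \<union> ?TY))"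
      unfolding A using T by (intro \<Psi>.finite_measure_mono) auto
    also have "\<dots> \<le> measure \<Psi> (excess_set \<Delta>') + (measure \<Psi> ?TX + measure \<Psi> ?TY)"
      using T by (intro order_trans[OF measure_Un_le] add_left_mono measure_Un_le) auto
    also have "\<dots> \<le> measure \<Psi> (excess_set \<Delta>') + 2 * e"
      using KX KY unfolding margX(2)[OF bX] margY(2)[OF bY] by linarith
    finally show ?thesis .
  qed
  define K where "K = max (CARD('a) * (\<bar>a\<bar> + (real_of_int N + 1) * h)) (CARD('b) * (\<bar>a\<bar> + (real_of_int N + 1) * h))"
  have evX: "\<forall>\<^sub>F n in sequentially. \<forall>i. (1 - e) * pmf (map_pmf fst A) i
      \<le> pmf (map_pmf (\<lambda>x. \<kappa>X (fluct PX n x)) (iid_pmf n PX)) i"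
    unfolding \<kappa>X_def by (rule eventually_cell_mass[OF h N(1) e(1) nullX pA1[unfolded \<kappa>X_def]])
  have evY: "\<forall>\<^sub>F n in sequentially. \<forall>j. (1 - e) * pmf (map_pmf snd A) j
      \<le> pmf (map_pmf (\<lambda>y. \<kappa>Y (fluct PY n y)) (iid_pmf n PY)) j"
    unfolding \<kappa>Y_def by (rule eventually_cell_mass[OF h N(1) e(1) nullY pA2[unfolded \<kappa>Y_def]])
  from evX evY ex_bounded_rearrangement[OF d, of K] eventually_gt_at_top[of "0::nat"]
  show ?thesis
  proof eventually_elim
    case (elim n)
    define kX where "kX x = \<kappa>X (fluct PX n x)" for x
    define kY where "kY y = \<kappa>Y (fluct PY n y)" for y
    obtain A' where A': "map_pmf fst A' = map_pmf kX (iid_pmf n PX)" "map_pmf snd A' = map_pmf kY (iid_pmf n PY)"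
      "\<And>E. measure_pmf.prob A' E \<le> measure_pmf.prob A E + e"
      using perturb_coupling[OF e elim(1)[rule_format] elim(2)[rule_format]] unfolding kX_def kY_def by blast
    obtain W where W: "map_pmf fst W = iid_pmf n PX" "map_pmf snd W = iid_pmf n PY" "map_pmf (map_prod kX kY) W = A'"
      using glue_coupling[OF A'(1,2)] by blast
    let ?ok = "\<lambda>x y \<sigma>. \<sigma> permutes {..<n} \<and> avg_cost c n x (y \<circ> \<sigma>) \<le> cost p + \<Delta> / sqrt n"
    have good: "\<exists>\<sigma>. ?ok x y \<sigma>" if xy: "(kX x, kY y) \<in> Good" for x y
    proof -
      let ?bX = "fluct PX n x" and ?bY = "fluct PY n y"
      obtain \<gamma>X \<gamma>Y where \<gamma>: "\<gamma>X \<in> zero_sum" "\<gamma>Y \<in> zero_sum" "cell a h N ?bX = cell a h N \<gamma>X"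
        "cell a h N ?bY = cell a h N \<gamma>Y" "theta c S \<gamma>X \<gamma>Y \<le> \<Delta>'"
        and int: "\<And>x'. \<bar>cell a h N ?bX x'\<bar> \<noteq> N" "\<And>y'. \<bar>cell a h N ?bY y'\<bar> \<noteq> N"
        using xy unfolding Good_def kX_def kY_def \<kappa>X_def \<kappa>Y_def by force
      note bX = cell_interior_bounds[OF h N(1) \<gamma>(3) int(1)] and bY = cell_interior_bounds[OF h N(1) \<gamma>(4) int(2)]
      have "theta c S ?bX ?bY \<le> theta c S \<gamma>X \<gamma>Y + L * (norm (?bX - \<gamma>X) + norm (?bY - \<gamma>Y))"
        by (rule L(2)[OF fluct_in_zero_sum fluct_in_zero_sum \<gamma>(1,2)])
      also have "L * (norm (?bX - \<gamma>X) + norm (?bY - \<gamma>Y)) \<le> L * (m * h)"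
        using bX(1) bY(1) L(1) unfolding m_def distrib_right by (intro mult_left_mono add_mono) auto
      finally have "theta c S ?bX ?bY \<le> theta c S \<gamma>X \<gamma>Y + L * (m * h)" by simp
      moreover have "\<Delta>' + d + d = \<Delta>" by (simp add: d_def field_simps)
      ultimately have th: "theta c S ?bX ?bY + d \<le> \<Delta>" using Lh \<gamma>(5) by linarith
      have "norm ?bX \<le> K" "norm ?bY \<le> K" using bX(2) bY(2) by (simp_all add: K_def)
      then obtain \<sigma> where \<sigma>: "\<sigma> permutes {..<n}"
        "avg_cost c n x (y \<circ> \<sigma>) \<le> cost p + (theta c S ?bX ?bY + d) / sqrt n"
        using elim(3) by blast
      have "(theta c S ?bX ?bY + d) / sqrt n \<le> \<Delta> / sqrt n" using th by (intro divide_right_mono) auto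
      then show ?thesis using \<sigma> by (intro exI[of _ \<sigma>]) linarith
    qed
    \<comment> \<open>Where no suitable permutation exists any permutation will do; only pairs with
      labels outside \<open>Good\<close> are affected, and their probability is already
      bounded.\<close>
    define \<sigma> where "\<sigma> x y = (if \<exists>\<sigma>. ?ok x y \<sigma> then SOME \<sigma>. ?ok x y \<sigma> else id)" for x y
    have perm: "\<sigma> x y permutes {..<n}" for x y
    proof (cases "\<exists>\<sigma>. ?ok x y \<sigma>")
      case True
      then show ?thesis using someI_ex[OF True] by (simp add: \<sigma>_def)
    qed (simp only: \<sigma>_def if_False permutes_id)
    have ok: "avg_cost c n x (y \<circ> \<sigma> x y) \<le> cost p + \<Delta> / sqrt n" if "(kX x, kY y) \<in> Good" for x y
      using someI_ex[OF good[OF that]] good[OF that] by (simp add: \<sigma>_def)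
    have "excess_prob c PX PY n (cost p + \<Delta> / sqrt n)
      \<le> measure_pmf.prob W {(x, y). avg_cost c n x (y \<circ> \<sigma> x y) > cost p + \<Delta> / sqrt n}"
      by (rule excess_prob_le_rearranged[OF W(1,2) perm])
    also have "\<dots> \<le> measure_pmf.prob W (map_prod kX kY -` (- Good))"
      using ok by (intro measure_pmf.finite_measure_mono) (auto simp: not_le[symmetric])
    also have "\<dots> = measure_pmf.prob A' (- Good)" unfolding W(3)[symmetric] by simp
    also have "\<dots> \<le> measure_pmf.prob A (- Good) + e" by (rule A'(3))
    also have "\<dots> \<le> measure \<Psi> (excess_set \<Delta>') + 3 * e" using bad by linarith
    finally show ?case .
  qed
qed

lemma limsup_le_Lambda:
  assumes \<Delta>: "\<Delta>' < \<Delta>"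
  shows "limsup (\<lambda>n. ereal (excess_prob c PX PY n (cost p + \<Delta> / sqrt (real n)))) \<le> ereal (Lambda c S PX PY \<Delta>')"
    (is "?l \<le> _")
proof (rule ereal_le_epsilon2)
  fix e :: real assume e: "0 < e"
  \<comment> \<open>The three errors together use half of \<open>e\<close>, near-optimality of
    \<open>\<Psi>\<close> the other half; the bound 1 is required of a mixing probability.\<close>
  define \<epsilon> where "\<epsilon> = min 1 (e / 6)"
  have \<epsilon>: "0 < \<epsilon>" "\<epsilon> \<le> 1" "3 * \<epsilon> \<le> e / 2" using e by (auto simp: \<epsilon>_def)
  obtain \<Psi> where \<Psi>: "\<Psi> \<in> couplings (Phi PX) (Phi PY)" "measure \<Psi> (excess_set \<Delta>') < Lambda c S PX PY \<Delta>' + e / 2"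
    using Lambda_approx[of \<Delta>' "Lambda c S PX PY \<Delta>' + e / 2"] e by auto
  have "\<forall>\<^sub>F n in sequentially. ereal (excess_prob c PX PY n (cost p + \<Delta> / sqrt (real n))) \<le> ereal (Lambda c S PX PY \<Delta>' + e)"
    using eventually_excess_le[OF \<Psi>(1) \<Delta> \<epsilon>(1,2)]
  proof eventually_elim
    case (elim n)
    then show ?case using \<Psi>(2) \<epsilon>(3) by simp
  qed
  then have "?l \<le> ereal (Lambda c S PX PY \<Delta>' + e)"
    by (rule Limsup_bounded)
  then show "?l \<le> ereal (Lambda c S PX PY \<Delta>') + ereal e"
    by simp
qed

text \<open>\<open>Lambda\<close> is antitone in its last argument, so the left limit exists and
  equals the infimum over all \<open>\<Delta>' < \<Delta>\<close>; a bound by each of these values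
  passes to the infimum.\<close>

lemma limsup_le_Lim_Lambda:
  "limsup (\<lambda>n. ereal (excess_prob c PX PY n (cost p + \<Delta> / sqrt (real n))))
    \<le> ereal (Lim (at_left \<Delta>) (\<lambda>\<Delta>'. Lambda c S PX PY \<Delta>'))"
    (is "?l \<le> _")
proof -
  let ?\<Lambda> = "\<lambda>\<Delta>'. Lambda c S PX PY \<Delta>'"
  define l where "l = (INF \<Delta>'\<in>{..<\<Delta>}. ?\<Lambda> \<Delta>')"
  have bdd: "bdd_below (?\<Lambda> ` {..<\<Delta>})" by (rule bdd_belowI2[where m=0]) (rule Lambda_nonneg)
  have below: "\<exists>\<Delta>'<\<Delta>. ?\<Lambda> \<Delta>' < b" if "l < b" for b
    using cInf_lessD[of "?\<Lambda> ` {..<\<Delta>}" b] that unfolding l_def by auto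
  have "(?\<Lambda> \<longlongrightarrow> l) (at_left \<Delta>)"
  proof (rule order_tendstoI)
    fix b assume "b < l"
    then have above: "b < ?\<Lambda> \<Delta>'" if "\<Delta>' < \<Delta>" for \<Delta>'
      using cINF_lower[OF bdd, of \<Delta>'] that unfolding l_def by simp
    show "\<forall>\<^sub>F \<Delta>' in at_left \<Delta>. b < ?\<Lambda> \<Delta>'"
      by (rule eventually_at_leftI[of "\<Delta> - 1"]) (simp_all add: above)
  next
    fix b assume "l < b"
    then obtain \<Delta>' where \<Delta>': "\<Delta>' < \<Delta>" "?\<Lambda> \<Delta>' < b" using below by blast
    have "?\<Lambda> x < b" if "\<Delta>' < x" for x using Lambda_antimono[of \<Delta>' x] that \<Delta>'(2) by simp
    then show "\<forall>\<^sub>F x in at_left \<Delta>. ?\<Lambda> x < b"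
      using \<Delta>'(1) by (intro eventually_at_leftI[of \<Delta>']) simp_all
  qed
  then have Lim: "Lim (at_left \<Delta>) ?\<Lambda> = l" by (intro tendsto_Lim) simp_all
  show ?thesis
    unfolding Lim
  proof (rule ereal_le_epsilon2)
    fix e :: real assume "0 < e"
    then obtain \<Delta>' where "\<Delta>' < \<Delta>" "?\<Lambda> \<Delta>' < l + e" using below[of "l + e"] by auto
    then show "?l \<le> ereal l + ereal e"
      using limsup_le_Lambda[OF \<open>\<Delta>' < \<Delta>\<close>] by (simp add: order_trans)
  qed
qed

end

section \<open>Couplings of finite distributions as weight vectors\<close>

lemma sets_pair_pmf_finite:
  "sets (measure_pmf (P :: 'a::finite pmf) \<Otimes>\<^sub>M measure_pmf (Q :: 'b::finite pmf)) = UNIV"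
proof -
  have "sets (measure_pmf P \<Otimes>\<^sub>M measure_pmf Q) = sets (count_space (UNIV :: 'a set) \<Otimes>\<^sub>M count_space (UNIV :: 'b set))"
    by (rule sets_pair_measure_cong) simp_all
  also have "\<dots> = UNIV" by (subst pair_measure_countable) (auto intro: countable_finite)
  finally show ?thesis .
qed

text \<open>All subsets are measurable here, so \<open>R\<close> is a pmf and the integral becomes a
  finite sum.\<close>

lemma transport_cost_finite:
  fixes P :: "'a::finite pmf" and Q :: "'b::finite pmf"
  assumes R: "R \<in> couplings (measure_pmf P) (measure_pmf Q)"
  shows "transport_cost c R = (\<Sum>(x, y)\<in>UNIV. measure R {(x, y)} * c x y)"
    "(\<Sum>y\<in>UNIV. measure R {(x, y)}) = pmf P x" "(\<Sum>x\<in>UNIV. measure R {(x, y)}) = pmf Q y"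
proof -
  note D = couplingsD[OF R]
  interpret prob_space R by (rule D(1))
  have sets: "sets R = UNIV" using D(2) by (simp add: sets_pair_pmf_finite)
  have space: "space R = UNIV" using D(3) by simp
  obtain W where W: "\<And>E. measure_pmf.prob W E = measure R ((\<lambda>z. z) -` E \<inter> space R)"
    by (rule ex_pmf_of_finite_range[OF D(1), of UNIV "\<lambda>z. z"]) (auto simp: sets)
  have "R = measure_pmf W"
    by (rule measure_eqI) (auto simp: sets W space emeasure_eq_measure measure_pmf.emeasure_eq_measure)
  then have "transport_cost c R = (\<Sum>z\<in>UNIV. c (fst z) (snd z) * pmf W z)"
    unfolding transport_cost_def by (simp add: integral_measure_pmf_real[of UNIV])
  also have "\<dots> = (\<Sum>(x, y)\<in>UNIV. measure R {(x, y)} * c x y)"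
    by (intro sum.cong refl) (simp add: case_prod_unfold measure_pmf_single[symmetric] W space mult.commute)
  finally show "transport_cost c R = (\<Sum>(x, y)\<in>UNIV. measure R {(x, y)} * c x y)" .
  have "(\<Sum>y\<in>UNIV. measure R {(x, y)}) = measure R (\<Union>y. {(x, y)})"
    by (rule finite_measure_finite_Union[symmetric]) (auto simp: sets disjoint_family_on_def)
  also have "(\<Union>y. {(x, y)}) = fst -` {x} \<inter> space R" by (auto simp: space)
  also have "measure R \<dots> = measure (distr R (measure_pmf P) fst) {x}"
    by (rule measure_distr[symmetric, OF D(6)]) simp
  finally show "(\<Sum>y\<in>UNIV. measure R {(x, y)}) = pmf P x" by (simp add: D(4) measure_pmf_single)
  have "(\<Sum>x\<in>UNIV. measure R {(x, y)}) = measure R (\<Union>x. {(x, y)})"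
    by (rule finite_measure_finite_Union[symmetric]) (auto simp: sets disjoint_family_on_def)
  also have "(\<Union>x. {(x, y)}) = snd -` {y} \<inter> space R" by (auto simp: space)
  also have "measure R \<dots> = measure (distr R (measure_pmf Q) snd) {y}"
    by (rule measure_distr[symmetric, OF D(7)]) simp
  finally show "(\<Sum>x\<in>UNIV. measure R {(x, y)}) = pmf Q y" by (simp add: D(5) measure_pmf_single)
qed

text \<open>The converse passage, which lets optimality of a measure be used against arbitrary
  weights.\<close>

lemma ex_coupling_of_weights:
  fixes P :: "'a::finite pmf" and Q :: "'b::finite pmf" and q :: "real ^ ('a \<times> 'b)"
  assumes nn: "\<And>z. 0 \<le> q $ z" and fst: "\<And>x. (\<Sum>y\<in>UNIV. q $ (x, y)) = pmf P x"
    and snd: "\<And>y. (\<Sum>x\<in>UNIV. q $ (x, y)) = pmf Q y"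
  obtains R where "R \<in> couplings (measure_pmf P) (measure_pmf Q)" "\<And>z. measure R {z} = q $ z"
proof
  define W where "W = embed_pmf (\<lambda>z. q $ z)"
  have "(\<Sum>z\<in>UNIV. q $ z) = (\<Sum>x\<in>UNIV. \<Sum>y\<in>UNIV. q $ (x, y))" by (simp add: sum.cartesian_product)
  also have "\<dots> = 1" unfolding fst by (rule sum_pmf_eq_1) auto
  finally have "(\<Sum>z\<in>UNIV. q $ z) = 1" .
  then have "(\<integral>\<^sup>+z. ennreal (q $ z) \<partial>count_space UNIV) = 1"
    using nn by (simp add: nn_integral_count_space_finite sum_ennreal)
  then have pW: "pmf W z = q $ z" for z unfolding W_def using nn by (intro pmf_embed_pmf)
  then show "measure (measure_pmf W) {z} = q $ z" for z by (simp add: measure_pmf_single)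
  have 1: "map_pmf fst W = P"
  proof (rule pmf_eqI)
    fix x :: 'a
    have "fst -` {x} = (\<lambda>y. (x, y)) ` (UNIV :: 'b set)" by auto
    then have "pmf (map_pmf fst W) x = (\<Sum>z\<in>(\<lambda>y. (x, y)) ` (UNIV :: 'b set). pmf W z)"
      by (simp add: pmf_map measure_measure_pmf_finite)
    then show "pmf (map_pmf fst W) x = pmf P x" by (simp add: sum.reindex inj_on_def pW fst)
  qed
  have 2: "map_pmf snd W = Q"
  proof (rule pmf_eqI)
    fix y :: 'b
    have "snd -` {y} = (\<lambda>x. (x, y)) ` (UNIV :: 'a set)" by auto
    then have "pmf (map_pmf snd W) y = (\<Sum>z\<in>(\<lambda>x. (x, y)) ` (UNIV :: 'a set). pmf W z)"
      by (simp add: pmf_map measure_measure_pmf_finite)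
    then show "pmf (map_pmf snd W) y = pmf Q y" by (simp add: sum.reindex inj_on_def pW snd)
  qed
  have "distr (measure_pmf W) (measure_pmf P) fst = distr (measure_pmf W) (count_space UNIV) fst"
    by (rule distr_cong) auto
  moreover have "distr (measure_pmf W) (measure_pmf Q) snd = distr (measure_pmf W) (count_space UNIV) snd"
    by (rule distr_cong) auto
  ultimately show "measure_pmf W \<in> couplings (measure_pmf P) (measure_pmf Q)"
    unfolding couplings_def
    by (simp add: sets_pair_pmf_finite prob_space_measure_pmf map_pmf_rep_eq[symmetric] 1 2)
qed

theorem theorem6:
  fixes PX :: "'a::finite pmf" and PY :: "'b::finite pmf"
    and c :: "'a \<Rightarrow> 'b \<Rightarrow> real"
    and Pstar :: "('a \<times> 'b) measure" and S :: "('a \<times> 'b) set"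
    and \<alpha>\<^sub>0 \<Delta> :: real
  assumes "set_pmf PX = UNIV" and "set_pmf PY = UNIV"
    and "\<And>x y. 0 \<le> c x y"
    and "\<alpha>\<^sub>0 = OT c PX PY"
    and "Min (range (\<lambda>(x, y). c x y)) < \<alpha>\<^sub>0" and "\<alpha>\<^sub>0 < Max (range (\<lambda>(x, y). c x y))"
    and "optimal_coupling c PX PY Pstar" and "S = atoms Pstar"
  shows "ereal (Lambda c S PX PY \<Delta>)
           \<le> liminf (\<lambda>n. ereal (excess_prob c PX PY n (\<alpha>\<^sub>0 + \<Delta> / sqrt (real n)))) \<and>
         liminf (\<lambda>n. ereal (excess_prob c PX PY n (\<alpha>\<^sub>0 + \<Delta> / sqrt (real n))))
           \<le> limsup (\<lambda>n. ereal (excess_prob c PX PY n (\<alpha>\<^sub>0 + \<Delta> / sqrt (real n)))) \<and>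
         limsup (\<lambda>n. ereal (excess_prob c PX PY n (\<alpha>\<^sub>0 + \<Delta> / sqrt (real n))))
           \<le> ereal (Lim (at_left \<Delta>) (\<lambda>\<Delta>'. Lambda c S PX PY \<Delta>'))"
proof -
  define p where "p = (\<chi> z. measure Pstar {z})"
  have Pstar: "Pstar \<in> couplings (measure_pmf PX) (measure_pmf PY)"
    and opt: "\<And>R. R \<in> couplings (measure_pmf PX) (measure_pmf PY) \<Longrightarrow> transport_cost c Pstar \<le> transport_cost c R"
    using assms(7) by (auto simp: optimal_coupling_def)
  note tc = transport_cost_finite[OF Pstar]
  interpret finite_ot PX PY c p S
  proof
    show "0 < pmf PX x" for x using assms(1) by (simp add: pmf_positive)
    show "0 < pmf PY y" for y using assms(2) by (simp add: pmf_positive)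
    show "0 \<le> c x y" for x y by (rule assms(3))
    show "0 \<le> p $ z" for z by (simp add: p_def)
    show "S = {z. 0 < p $ z}" using assms(8) by (simp add: atoms_def p_def)
    show "(\<Sum>y\<in>UNIV. p $ (x, y)) = pmf PX x" for x using tc(2) by (simp add: p_def)
    show "(\<Sum>x\<in>UNIV. p $ (x, y)) = pmf PY y" for y using tc(3) by (simp add: p_def)
    fix q :: "real ^ ('a \<times> 'b)"
    assume "\<And>z. 0 \<le> q $ z" "\<And>x. (\<Sum>y\<in>UNIV. q $ (x, y)) = pmf PX x" "\<And>y. (\<Sum>x\<in>UNIV. q $ (x, y)) = pmf PY y"
    then obtain R where R: "R \<in> couplings (measure_pmf PX) (measure_pmf PY)" "\<And>z. measure R {z} = q $ z"
      by (rule ex_coupling_of_weights) blast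
    show "(\<Sum>(x, y)\<in>UNIV. p $ (x, y) * c x y) \<le> (\<Sum>(x, y)\<in>UNIV. q $ (x, y) * c x y)"
      using opt[OF R(1)] unfolding tc(1) transport_cost_finite(1)[OF R(1)] R(2) by (simp add: p_def)
  qed
  \<comment> \<open>The infimum is attained at \<open>Pstar\<close>, so the centring constant
    \<open>\<alpha>\<^sub>0\<close> is the cost of the weights \<open>p\<close>.\<close>
  have "OT c PX PY = transport_cost c Pstar"
    unfolding OT_def using Pstar opt by (intro cInf_eq_minimum) auto
  then have \<alpha>: "\<alpha>\<^sub>0 = cost p" using assms(4) tc(1) by (simp add: cost_def p_def)
  show ?thesis
    unfolding \<alpha> using Lambda_le_liminf limsup_le_Lim_Lambda
    by (intro conjI Liminf_le_Limsup) simp_all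
qed

end
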